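(* Let $n\in\mathbb{N}^*$ and let $L$ be an i--lattice with $|L|=n$. Then: (1) $|{\rm Con}_{\mathbb{BI}}(L)|\leq 2^{\lfloor n/2\rfloor}$; (2) $|{\rm Con}_{\mathbb{BI}}(L)|=2^{\lfloor n/2\rfloor}$ iff ${\rm Con}_{\mathbb{BI}}(L)\cong{\cal L}_2^{\lfloor n/2\rfloor}$ iff either $L\cong{\cal L}_n$ or ($n\in 2(\mathbb{N}\setminus\{0,1\})$ and $L\cong_{\mathbb{BI}}{\cal L}_{n/2-1}\oplus{\cal L}_2^2\oplus{\cal L}_{n/2-1}$) iff either $|{\rm Con}(L)|=2^{n-1}$ or ($n\geq 2$, $L\not\cong_{\mathbb{BI}}{\cal L}_{\lfloor n/2\rfloor-1}\oplus({\cal L}_3\boxplus{\cal L}_3)\oplus{\cal L}_{\lfloor n/2\rfloor-1}$ and $|{\rm Con}(L)|=2^{n-2}$) iff either ${\rm Con}(L)\cong{\cal L}_2^{n-1}$ or ($n\geq 2$, $L\not\cong_{\mathbb{BI}}{\cal L}_{\lfloor n/2\rfloor-1}\oplus({\cal L}_3\boxplus{\cal L}_3)\oplus{\cal L}_{\lfloor n/2\rfloor-1}$ and ${\rm Con}(L)\cong{\cal L}_2^{n-2}$); (3) if $L$ is a pseudo--Kleene algebra, then: $|{\rm Con}_{\mathbb{BI}}(L)|=2^{\lfloor n/2\rfloor}$ iff ${\rm Con}_{\mathbb{BI}}(L)\cong{\cal L}_2^{\lfloor n/2\rfloor}$ iff either $L\cong{\cal L}_n$ or ($n\in 2(\mathbb{N}\setminus\{0,1\})$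 and $L\cong{\cal L}_{n/2-1}\oplus{\cal L}_2^2\oplus{\cal L}_{n/2-1}$) iff $|{\rm Con}(L)|\in\{2^{n-1},2^{n-2}\}$ iff either ${\rm Con}(L)\cong{\cal L}_2^{n-1}$ or ($n\geq 2$ and ${\rm Con}(L)\cong{\cal L}_2^{n-2}$); (4) $|{\rm Con}_{\mathbb{BI}}(L)|<2^{\lfloor n/2\rfloor}$ iff either ($n\in 2(\mathbb{N}\setminus\{0,1\})$ and $L\cong_{\mathbb{BI}}{\cal L}_{n/2-1}\oplus({\cal L}_3\boxplus{\cal L}_3)\oplus{\cal L}_{n/2-1}$) or $|{\rm Con}(L)|<2^{n-2}$; (5) if $L$ is a pseudo--Kleene algebra, then: $|{\rm Con}_{\mathbb{BI}}(L)|<2^{\lfloor n/2\rfloor}$ iff $|{\rm Con}(L)|<2^{n-2}$ iff $|{\rm Con}(L)|\leq 2^{n-3}$; (6) if ${\rm Con}_{\mathbb{BI}}(L)$ is a Boolean algebra, in particular if ${\rm Con}(L)$ is a Boolean algebra, in particular if $L$ is a modular i--lattice, then: $|{\rm Con}_{\mathbb{BI}}(L)|<2^{\lfloor n/2\rfloor}$ iff $|{\rm Con}_{\mathbb{BI}}(L)|\leq 2^{\lfloor n/2\rfloor-1}$ iff either ($n\in 2(\mathbb{N}\setminus\{0,1\})$ and $L\cong_{\mathbb{BI}}{\cal L}_{n/2-1}\oplus({\cal L}_3\boxplus{\cal L}_3)\oplus{\cal L}_{n/2-1}$) or $|{\rm Con}(L)|<2^{n-2}$ iff either ($n\in 2(\mathbb{N}\setminus\{0,1\})$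 and $L\cong_{\mathbb{BI}}{\cal L}_{n/2-1}\oplus({\cal L}_3\boxplus{\cal L}_3)\oplus{\cal L}_{n/2-1}$) or $|{\rm Con}(L)|\leq 2^{n-3}$; (7) if $L$ is a pseudo--Kleene algebra such that ${\rm Con}_{\mathbb{BI}}(L)$ is a Boolean algebra, in particular if $L$ is a pseudo--Kleene algebra such that ${\rm Con}(L)$ is a Boolean algebra, in particular if $L$ is a modular pseudo--Kleene algebra, then: $|{\rm Con}_{\mathbb{BI}}(L)|<2^{\lfloor n/2\rfloor}$ iff $|{\rm Con}_{\mathbb{BI}}(L)|\leq 2^{\lfloor n/2\rfloor-1}$ iff $|{\rm Con}(L)|<2^{n-2}$ iff $|{\rm Con}(L)|\leq 2^{n-3}$.
   Context: An i--lattice (involution lattice) is a lattice $(L,\vee,\wedge,\leq)$ with a unary operation $'$ such that $a''=a$ and $a\leq b$ implies $b'\leq a'$ for all $a,b$. A bi--lattice is a bounded i--lattice; a pseudo--Kleene algebra is a bi--lattice satisfying $a\wedge a'\leq b\vee b'$ for all $a,b$. ${\rm Con}(L)$ is the lattice of lattice congruences of $L$; ${\rm Con}_{\mathbb{BI}}(L)$ is the lattice of congruences of $L$ with respect to the operations $\vee,\wedge,'$ (i.e. lattice congruences $\theta$ such that $(a,b)\in\theta$ implies $(a',b')\in\theta$; adding the constants $0,1$ does not change this). $\cong$ between lattices denotes lattice isomorphism; $L\cong_{\mathbb{BI}}M$ means there is a lattice isomorphism preserving the involution. ${\cal L}_m$ is the $m$--element chain; $\lfloor x\rfloor$ is the integer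 part; $2(\mathbb{N}\setminus\{0,1\})=\{4,6,8,\ldots\}$. Ordinal sum: for a lattice $A$ with top $1^A$ and a lattice $B$ with bottom $0^B$, $A\oplus B$ is obtained by placing $B$ above $A$ and identifying $1^A$ with $0^B$. For a bounded lattice $M$ (here a chain ${\cal L}_k$), a dual lattice isomorphism $f:M\to M^d$ and a bi--lattice $K$, the bi--lattice $M\oplus K\oplus M^d$ has involution $f$ on $M$, the involution of $K$ on $K$, and $f^{-1}$ on $M^d$. ${\cal L}_2^2$ denotes the four--element Boolean algebra with its Boolean complement as involution. ${\cal L}_3\boxplus{\cal L}_3$ denotes the four--element lattice $\{0,a,b,1\}$ with $a,b$ incomparable, with involution $0'=1$, $1'=0$, $a'=a$, $b'=b$ (horizontal sum of two three--element bi--chains). *)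

theory Defs
  imports Complex_Main
begin

definition lattice_on :: "'a set \<Rightarrow> ('a \<Rightarrow> 'a \<Rightarrow> 'a) \<Rightarrow> ('a \<Rightarrow> 'a \<Rightarrow> 'a) \<Rightarrow> bool" where
  "lattice_on A j m \<longleftrightarrow>
     (\<forall>x\<in>A. \<forall>y\<in>A. j x y \<in> A \<and> m x y \<in> A \<and> j x y = j y x \<and> m x y = m y x
        \<and> j x (m x y) = x \<and> m x (j x y) = x) \<and>
     (\<forall>x\<in>A. \<forall>y\<in>A. \<forall>z\<in>A. j (j x y) z = j x (j y z) \<and> m (m x y) z = m x (m y z))"

definition lat_le :: "('a \<Rightarrow> 'a \<Rightarrow> 'a) \<Rightarrow> 'a \<Rightarrow> 'a \<Rightarrow> bool" where
  "lat_le m x y \<longleftrightarrow> m x y = x"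

definition i_lattice :: "'a set \<Rightarrow> ('a \<Rightarrow> 'a \<Rightarrow> 'a) \<Rightarrow> ('a \<Rightarrow> 'a \<Rightarrow> 'a) \<Rightarrow> ('a \<Rightarrow> 'a) \<Rightarrow> bool" where
  "i_lattice A j m v \<longleftrightarrow> lattice_on A j m \<and> (\<forall>x\<in>A. v x \<in> A \<and> v (v x) = x) \<and>
     (\<forall>x\<in>A. \<forall>y\<in>A. lat_le m x y \<longrightarrow> lat_le m (v y) (v x))"

definition bounded_lat :: "'a set \<Rightarrow> ('a \<Rightarrow> 'a \<Rightarrow> 'a) \<Rightarrow> bool" where
  "bounded_lat A m \<longleftrightarrow> (\<exists>z\<in>A. \<exists>u\<in>A. \<forall>x\<in>A. lat_le m z x \<and> lat_le m x u)"

definition bi_lattice :: "'a set \<Rightarrow> ('a \<Rightarrow> 'a \<Rightarrow> 'a) \<Rightarrow> ('a \<Rightarrow> 'a \<Rightarrow> 'a) \<Rightarrow> ('a \<Rightarrow> 'a) \<Rightarrow> bool" where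
  "bi_lattice A j m v \<longleftrightarrow> i_lattice A j m v \<and> bounded_lat A m"

definition pseudo_kleene :: "'a set \<Rightarrow> ('a \<Rightarrow> 'a \<Rightarrow> 'a) \<Rightarrow> ('a \<Rightarrow> 'a \<Rightarrow> 'a) \<Rightarrow> ('a \<Rightarrow> 'a) \<Rightarrow> bool" where
  "pseudo_kleene A j m v \<longleftrightarrow> bi_lattice A j m v \<and>
     (\<forall>a\<in>A. \<forall>b\<in>A. lat_le m (m a (v a)) (j b (v b)))"

definition modular_lat :: "'a set \<Rightarrow> ('a \<Rightarrow> 'a \<Rightarrow> 'a) \<Rightarrow> ('a \<Rightarrow> 'a \<Rightarrow> 'a) \<Rightarrow> bool" where
  "modular_lat A j m \<longleftrightarrow>
     (\<forall>x\<in>A. \<forall>y\<in>A. \<forall>z\<in>A. lat_le m x z \<longrightarrow> j x (m y z) = m (j x y) z)"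

definition lat_cong :: "'a set \<Rightarrow> ('a \<Rightarrow> 'a \<Rightarrow> 'a) \<Rightarrow> ('a \<Rightarrow> 'a \<Rightarrow> 'a) \<Rightarrow> ('a \<times> 'a) set \<Rightarrow> bool" where
  "lat_cong A j m \<theta> \<longleftrightarrow> equiv A \<theta> \<and>
     (\<forall>a b c d. (a, b) \<in> \<theta> \<and> (c, d) \<in> \<theta> \<longrightarrow> (j a c, j b d) \<in> \<theta> \<and> (m a c, m b d) \<in> \<theta>)"

definition Con :: "'a set \<Rightarrow> ('a \<Rightarrow> 'a \<Rightarrow> 'a) \<Rightarrow> ('a \<Rightarrow> 'a \<Rightarrow> 'a) \<Rightarrow> ('a \<times> 'a) set set" where
  "Con A j m = {\<theta>. lat_cong A j m \<theta>}"

definition ConBI :: "'a set \<Rightarrow> ('a \<Rightarrow> 'a \<Rightarrow> 'a) \<Rightarrow> ('a \<Rightarrow> 'a \<Rightarrow> 'a) \<Rightarrow> ('a \<Rightarrow> 'a) \<Rightarrow> ('a \<times> 'a) set set" where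
  "ConBI A j m v = {\<theta> \<in> Con A j m. \<forall>a b. (a, b) \<in> \<theta> \<longrightarrow> (v a, v b) \<in> \<theta>}"

definition set_lub :: "'b set set \<Rightarrow> 'b set \<Rightarrow> 'b set \<Rightarrow> 'b set \<Rightarrow> bool" where
  "set_lub P x y z \<longleftrightarrow> z \<in> P \<and> x \<subseteq> z \<and> y \<subseteq> z \<and> (\<forall>w\<in>P. x \<subseteq> w \<and> y \<subseteq> w \<longrightarrow> z \<subseteq> w)"

definition set_glb :: "'b set set \<Rightarrow> 'b set \<Rightarrow> 'b set \<Rightarrow> 'b set \<Rightarrow> bool" where
  "set_glb P x y z \<longleftrightarrow> z \<in> P \<and> z \<subseteq> x \<and> z \<subseteq> y \<and> (\<forall>w\<in>P. w \<subseteq> x \<and> w \<subseteq> y \<longrightarrow> w \<subseteq> z)"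

definition boolean_family :: "'b set set \<Rightarrow> bool" where
  "boolean_family P \<longleftrightarrow>
     (\<forall>x\<in>P. \<forall>y\<in>P. (\<exists>z. set_lub P x y z) \<and> (\<exists>z. set_glb P x y z)) \<and>
     (\<forall>x\<in>P. \<forall>y\<in>P. \<forall>z\<in>P. \<forall>u r xy xz.
        set_lub P y z u \<and> set_glb P x u r \<and> set_glb P x y xy \<and> set_glb P x z xz
        \<longrightarrow> set_lub P xy xz r) \<and>
     (\<exists>b\<in>P. \<exists>t\<in>P. (\<forall>x\<in>P. b \<subseteq> x \<and> x \<subseteq> t) \<and>
        (\<forall>x\<in>P. \<exists>y\<in>P. set_lub P x y t \<and> set_glb P x y b))"

text \<open>(P, \<subseteq>) is lattice isomorphic to L_2^k, modelled as the power set of a k-element set.\<close>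

definition iso_L2pow :: "'b set set \<Rightarrow> nat \<Rightarrow> bool" where
  "iso_L2pow P k \<longleftrightarrow> (\<exists>f. bij_betw f P (Pow {..<k}) \<and> (\<forall>x\<in>P. \<forall>y\<in>P. x \<subseteq> y \<longleftrightarrow> f x \<subseteq> f y))"

definition lat_iso :: "'a set \<Rightarrow> ('a \<Rightarrow> 'a \<Rightarrow> 'a) \<Rightarrow> ('a \<Rightarrow> 'a \<Rightarrow> 'a) \<Rightarrow>
    'c set \<Rightarrow> ('c \<Rightarrow> 'c \<Rightarrow> 'c) \<Rightarrow> ('c \<Rightarrow> 'c \<Rightarrow> 'c) \<Rightarrow> ('a \<Rightarrow> 'c) \<Rightarrow> bool" where
  "lat_iso A j m B j' m' f \<longleftrightarrow> bij_betw f A B \<and>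
     (\<forall>x\<in>A. \<forall>y\<in>A. f (j x y) = j' (f x) (f y) \<and> f (m x y) = m' (f x) (f y))"

definition bi_iso :: "'a set \<Rightarrow> ('a \<Rightarrow> 'a \<Rightarrow> 'a) \<Rightarrow> ('a \<Rightarrow> 'a \<Rightarrow> 'a) \<Rightarrow> ('a \<Rightarrow> 'a) \<Rightarrow>
    'c set \<Rightarrow> ('c \<Rightarrow> 'c \<Rightarrow> 'c) \<Rightarrow> ('c \<Rightarrow> 'c \<Rightarrow> 'c) \<Rightarrow> ('c \<Rightarrow> 'c) \<Rightarrow> ('a \<Rightarrow> 'c) \<Rightarrow> bool" where
  "bi_iso A j m v B j' m' v' f \<longleftrightarrow> lat_iso A j m B j' m' f \<and> (\<forall>x\<in>A. f (v x) = v' (f x))"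

definition iso_chain :: "'a set \<Rightarrow> ('a \<Rightarrow> 'a \<Rightarrow> 'a) \<Rightarrow> ('a \<Rightarrow> 'a \<Rightarrow> 'a) \<Rightarrow> nat \<Rightarrow> bool" where
  "iso_chain A j m n \<longleftrightarrow> (\<exists>f. lat_iso A j m {..<n} max min f)"

text \<open>The bi-lattice L_k \<oplus> K \<oplus> L_k^d, where K is the 4-element lattice {0,a,b,1}.
  Elements are pairs (level, tag): levels 0..k-1 form L_k (level k-1 being the bottom of K),
  level k carries the two incomparable atoms (k,0), (k,1) of K, levels k+1..2k form L_k^d
  (level k+1 being the top of K). The involution reverses levels; on the atoms it is the
  swap a'=b if sw (K = L_2^2) and the identity a'=a, b'=b if not sw (K = L_3 \<boxplus> L_3).\<close>

definition gl_car :: "nat \<Rightarrow> (nat \<times> nat) set" where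
  "gl_car k = {(i, 0) | i. i \<le> 2 * k \<and> i \<noteq> k} \<union> {(k, 0), (k, 1)}"

definition gl_join :: "nat \<Rightarrow> nat \<times> nat \<Rightarrow> nat \<times> nat \<Rightarrow> nat \<times> nat" where
  "gl_join k p q = (if fst p < fst q then q else if fst q < fst p then p
                    else if p = q then p else (k + 1, 0))"

definition gl_meet :: "nat \<Rightarrow> nat \<times> nat \<Rightarrow> nat \<times> nat \<Rightarrow> nat \<times> nat" where
  "gl_meet k p q = (if fst p < fst q then p else if fst q < fst p then q
                    else if p = q then p else (k - 1, 0))"

definition gl_inv :: "nat \<Rightarrow> bool \<Rightarrow> nat \<times> nat \<Rightarrow> nat \<times> nat" where
  "gl_inv k sw p = (2 * k - fst p, if fst p = k \<and> sw then 1 - snd p else snd p)"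

definition iso_BI_glued :: "'a set \<Rightarrow> ('a \<Rightarrow> 'a \<Rightarrow> 'a) \<Rightarrow> ('a \<Rightarrow> 'a \<Rightarrow> 'a) \<Rightarrow> ('a \<Rightarrow> 'a) \<Rightarrow>
    nat \<Rightarrow> bool \<Rightarrow> bool" where
  "iso_BI_glued A j m v k sw \<longleftrightarrow>
     (\<exists>f. bi_iso A j m v (gl_car k) (gl_join k) (gl_meet k) (gl_inv k sw) f)"

definition iso_glued :: "'a set \<Rightarrow> ('a \<Rightarrow> 'a \<Rightarrow> 'a) \<Rightarrow> ('a \<Rightarrow> 'a \<Rightarrow> 'a) \<Rightarrow> nat \<Rightarrow> bool" where
  "iso_glued A j m k \<longleftrightarrow> (\<exists>f. lat_iso A j m (gl_car k) (gl_join k) (gl_meet k) f)"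

end

theory Submission
  imports Defs
begin

text \<open>
  A congruence of a finite lattice is determined by the join-irreducible elements \<open>p\<close> that it
  identifies with their lower covers; this turns \<open>Con(L)\<close>, and with it its sublattice
  \<open>Con\<^sub>B\<^sub>I(L)\<close>, into a ring of sets of join-irreducibles.

  Upper bound: the number of congruence classes not fixed by the involution is even and strictly
  decreases along strict inclusions in \<open>Con\<^sub>B\<^sub>I(L)\<close>, so half of it is a rank function that is at
  most \<open>n div 2\<close> at the bottom. By distributivity, a rank function bounds the size of the lattice
  by a power of two. If the bound is attained, every edge is collapsed by an atom, and an atom merges
  so few classes that each incomparable pair \<open>x\<close>, \<open>y\<close> must satisfy \<open>y = v x\<close>; this leaves only
  chains and chains with one swapped incomparable pair.

  Gap below \<open>2\<^bsup>n-2\<^esup>\<close>: if \<open>L\<close> is not a chain, it has at most \<open>n - 2\<close> join-irreducibles. When there are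
  exactly \<open>n - 2\<close>, all incomparable pairs have the same join \<open>w\<close> and the same meet \<open>z\<close>, and
  implications between the edges of the interval from \<open>z\<close> to \<open>w\<close> push the number of congruences
  down to \<open>2\<^bsup>n-3\<^esup>\<close>, unless this interval is the four-element Boolean lattice or the pentagon. In the
  pentagon the involution fixes the short side and swaps the two inner elements of the long side, so
  \<open>L\<close> is not pseudo-Kleene, and \<open>Con\<^sub>B\<^sub>I(L)\<close> is not Boolean.
\<close>

text \<open>Congruences become rings of sets because a chain of steps taken from two congruences can
  enter the up-set of a join-irreducible \<open>p\<close> only if one of the two already collapses
  \<open>p\<close>. Equality in the size bound is rigid: the first doubling is tight at every atom,
  which gives each atom a complement. Hence every join-irreducible edge is collapsed by some atom,
  and every atom has a budget of exactly two redundant points. The gap is delicate because of a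
  single shape. If collapsing either of two covers of \<open>z\<close> collapses one further inner
  element, up to 5/8 of all sets of join-irreducibles survive, which is more than half; with two
  further elements at most 7/16 survive. So only the pentagon, with five elements and five
  congruences as the smallest instance, can exceed 2^(n-3). This is why the strict bound 2^(n-2)
  appears for arbitrary i-lattices and the halved bound only under the pseudo-Kleene or Boolean
  hypothesis.\<close>

section \<open>Counting in finite sets and set families\<close>

lemma finite_minimal_set:
  assumes "finite P" "x0 \<in> P" "Q x0"
  obtains x where "x \<in> P" "Q x" "\<And>y. y \<in> P \<Longrightarrow> Q y \<Longrightarrow> y \<subseteq> x \<Longrightarrow> y = x"
proof -
  have "finite {x \<in> P. Q x}" "{x \<in> P. Q x} \<noteq> {}" using assms by auto
  from finite_has_minimal[OF this] show ?thesis using that by blast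
qed

lemma even_card_involution:
  assumes "finite X" "\<And>x. x \<in> X \<Longrightarrow> f x \<in> X \<and> f (f x) = x \<and> f x \<noteq> x"
  shows "even (card X)"
  using assms
proof (induction "card X" arbitrary: X rule: less_induct)
  case less
  show ?case
  proof (cases "X = {}")
    case False
    then obtain x where x: "x \<in> X" by auto
    let ?Y = "X - {x, f x}"
    have sub: "{x, f x} \<subseteq> X" and two: "card {x, f x} = 2"
      using x less.prems(2)[OF x] by auto
    have cX: "card X = card ?Y + 2"
      using card_Diff_subset[OF _ sub] card_mono[OF less.prems(1) sub] two by simp
    have "even (card ?Y)"
    proof (rule less.hyps)
      show "card ?Y < card X" using cX by simp
      show "finite ?Y" using less.prems(1) by simp
      show "f y \<in> ?Y \<and> f (f y) = y \<and> f y \<noteq> y" if "y \<in> ?Y" for y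
      proof -
        have y: "y \<in> X" "y \<noteq> x" "y \<noteq> f x" using that by auto
        have "f y \<noteq> x" "f y \<noteq> f x"
          using y less.prems(2)[OF x] less.prems(2)[OF y(1)] by metis+
        then show ?thesis using less.prems(2)[OF y(1)] by blast
      qed
    qed
    with cX show ?thesis by simp
  qed simp
qed

lemma card_between_sets:
  assumes "finite C" "B \<subseteq> C"
  shows "card {S. B \<subseteq> S \<and> S \<subseteq> C} = 2 ^ (card C - card B)"
proof -
  have "bij_betw (\<lambda>S. S - B) {S. B \<subseteq> S \<and> S \<subseteq> C} (Pow (C - B))"
    using assms by (intro bij_betw_byWitness[where f' = "\<lambda>S. S \<union> B"]) auto
  then have "card {S. B \<subseteq> S \<and> S \<subseteq> C} = card (Pow (C - B))" by (rule bij_betw_same_card)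
  also have "\<dots> = 2 ^ (card C - card B)"
    using assms by (simp add: card_Pow card_Diff_subset finite_subset)
  finally show ?thesis .
qed

text \<open>Deleting \<open>p\<close> loses nothing, since membership of \<open>q\<close> restores
  it. Meant for two join-irreducibles that are collapsed by the same congruences.\<close>

lemma card_family_equivalent:
  assumes "finite J" "G \<subseteq> Pow J" "p \<in> J" "q \<in> J" "p \<noteq> q" "\<And>S. S \<in> G \<Longrightarrow> p \<in> S \<longleftrightarrow> q \<in> S"
  shows "card G \<le> 2 ^ (card J - 1)"
proof -
  have "inj_on (\<lambda>S. S - {p}) G"
  proof (rule inj_onI)
    fix S S' assume S: "S \<in> G" "S' \<in> G" and eq: "S - {p} = S' - {p}"
    then have "q \<in> S \<longleftrightarrow> q \<in> S'" using \<open>p \<noteq> q\<close> by blast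
    then have "p \<in> S \<longleftrightarrow> p \<in> S'" using assms(6) S by blast
    then show "S = S'" using eq by blast
  qed
  moreover have "(\<lambda>S. S - {p}) ` G \<subseteq> Pow (J - {p})" using assms(2) by blast
  moreover have "finite (Pow (J - {p}))" using assms(1) by simp
  ultimately have "card G \<le> card (Pow (J - {p}))" by (rule card_inj_on_le)
  then show ?thesis using assms(1,3) by (simp add: card_Pow)
qed

text \<open>With \<open>N = card J - 4\<close>, there are at most 4 * 2^N members avoiding both
  \<open>p\<close> and \<open>q\<close>, 2^N with \<open>q\<close> but not \<open>p\<close>, and 2 *
  2^N with \<open>p\<close>. The total 7 * 2^N stays below the 8 * 2^N of the claim. One forced
  element alone would leave 5/8 of the power set, which is too many.\<close>

lemma card_family_two_force_two:
  assumes J: "finite J" "G \<subseteq> Pow J" and in_J: "{p, q, s, t} \<subseteq> J" and four: "card {p, q, s, t} = 4"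
    and force: "\<And>S. S \<in> G \<Longrightarrow> p \<in> S \<or> q \<in> S \<Longrightarrow> s \<in> S \<and> t \<in> S"
  shows "card G \<le> 2 ^ (card J - 1)"
proof -
  have dist: "p \<noteq> q" "p \<noteq> s" "p \<noteq> t" "q \<noteq> s" "q \<noteq> t" "s \<noteq> t"
    using four by (auto simp: card_insert_if split: if_splits)
  define N where "N = card J - 4"
  have N: "card J = N + 4" using card_mono[OF J(1) in_J] four unfolding N_def by simp
  let ?X = "{S. {} \<subseteq> S \<and> S \<subseteq> J - {p, q}}"
  let ?Y = "{S. {q, s, t} \<subseteq> S \<and> S \<subseteq> J - {p}}"
  let ?Z = "{S. {p, s, t} \<subseteq> S \<and> S \<subseteq> J}"
  have fin: "finite ?X" "finite ?Y" "finite ?Z"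
    using J(1) by (auto intro: finite_subset[of _ "Pow J"])
  have "card ?X = 2 ^ (N + 2)"
    using in_J J(1) dist N by (subst card_between_sets) (auto simp: card_Diff_subset)
  moreover have "card ?Y = 2 ^ N"
    using in_J J(1) dist N by (subst card_between_sets) (auto simp: card_Diff_subset)
  moreover have "card ?Z = 2 ^ (N + 1)"
    using in_J J(1) dist N by (subst card_between_sets) auto
  moreover have "G \<subseteq> ?X \<union> ?Y \<union> ?Z"
  proof
    fix S assume S: "S \<in> G"
    then have "S \<subseteq> J" using J(2) by blast
    then show "S \<in> ?X \<union> ?Y \<union> ?Z" using force[OF S] by blast
  qed
  then have "card G \<le> card (?X \<union> ?Y \<union> ?Z)" using fin by (intro card_mono) (auto simp only: finite_Un)
  moreover have "card (?X \<union> ?Y \<union> ?Z) \<le> card ?X + card ?Y + card ?Z"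
    by (meson card_Un_le add_right_mono order_trans)
  ultimately have "card G \<le> 2 ^ (N + 2) + 2 ^ N + 2 ^ (N + 1)" by simp
  also have "\<dots> \<le> (2::nat) ^ (N + 3)" by (simp add: power_add)
  finally show ?thesis using N by (simp add: add.commute)
qed

lemma iso_L2powI:
  assumes "finite T" "card T = k" "bij_betw g P (Pow T)"
    and "\<And>x y. x \<in> P \<Longrightarrow> y \<in> P \<Longrightarrow> x \<subseteq> y \<longleftrightarrow> g x \<subseteq> g y"
  shows "iso_L2pow P k"
proof -
  obtain h where h: "bij_betw h T {..<k}"
    using assms(1,2) by (metis finite_same_card_bij finite_lessThan card_lessThan)
  have "bij_betw ((`) h) (Pow T) (Pow {..<k})"
    using h by (rule bij_betw_Pow)
  with assms(3) have "bij_betw ((`) h \<circ> g) P (Pow {..<k})" by (rule bij_betw_trans)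
  moreover have "x \<subseteq> y \<longleftrightarrow> ((`) h \<circ> g) x \<subseteq> ((`) h \<circ> g) y" if "x \<in> P" "y \<in> P" for x y
  proof -
    have "g x \<subseteq> T" "g y \<subseteq> T" using assms(3) that by (auto simp: bij_betw_def)
    then have "h ` g x \<subseteq> h ` g y \<longleftrightarrow> g x \<subseteq> g y"
      using h by (metis bij_betw_imp_inj_on image_mono inj_on_image_mem_iff subset_iff)
    then show ?thesis using assms(4)[OF that] by simp
  qed
  ultimately show ?thesis unfolding iso_L2pow_def by blast
qed

lemma card_iso_L2pow: "iso_L2pow P k \<Longrightarrow> card P = 2 ^ k"
  unfolding iso_L2pow_def by (metis bij_betw_same_card card_Pow finite_lessThan card_lessThan)

section \<open>Finite families represented by rings of sets\<close>

text \<open>Members of \<open>P\<close> are ordered by inclusion, but a join may be larger than the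
  union; for congruences it is a transitive closure. The encoding \<open>E\<close> turns both
  operations into set operations, so distributivity comes for free. The same map \<open>coll\<close>
  serves as \<open>E\<close> for all congruences and for the involution-invariant ones.\<close>

locale set_ring_representation =
  fixes P :: "'b set set" and E :: "'b set \<Rightarrow> 'e set" and b t :: "'b set"
  assumes finite_P: "finite P"
    and embed: "x \<in> P \<Longrightarrow> y \<in> P \<Longrightarrow> E x \<subseteq> E y \<longleftrightarrow> x \<subseteq> y"
    and ex_Un: "x \<in> P \<Longrightarrow> y \<in> P \<Longrightarrow> \<exists>z\<in>P. E z = E x \<union> E y"
    and ex_Int: "x \<in> P \<Longrightarrow> y \<in> P \<Longrightarrow> \<exists>z\<in>P. E z = E x \<inter> E y"
    and b_in: "b \<in> P" and E_b: "E b = {}"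
    and t_in: "t \<in> P" and E_t: "x \<in> P \<Longrightarrow> E x \<subseteq> E t"
begin

lemma E_inject: "x \<in> P \<Longrightarrow> y \<in> P \<Longrightarrow> E x = E y \<longleftrightarrow> x = y"
  using embed by (metis subset_antisym subset_refl)

lemma set_lub_iff:
  assumes "x \<in> P" "y \<in> P"
  shows "set_lub P x y z \<longleftrightarrow> z \<in> P \<and> E z = E x \<union> E y"
proof -
  obtain u where u: "u \<in> P" "E u = E x \<union> E y" using ex_Un assms by blast
  have "set_lub P x y u"
    unfolding set_lub_def using u assms by (auto simp flip: embed)
  then have "set_lub P x y z \<longleftrightarrow> z = u"
    unfolding set_lub_def by (meson subset_antisym)
  moreover have "z \<in> P \<and> E z = E u \<longleftrightarrow> z = u" using E_inject u(1) by blast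
  ultimately show ?thesis using u(2) by simp
qed

lemma set_glb_iff:
  assumes "x \<in> P" "y \<in> P"
  shows "set_glb P x y z \<longleftrightarrow> z \<in> P \<and> E z = E x \<inter> E y"
proof -
  obtain u where u: "u \<in> P" "E u = E x \<inter> E y" using ex_Int assms by blast
  have "set_glb P x y u"
    unfolding set_glb_def using u assms by (auto simp flip: embed)
  then have "set_glb P x y z \<longleftrightarrow> z = u"
    unfolding set_glb_def by (meson subset_antisym)
  moreover have "z \<in> P \<and> E z = E u \<longleftrightarrow> z = u" using E_inject u(1) by blast
  ultimately show ?thesis using u(2) by simp
qed

text \<open>Rings of sets are distributive, so only complements are at stake. As the bounds are
  encoded by the empty set and \<open>E t\<close>, a complement of \<open>x\<close> can only be
  encoded by \<open>E t - E x\<close>.\<close>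

lemma boolean_family_iff: "boolean_family P \<longleftrightarrow> (\<forall>x\<in>P. \<exists>y\<in>P. E y = E t - E x)"
proof
  assume "boolean_family P"
  then obtain b' t' where bt: "b' \<in> P" "t' \<in> P" "\<And>x. x \<in> P \<Longrightarrow> b' \<subseteq> x \<and> x \<subseteq> t'"
    and compl: "\<And>x. x \<in> P \<Longrightarrow> \<exists>y\<in>P. set_lub P x y t' \<and> set_glb P x y b'"
    unfolding boolean_family_def by (elim conjE bexE) (erule (1) that; erule (1) bspec)
  have "E b' \<subseteq> E b" "E t \<subseteq> E t'" using bt b_in t_in by (simp_all add: embed)
  then have "E b' = {}" "E t' = E t" using E_b E_t[OF bt(2)] by auto
  show "\<forall>x\<in>P. \<exists>y\<in>P. E y = E t - E x"
  proof
    fix x assume x: "x \<in> P"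
    then obtain y where y: "y \<in> P" "set_lub P x y t'" "set_glb P x y b'" using compl[OF x] by auto
    then have "E t = E x \<union> E y" "{} = E x \<inter> E y"
      using set_lub_iff[OF x y(1)] set_glb_iff[OF x y(1)] y(2,3) \<open>E b' = {}\<close> \<open>E t' = E t\<close> by auto
    then show "\<exists>y\<in>P. E y = E t - E x" using y(1) by blast
  qed
next
  assume compl: "\<forall>x\<in>P. \<exists>y\<in>P. E y = E t - E x"
  have ex: "\<forall>x\<in>P. \<forall>y\<in>P. (\<exists>z. set_lub P x y z) \<and> (\<exists>z. set_glb P x y z)"
    using ex_Un ex_Int by (simp add: set_lub_iff set_glb_iff Bex_def)
  have dist: "\<forall>x\<in>P. \<forall>y\<in>P. \<forall>z\<in>P. \<forall>u r xy xz.
      set_lub P y z u \<and> set_glb P x u r \<and> set_glb P x y xy \<and> set_glb P x z xz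
      \<longrightarrow> set_lub P xy xz r"
  proof (intro ballI allI impI, elim conjE)
    fix x y z u r xy xz
    assume in_P: "x \<in> P" "y \<in> P" "z \<in> P"
      and *: "set_lub P y z u" "set_glb P x u r" "set_glb P x y xy" "set_glb P x z xz"
    have u: "u \<in> P" "E u = E y \<union> E z" using * in_P by (simp_all add: set_lub_iff)
    then have "r \<in> P" "E r = E x \<inter> E u" using * in_P by (simp_all add: set_glb_iff)
    moreover have "xy \<in> P" "E xy = E x \<inter> E y" "xz \<in> P" "E xz = E x \<inter> E z"
      using * in_P by (simp_all add: set_glb_iff)
    ultimately show "set_lub P xy xz r" using u by (simp add: set_lub_iff Int_Un_distrib)
  qed
  have "\<exists>y\<in>P. set_lub P x y t \<and> set_glb P x y b" if x: "x \<in> P" for x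
  proof -
    obtain y where y: "y \<in> P" "E y = E t - E x" using bspec[OF compl x] by auto
    then have "set_lub P x y t" "set_glb P x y b"
      using x E_t[OF x] E_b b_in t_in by (auto simp: set_lub_iff set_glb_iff)
    then show ?thesis using y by auto
  qed
  then have bounds: "(\<forall>x\<in>P. b \<subseteq> x \<and> x \<subseteq> t) \<and>
      (\<forall>x\<in>P. \<exists>y\<in>P. set_lub P x y t \<and> set_glb P x y b)"
    using b_in t_in E_b E_t by (simp flip: embed)
  show "boolean_family P" unfolding boolean_family_def
    by (intro conjI[OF ex] conjI[OF dist])
      (rule bexI[OF _ b_in], rule bexI[OF _ t_in], rule bounds)
qed

lemma E_mono: "x \<in> P \<Longrightarrow> y \<in> P \<Longrightarrow> x \<subseteq> y \<Longrightarrow> E x \<subseteq> E y"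
  by (simp add: embed)

lemma E_reflect: "x \<in> P \<Longrightarrow> y \<in> P \<Longrightarrow> E x \<subseteq> E y \<Longrightarrow> x \<subseteq> y"
  by (simp add: embed)

lemma E_nonempty: "x \<in> P \<Longrightarrow> x \<noteq> b \<Longrightarrow> E x \<noteq> {}"
  using E_inject[OF _ b_in] E_b by simp

lemma b_le: "x \<in> P \<Longrightarrow> b \<subseteq> x"
  using E_reflect[OF b_in] E_b by simp

section \<open>Atoms and complements in a ring of sets\<close>

definition atom :: "'b set \<Rightarrow> bool" where
  "atom x \<longleftrightarrow> x \<in> P \<and> x \<noteq> b \<and> (\<forall>y\<in>P. y \<subseteq> x \<longrightarrow> y = b \<or> y = x)"

lemma atom_in: "atom a \<Longrightarrow> a \<in> P"
  and atom_neq: "atom a \<Longrightarrow> a \<noteq> b"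
  and atom_cases: "atom a \<Longrightarrow> y \<in> P \<Longrightarrow> y \<subseteq> a \<Longrightarrow> y = b \<or> y = a"
  unfolding atom_def by simp_all

lemma ex_atom_below:
  assumes "x \<in> P" "x \<noteq> b"
  obtains a where "atom a" "a \<subseteq> x"
proof -
  obtain a where a: "a \<in> P" "a \<noteq> b \<and> a \<subseteq> x"
    and min: "\<And>y. y \<in> P \<Longrightarrow> y \<noteq> b \<and> y \<subseteq> x \<Longrightarrow> y \<subseteq> a \<Longrightarrow> y = a"
    by (rule finite_minimal_set[OF finite_P assms(1), where Q = "\<lambda>y. y \<noteq> b \<and> y \<subseteq> x"])
      (use assms in simp, rule that)
  have "atom a" unfolding atom_def
  proof (intro conjI ballI impI)
    fix y assume "y \<in> P" "y \<subseteq> a"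
    then show "y = b \<or> y = a" using min[of y] a(2) order_trans[of y a x] by metis
  qed (use a in auto)
  then show ?thesis using that a(2) by simp
qed

text \<open>The intersection of \<open>E a\<close> and \<open>E x\<close> encodes a member below
  \<open>a\<close>; as it contains \<open>e\<close>, this member is not \<open>b\<close>, so it is
  \<open>a\<close>. In particular, distinct atoms have disjoint encodings.\<close>

lemma atom_Int:
  assumes a: "atom a" and x: "x \<in> P" and "e \<in> E a" "e \<in> E x"
  shows "a \<subseteq> x"
proof -
  obtain z where z: "z \<in> P" "E z = E a \<inter> E x" using ex_Int[OF atom_in[OF a] x] by auto
  then have "z \<subseteq> a" using E_reflect[OF z(1) atom_in[OF a]] by simp
  moreover have "z \<noteq> b" using assms(3,4) z E_b by auto
  ultimately have "z = a" using atom_cases[OF a z(1)] by simp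
  then show ?thesis using z(2) E_reflect[OF atom_in[OF a] x] Int_lower2[of "E a" "E x"] by simp
qed

text \<open>Let \<open>x\<close> be minimal with \<open>e\<close> in \<open>E x\<close>, let
  \<open>a\<close> be an atom below \<open>x\<close> and \<open>y\<close> its complement. If
  \<open>e\<close> were outside \<open>E a\<close>, the meet of \<open>x\<close> and
  \<open>y\<close> would still contain \<open>e\<close>, and minimality would put \<open>x\<close>,
  hence \<open>a\<close>, below \<open>y\<close>. Complements are asked of atoms only because that
  is what \<open>extremal_atom\<close> delivers.\<close>

lemma atomistic_if_complemented:
  assumes compl: "\<And>a. atom a \<Longrightarrow> \<exists>y\<in>P. E y = E t - E a" and e: "e \<in> E t"
  obtains a where "atom a" "e \<in> E a"
proof -
  obtain x where x: "x \<in> P" "e \<in> E x"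
    and min: "\<And>y. y \<in> P \<Longrightarrow> e \<in> E y \<Longrightarrow> y \<subseteq> x \<Longrightarrow> y = x"
    by (rule finite_minimal_set[OF finite_P t_in, where Q = "\<lambda>y. e \<in> E y"]) (rule e, rule that)
  then have "x \<noteq> b" using E_b by auto
  then obtain a where a: "atom a" "a \<subseteq> x" using ex_atom_below[OF x(1)] by metis
  obtain y where y: "y \<in> P" "E y = E t - E a" using compl[OF a(1)] by auto
  have "e \<in> E a"
  proof (rule ccontr)
    assume "e \<notin> E a"
    obtain z where z: "z \<in> P" "E z = E y \<inter> E x" using ex_Int[OF y(1) x(1)] by auto
    then have "e \<in> E z" "z \<subseteq> x" using y e \<open>e \<notin> E a\<close> x E_reflect[OF z(1) x(1)] by auto
    then have "E x \<subseteq> E y" using min[OF z(1)] z(2) by auto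
    moreover have "E a \<subseteq> E x" using E_mono[OF atom_in[OF a(1)] x(1) a(2)] .
    ultimately show False using y E_nonempty[OF atom_in atom_neq] a(1) by blast
  qed
  then show ?thesis using that a(1) by simp
qed

text \<open>The isomorphism sends \<open>x\<close> to the atoms below it: atoms cover
  \<open>E x\<close>, so it reflects the order, and unions of atoms exist, so it is onto. The
  exponent is left open; each use recovers what it needs from the cardinality.\<close>

lemma iso_L2pow_if_complemented:
  assumes "\<And>a. atom a \<Longrightarrow> \<exists>y\<in>P. E y = E t - E a"
  obtains k where "iso_L2pow P k"
proof -
  let ?T = "{a. atom a}" and ?g = "\<lambda>x. {a. atom a \<and> a \<subseteq> x}"
  have finT: "finite ?T" using finite_P by (rule finite_subset[rotated]) (auto simp: atom_def)
  have ord: "x \<subseteq> y \<longleftrightarrow> ?g x \<subseteq> ?g y" if xy: "x \<in> P" "y \<in> P" for x y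
  proof
    assume sub: "?g x \<subseteq> ?g y"
    have "E x \<subseteq> E y"
    proof
      fix e assume e: "e \<in> E x"
      then have "e \<in> E t" using E_t[OF xy(1)] by (rule set_rev_mp)
      then obtain a where a: "atom a" "e \<in> E a"
        by (rule atomistic_if_complemented[OF assms, rotated])
      then have "a \<subseteq> x" using atom_Int[OF _ xy(1)] e by simp
      then have "a \<subseteq> y" using sub a(1) by auto
      then show "e \<in> E y" using E_mono[OF atom_in[OF a(1)] xy(2)] a(2) by auto
    qed
    then show "x \<subseteq> y" by (rule E_reflect[OF xy])
  qed auto
  have "S \<in> ?g ` P" if S: "S \<subseteq> ?T" for S
  proof -
    have "finite S" using S finT by (rule finite_subset)
    then have "\<exists>z\<in>P. E z = (\<Union>a\<in>S. E a)" using S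
    proof (induction S rule: finite_induct)
      case empty then show ?case using b_in E_b by auto
    next
      case (insert a S)
      then obtain z where "z \<in> P" "E z = (\<Union>a\<in>S. E a)" by auto
      moreover have "a \<in> P" using insert.prems atom_in by auto
      ultimately show ?case using ex_Un[of a z] by auto
    qed
    then obtain z where z: "z \<in> P" "E z = (\<Union>a\<in>S. E a)" by auto
    \<comment> \<open>Encodings of atoms are disjoint, so the union over \<open>S\<close> lies above
      no atom outside \<open>S\<close>.\<close>
    have "a \<in> S" if a: "atom a" "a \<subseteq> z" for a
    proof -
      note aP = atom_in[OF a(1)]
      obtain e where e: "e \<in> E a" using E_nonempty[OF aP atom_neq] a(1) by blast
      then have "e \<in> E z" using E_mono[OF aP z(1) a(2)] by auto
      then obtain s where s: "s \<in> S" "e \<in> E s" using z by auto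
      then have "atom s" using S by auto
      then have "a = s" using atom_Int[OF a(1) atom_in e s(2)] atom_Int[OF _ aP s(2) e] by simp
      then show "a \<in> S" using s by simp
    qed
    moreover have "atom a \<and> a \<subseteq> z" if "a \<in> S" for a
    proof -
      have "atom a" "E a \<subseteq> E z" using that S z by auto
      then show ?thesis using E_reflect[OF atom_in z(1)] by simp
    qed
    ultimately have "?g z = S" by auto
    then show "S \<in> ?g ` P" using z(1) by auto
  qed
  then have "?g ` P = Pow ?T" by auto
  moreover have "inj_on ?g P"
    using ord by (intro inj_onI subset_antisym) (simp_all only: order_refl)
  ultimately have "bij_betw ?g P (Pow ?T)" by (simp add: bij_betw_def)
  then have "iso_L2pow P (card ?T)" by (rule iso_L2powI[OF finT refl]) (rule ord)
  then show ?thesis by (rule that)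
qed

text \<open>An element \<open>a\<close> covering \<open>x\<close> splits the up-set of \<open>x\<close>; by distributivity, adjoining \<open>a\<close>
  embeds the part not above \<open>a\<close> into the part above \<open>a\<close>.\<close>

lemma cover_split:
  assumes x: "x \<in> P" and a: "a \<in> P" and "x \<subset> a"
    and cov: "\<And>y. y \<in> P \<Longrightarrow> x \<subseteq> y \<Longrightarrow> y \<subseteq> a \<Longrightarrow> y = x \<or> y = a"
  defines "N \<equiv> {y \<in> P. x \<subseteq> y \<and> \<not> a \<subseteq> y}"
  obtains u where "inj_on u N" "u ` N \<subseteq> {y \<in> P. a \<subseteq> y}"
    "\<forall>y\<in>N. E (u y) = E y \<union> E a \<and> E y \<inter> E a = E x"
proof -
  have "\<forall>y\<in>N. \<exists>u. u \<in> P \<and> E u = E y \<union> E a"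
    using ex_Un[OF _ a] unfolding N_def by auto
  then obtain u where u: "\<And>y. y \<in> N \<Longrightarrow> u y \<in> P" "\<And>y. y \<in> N \<Longrightarrow> E (u y) = E y \<union> E a"
    by (metis bchoice)
  have int: "E y \<inter> E a = E x" if y: "y \<in> N" for y
  proof -
    have yP: "y \<in> P" "x \<subseteq> y" "\<not> a \<subseteq> y" using y N_def by auto
    obtain z where z: "z \<in> P" "E z = E y \<inter> E a" using ex_Int[OF yP(1) a] by auto
    have "x \<subseteq> z" using E_reflect[OF x z(1)] E_mono[OF x] yP a \<open>x \<subset> a\<close> z(2) by simp
    moreover have "z \<subseteq> a" "z \<subseteq> y" using E_reflect[OF z(1)] a yP z(2) by simp_all
    ultimately have "z = x" using cov[OF z(1)] yP(3) by auto
    then show ?thesis using z by simp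
  qed
  have "inj_on u N"
  proof (rule inj_onI)
    fix y y' assume y: "y \<in> N" "y' \<in> N" "u y = u y'"
    then have "E y \<union> E a = E y' \<union> E a" "E y \<inter> E a = E y' \<inter> E a"
      using u(2)[OF y(1)] u(2)[OF y(2)] int[OF y(1)] int[OF y(2)] by simp_all
    then have "E y = E y'" by blast
    then show "y = y'" using y E_inject[of y y'] N_def by simp
  qed
  moreover have "u ` N \<subseteq> {y \<in> P. a \<subseteq> y}" using u E_reflect[OF a] by (simp add: image_subset_iff)
  ultimately show ?thesis by (rule that) (use u int in simp_all)
qed

section \<open>Size bounds from a rank function\<close>

context
  fixes r :: "'b set \<Rightarrow> nat"
  assumes rank: "\<And>x y. x \<in> P \<Longrightarrow> y \<in> P \<Longrightarrow> x \<subset> y \<Longrightarrow> r y < r x"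
begin

lemma card_above_split:
  assumes "x \<in> P" "a \<in> P" "x \<subset> a" "\<And>y. y \<in> P \<Longrightarrow> x \<subseteq> y \<Longrightarrow> y \<subseteq> a \<Longrightarrow> y = x \<or> y = a"
  shows "card {y \<in> P. x \<subseteq> y} = card {y \<in> P. x \<subseteq> y \<and> \<not> a \<subseteq> y} + card {y \<in> P. a \<subseteq> y}"
    and "card {y \<in> P. x \<subseteq> y \<and> \<not> a \<subseteq> y} \<le> card {y \<in> P. a \<subseteq> y}"
proof -
  have "{y \<in> P. x \<subseteq> y} = {y \<in> P. x \<subseteq> y \<and> \<not> a \<subseteq> y} \<union> {y \<in> P. a \<subseteq> y}" using assms(3) by auto
  moreover have "{y \<in> P. x \<subseteq> y \<and> \<not> a \<subseteq> y} \<inter> {y \<in> P. a \<subseteq> y} = {}" by auto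
  ultimately show "card {y \<in> P. x \<subseteq> y} = card {y \<in> P. x \<subseteq> y \<and> \<not> a \<subseteq> y} + card {y \<in> P. a \<subseteq> y}"
    using finite_P by (simp add: card_Un_disjoint)
  obtain u where "inj_on u {y \<in> P. x \<subseteq> y \<and> \<not> a \<subseteq> y}"
    "u ` {y \<in> P. x \<subseteq> y \<and> \<not> a \<subseteq> y} \<subseteq> {y \<in> P. a \<subseteq> y}"
    by (rule cover_split[OF assms])
  then show "card {y \<in> P. x \<subseteq> y \<and> \<not> a \<subseteq> y} \<le> card {y \<in> P. a \<subseteq> y}"
    by (rule card_inj_on_le) (simp add: finite_P)
qed

text \<open>The up-set of \<open>x\<close> is at most twice as large as that of a cover
  \<open>a\<close>, while the rank drops by at least one on the way from \<open>x\<close> to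
  \<open>a\<close>.\<close>

lemma card_above_le: "x \<in> P \<Longrightarrow> card {y \<in> P. x \<subseteq> y} \<le> 2 ^ r x"
proof (induction "r x" arbitrary: x rule: less_induct)
  case less
  show ?case
  proof (cases "\<exists>y\<in>P. x \<subset> y")
    case True
    then obtain y where y: "y \<in> P" "x \<subset> y" by auto
    obtain a where a: "a \<in> P" "x \<subset> a"
      and min: "\<And>y. y \<in> P \<Longrightarrow> x \<subset> y \<Longrightarrow> y \<subseteq> a \<Longrightarrow> y = a"
      by (rule finite_minimal_set[OF finite_P y(1), where Q = "\<lambda>y. x \<subset> y"]) (rule y, rule that)
    have cov: "y = x \<or> y = a" if "y \<in> P" "x \<subseteq> y" "y \<subseteq> a" for y
      using min[OF that(1) _ that(3)] that(2) by auto
    have ra: "r a < r x" using rank[OF less.prems a] .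
    note card_above_split[OF less.prems a cov]
    then have "card {y \<in> P. x \<subseteq> y} \<le> 2 * card {y \<in> P. a \<subseteq> y}" by linarith
    also have "\<dots> \<le> 2 * 2 ^ r a" using less.hyps[OF ra a(1)] by simp
    also have "\<dots> = 2 ^ Suc (r a)" by simp
    also have "\<dots> \<le> 2 ^ r x" using ra by (intro power_increasing) auto
    finally show ?thesis .
  next
    case False
    then have "{y \<in> P. x \<subseteq> y} = {x}" using less.prems by auto
    then show ?thesis by simp
  qed
qed

lemma above_b: "{y \<in> P. b \<subseteq> y} = P"
  using b_le by auto

lemma card_le_rank: "card P \<le> 2 ^ r b"
  using card_above_le[OF b_in] by (simp add: above_b)

text \<open>Equality makes the doubling from \<open>b\<close> to \<open>a\<close> tight. So the rank
  drops by exactly one and the embedding of \<open>cover_split\<close> is onto; the element that it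
  sends to \<open>t\<close> is the complement of \<open>a\<close>.\<close>

lemma extremal_atom:
  assumes ext: "card P = 2 ^ r b" and a: "atom a"
  shows "Suc (r a) = r b" and "\<exists>y\<in>P. E y = E t - E a"
proof -
  note aP = atom_in[OF a]
  have ba: "b \<subset> a" using b_le[OF aP] atom_neq[OF a] by auto
  have cov: "\<And>y. y \<in> P \<Longrightarrow> b \<subseteq> y \<Longrightarrow> y \<subseteq> a \<Longrightarrow> y = b \<or> y = a"
    using atom_cases[OF a] .
  let ?N = "{y \<in> P. b \<subseteq> y \<and> \<not> a \<subseteq> y}" and ?M = "{y \<in> P. a \<subseteq> y}"
  note split = card_above_split[OF b_in aP ba cov, unfolded above_b]
  have ra: "r a < r b" using rank[OF b_in aP ba] .
  have M: "card ?M \<le> 2 ^ r a" using card_above_le[OF aP] .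
  have "2 ^ r b \<le> (2::nat) ^ Suc (r a)" using split ext M by simp
  then have "r b \<le> Suc (r a)" by (simp only: power_increasing_iff one_less_numeral_iff semiring_norm)
  then show r: "Suc (r a) = r b" using ra by simp
  have "2 * 2 ^ r a = (2::nat) ^ r b" using r[symmetric] by simp
  then have "card ?N = card ?M" using split ext M by linarith
  moreover obtain u where u: "inj_on u ?N" "u ` ?N \<subseteq> ?M"
    "\<forall>y\<in>?N. E (u y) = E y \<union> E a \<and> E y \<inter> E a = E b"
    by (rule cover_split[OF b_in aP ba cov])
  ultimately have "u ` ?N = ?M"
    using finite_P by (intro card_subset_eq) (simp_all add: card_image)
  moreover have "t \<in> ?M" using t_in E_reflect[OF aP t_in] E_t[OF aP] by simp
  ultimately have "t \<in> u ` ?N" by simp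
  then obtain y where y: "y \<in> ?N" "u y = t" by auto
  then have "E y = E t - E a" using bspec[OF u(3) y(1)] E_b by auto
  then show "\<exists>y\<in>P. E y = E t - E a" using y(1) by auto
qed

end

end

section \<open>Finite lattices\<close>

lemma equivD:
  assumes "equiv A \<theta>"
  shows "a \<in> A \<Longrightarrow> (a, a) \<in> \<theta>" "(a, b) \<in> \<theta> \<Longrightarrow> (b, a) \<in> \<theta>"
    "(a, b) \<in> \<theta> \<Longrightarrow> (b, c) \<in> \<theta> \<Longrightarrow> (a, c) \<in> \<theta>" "(a, b) \<in> \<theta> \<Longrightarrow> a \<in> A \<and> b \<in> A"
  using assms unfolding equiv_def refl_on_def sym_def trans_def by blast+

locale finite_lattice =
  fixes A :: "'a set" and join :: "'a \<Rightarrow> 'a \<Rightarrow> 'a" (infixl "\<squnion>" 65)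
    and meet :: "'a \<Rightarrow> 'a \<Rightarrow> 'a" (infixl "\<sqinter>" 70)
  assumes lattice: "lattice_on A join meet" and finite_A: "finite A" and nonempty: "A \<noteq> {}"
begin

abbreviation le (infix "\<sqsubseteq>" 50) where "x \<sqsubseteq> y \<equiv> lat_le meet x y"
abbreviation lt (infix "\<sqsubset>" 50) where "x \<sqsubset> y \<equiv> x \<sqsubseteq> y \<and> x \<noteq> y"
abbreviation incomp (infix "\<parallel>" 50) where "x \<parallel> y \<equiv> \<not> x \<sqsubseteq> y \<and> \<not> y \<sqsubseteq> x"

lemma join_in [simp]: "x \<in> A \<Longrightarrow> y \<in> A \<Longrightarrow> x \<squnion> y \<in> A"
  and meet_in [simp]: "x \<in> A \<Longrightarrow> y \<in> A \<Longrightarrow> x \<sqinter> y \<in> A"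
  and join_commute: "x \<in> A \<Longrightarrow> y \<in> A \<Longrightarrow> x \<squnion> y = y \<squnion> x"
  and meet_commute: "x \<in> A \<Longrightarrow> y \<in> A \<Longrightarrow> x \<sqinter> y = y \<sqinter> x"
  and join_meet_absorb: "x \<in> A \<Longrightarrow> y \<in> A \<Longrightarrow> x \<squnion> (x \<sqinter> y) = x"
  and meet_join_absorb: "x \<in> A \<Longrightarrow> y \<in> A \<Longrightarrow> x \<sqinter> (x \<squnion> y) = x"
  and join_assoc: "x \<in> A \<Longrightarrow> y \<in> A \<Longrightarrow> z \<in> A \<Longrightarrow> x \<squnion> y \<squnion> z = x \<squnion> (y \<squnion> z)"
  and meet_assoc: "x \<in> A \<Longrightarrow> y \<in> A \<Longrightarrow> z \<in> A \<Longrightarrow> x \<sqinter> y \<sqinter> z = x \<sqinter> (y \<sqinter> z)"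
  using lattice unfolding lattice_on_def by blast+

lemma le_iff_meet: "x \<sqsubseteq> y \<longleftrightarrow> x \<sqinter> y = x"
  by (simp add: lat_le_def)

lemma le_iff_join: "x \<in> A \<Longrightarrow> y \<in> A \<Longrightarrow> x \<sqsubseteq> y \<longleftrightarrow> x \<squnion> y = y"
  by (metis join_commute join_meet_absorb le_iff_meet meet_commute meet_join_absorb)

lemma le_refl [simp]: "x \<in> A \<Longrightarrow> x \<sqsubseteq> x"
  by (metis join_meet_absorb le_iff_meet meet_in meet_join_absorb)

lemma le_antisym: "x \<in> A \<Longrightarrow> y \<in> A \<Longrightarrow> x \<sqsubseteq> y \<Longrightarrow> y \<sqsubseteq> x \<Longrightarrow> x = y"
  by (metis le_iff_meet meet_commute)

lemma le_trans: "x \<in> A \<Longrightarrow> y \<in> A \<Longrightarrow> z \<in> A \<Longrightarrow> x \<sqsubseteq> y \<Longrightarrow> y \<sqsubseteq> z \<Longrightarrow> x \<sqsubseteq> z"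
  by (metis le_iff_meet meet_assoc)

lemma join_ge1 [simp]: "x \<in> A \<Longrightarrow> y \<in> A \<Longrightarrow> x \<sqsubseteq> x \<squnion> y"
  by (simp add: le_iff_meet meet_join_absorb)

lemma join_ge2 [simp]: "x \<in> A \<Longrightarrow> y \<in> A \<Longrightarrow> y \<sqsubseteq> x \<squnion> y"
  by (metis join_commute join_ge1)

lemma meet_le1 [simp]: "x \<in> A \<Longrightarrow> y \<in> A \<Longrightarrow> x \<sqinter> y \<sqsubseteq> x"
  by (metis le_iff_join join_commute join_meet_absorb meet_in)

lemma meet_le2 [simp]: "x \<in> A \<Longrightarrow> y \<in> A \<Longrightarrow> x \<sqinter> y \<sqsubseteq> y"
  by (metis meet_commute meet_le1)

lemma join_least: "x \<in> A \<Longrightarrow> y \<in> A \<Longrightarrow> z \<in> A \<Longrightarrow> x \<sqsubseteq> z \<Longrightarrow> y \<sqsubseteq> z \<Longrightarrow> x \<squnion> y \<sqsubseteq> z"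
  by (simp add: le_iff_join join_assoc)

lemma meet_greatest: "x \<in> A \<Longrightarrow> y \<in> A \<Longrightarrow> z \<in> A \<Longrightarrow> z \<sqsubseteq> x \<Longrightarrow> z \<sqsubseteq> y \<Longrightarrow> z \<sqsubseteq> x \<sqinter> y"
  by (simp add: le_iff_meet meet_assoc[symmetric])

lemma join_absorb1: "x \<in> A \<Longrightarrow> y \<in> A \<Longrightarrow> x \<sqsubseteq> y \<Longrightarrow> x \<squnion> y = y"
  and join_absorb2: "x \<in> A \<Longrightarrow> y \<in> A \<Longrightarrow> y \<sqsubseteq> x \<Longrightarrow> x \<squnion> y = x"
  and meet_absorb1: "x \<in> A \<Longrightarrow> y \<in> A \<Longrightarrow> x \<sqsubseteq> y \<Longrightarrow> x \<sqinter> y = x"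
  and meet_absorb2: "x \<in> A \<Longrightarrow> y \<in> A \<Longrightarrow> y \<sqsubseteq> x \<Longrightarrow> x \<sqinter> y = y"
  by (metis le_iff_join le_iff_meet join_commute meet_commute)+

lemma le_meet_iff: "x \<in> A \<Longrightarrow> y \<in> A \<Longrightarrow> z \<in> A \<Longrightarrow> z \<sqsubseteq> x \<sqinter> y \<longleftrightarrow> z \<sqsubseteq> x \<and> z \<sqsubseteq> y"
  by (meson le_trans meet_greatest meet_in meet_le1 meet_le2)

lemma join_le_iff: "x \<in> A \<Longrightarrow> y \<in> A \<Longrightarrow> z \<in> A \<Longrightarrow> x \<squnion> y \<sqsubseteq> z \<longleftrightarrow> x \<sqsubseteq> z \<and> y \<sqsubseteq> z"
  by (meson le_trans join_least join_in join_ge1 join_ge2)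

lemma down_card_less:
  assumes "x \<in> A" "y \<in> A" "x \<sqsubset> y"
  shows "card {z \<in> A. z \<sqsubseteq> x} < card {z \<in> A. z \<sqsubseteq> y}"
proof (rule psubset_card_mono)
  show "finite {z \<in> A. z \<sqsubseteq> y}" using finite_A by simp
  have "y \<in> {z \<in> A. z \<sqsubseteq> y} - {z \<in> A. z \<sqsubseteq> x}" using assms by (blast intro: le_antisym le_refl)
  moreover have "{z \<in> A. z \<sqsubseteq> x} \<subseteq> {z \<in> A. z \<sqsubseteq> y}" using assms by (blast intro: le_trans)
  ultimately show "{z \<in> A. z \<sqsubseteq> x} \<subset> {z \<in> A. z \<sqsubseteq> y}" by blast
qed

lemma ex_minimal:
  assumes "x0 \<in> A" "Q x0"
  obtains x where "x \<in> A" "Q x" "\<forall>y\<in>A. y \<sqsubset> x \<longrightarrow> \<not> Q y"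
proof -
  obtain x where x: "x \<in> A \<and> Q x" "\<forall>y. y \<in> A \<and> Q y \<longrightarrow> card {z \<in> A. z \<sqsubseteq> x} \<le> card {z \<in> A. z \<sqsubseteq> y}"
    using ex_has_least_nat[of "\<lambda>x. x \<in> A \<and> Q x" x0 "\<lambda>x. card {z \<in> A. z \<sqsubseteq> x}"] assms by auto
  show ?thesis
  proof (rule that)
    show "\<forall>y\<in>A. y \<sqsubset> x \<longrightarrow> \<not> Q y"
    proof (intro ballI impI notI)
      fix y assume "y \<in> A" "y \<sqsubset> x" "Q y"
      then show False using x(2) down_card_less[of y x] x(1) by fastforce
    qed
  qed (use x in simp_all)
qed

lemma ex_maximal:
  assumes "x0 \<in> A" "Q x0"
  obtains x where "x \<in> A" "Q x" "\<forall>y\<in>A. x \<sqsubset> y \<longrightarrow> \<not> Q y"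
proof -
  have "card {z \<in> A. z \<sqsubseteq> x} < Suc (card A)" for x
    using finite_A by (intro le_imp_less_Suc card_mono) auto
  then obtain x where x: "x \<in> A \<and> Q x"
    "\<forall>y. y \<in> A \<and> Q y \<longrightarrow> card {z \<in> A. z \<sqsubseteq> y} \<le> card {z \<in> A. z \<sqsubseteq> x}"
    using ex_has_greatest_nat[of "\<lambda>x. x \<in> A \<and> Q x" x0 "\<lambda>x. card {z \<in> A. z \<sqsubseteq> x}" "Suc (card A)"]
      assms by auto
  show ?thesis
  proof (rule that)
    show "\<forall>y\<in>A. x \<sqsubset> y \<longrightarrow> \<not> Q y"
    proof (intro ballI impI notI)
      fix y assume "y \<in> A" "x \<sqsubset> y" "Q y"
      then show False using x(2) down_card_less[of x y] x(1) by fastforce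
    qed
  qed (use x in simp_all)
qed

lemma ex_bottom: "\<exists>z\<in>A. \<forall>x\<in>A. z \<sqsubseteq> x"
proof -
  obtain x0 where "x0 \<in> A" using nonempty by auto
  then obtain z where z: "z \<in> A" "\<forall>y\<in>A. y \<sqsubset> z \<longrightarrow> \<not> True"
    by (rule ex_minimal[where Q = "\<lambda>_. True"]) (rule TrueI, rule that)
  have "z \<sqsubseteq> x" if x: "x \<in> A" for x
  proof -
    have "z \<sqinter> x = z" using bspec[OF z(2) meet_in[OF z(1) x]] meet_le1[OF z(1) x] by blast
    then show ?thesis by (simp only: le_iff_meet)
  qed
  then show ?thesis using z by auto
qed

definition bot :: 'a ("\<bottom>") where "\<bottom> = (SOME z. z \<in> A \<and> (\<forall>x\<in>A. z \<sqsubseteq> x))"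

lemma bot_in [simp]: "\<bottom> \<in> A" and bot_le [simp]: "x \<in> A \<Longrightarrow> \<bottom> \<sqsubseteq> x"
  using someI_ex[of "\<lambda>z. z \<in> A \<and> (\<forall>x\<in>A. z \<sqsubseteq> x)"] ex_bottom unfolding bot_def by blast+

text \<open>In a finite lattice, the elements \<open>p\<close> admitting some \<open>l\<close> with \<open>jcov l p\<close> are exactly
  the join-irreducible ones; \<open>l\<close> is then the unique lower cover of \<open>p\<close>.\<close>

definition jcov :: "'a \<Rightarrow> 'a \<Rightarrow> bool" where
  "jcov l p \<longleftrightarrow> l \<in> A \<and> p \<in> A \<and> l \<sqsubset> p \<and> (\<forall>y\<in>A. y \<sqsubset> p \<longrightarrow> y \<sqsubseteq> l)"

definition JI :: "'a set" where
  "JI = {p. \<exists>l. jcov l p}"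

definition coll :: "('a \<times> 'a) set \<Rightarrow> 'a set" where
  "coll \<theta> = {p. \<exists>l. jcov l p \<and> (l, p) \<in> \<theta>}"

lemma jcov_in: "jcov l p \<Longrightarrow> l \<in> A" "jcov l p \<Longrightarrow> p \<in> A"
  and jcov_lt: "jcov l p \<Longrightarrow> l \<sqsubset> p"
  and jcov_below: "jcov l p \<Longrightarrow> y \<in> A \<Longrightarrow> y \<sqsubset> p \<Longrightarrow> y \<sqsubseteq> l"
  unfolding jcov_def by simp_all

lemma jcov_unique: "jcov l p \<Longrightarrow> jcov l' p \<Longrightarrow> l = l'"
  using jcov_below[of l p l'] jcov_below[of l' p l] jcov_in jcov_lt le_antisym by blast

lemma JI_subset: "JI \<subseteq> A - {\<bottom>}"
proof
  fix p assume "p \<in> JI"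
  then obtain l where l: "jcov l p" unfolding JI_def by blast
  then have "p \<noteq> \<bottom>" using jcov_lt jcov_in bot_le le_antisym bot_in by metis
  then show "p \<in> A - {\<bottom>}" using jcov_in l by auto
qed

lemma finite_JI: "finite JI"
  using JI_subset finite_A finite_subset by blast

lemma coll_subset: "coll \<theta> \<subseteq> JI"
  unfolding coll_def JI_def by blast

lemma coll_iff: "jcov l p \<Longrightarrow> p \<in> coll \<theta> \<longleftrightarrow> (l, p) \<in> \<theta>"
  unfolding coll_def using jcov_unique by blast

text \<open>A maximal element \<open>l\<close> strictly below \<open>x\<close> is its only lower
  cover: some \<open>y\<close> below \<open>x\<close> but not below \<open>l\<close> would have a
  join with \<open>l\<close> that is too large for maximality. The premise speaks of incomparable
  pairs because in chains and diamonds exactly their joins are under control.\<close>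

lemma JI_I:
  assumes x: "x \<in> A" "x \<noteq> \<bottom>"
    and join: "\<And>a b. a \<in> A \<Longrightarrow> b \<in> A \<Longrightarrow> a \<sqsubset> x \<Longrightarrow> b \<sqsubset> x \<Longrightarrow> a \<parallel> b \<Longrightarrow> a \<squnion> b \<noteq> x"
  shows "x \<in> JI"
proof -
  obtain l where l: "l \<in> A" "l \<sqsubset> x" "\<forall>y\<in>A. l \<sqsubset> y \<longrightarrow> \<not> y \<sqsubset> x"
    using ex_maximal[of \<bottom> "\<lambda>y. y \<sqsubset> x"] x bot_in bot_le by metis
  have "y \<sqsubseteq> l" if y: "y \<in> A" "y \<sqsubset> x" for y
  proof (rule ccontr)
    assume not: "\<not> y \<sqsubseteq> l"
    have "l \<squnion> y \<noteq> x"
    proof (cases "l \<sqsubseteq> y")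
      case True then show ?thesis using l y by (simp add: join_absorb1)
    next
      case False then show ?thesis using join[OF l(1) y(1) l(2) y(2)] not by simp
    qed
    then have "l \<squnion> y \<sqsubset> x" using l y x by (simp add: join_least)
    moreover have "l \<sqsubset> l \<squnion> y" using l y not by (metis join_ge1 join_ge2)
    ultimately show False using l y by (meson join_in)
  qed
  then show ?thesis using l x unfolding JI_def jcov_def by blast
qed

lemma join_not_JI:
  assumes "x \<in> A" "y \<in> A" "x \<parallel> y"
  shows "x \<squnion> y \<notin> JI" "x \<squnion> y \<noteq> \<bottom>"
proof
  have lt: "x \<sqsubset> x \<squnion> y" "y \<sqsubset> x \<squnion> y" using assms by (metis join_ge1 join_ge2)+
  assume "x \<squnion> y \<in> JI"
  then obtain l where l: "jcov l (x \<squnion> y)" unfolding JI_def by blast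
  then have "x \<squnion> y \<sqsubseteq> l" using jcov_below[OF l] lt assms jcov_in[OF l] by (simp add: join_least)
  then show False using jcov_lt[OF l] jcov_in[OF l] le_antisym by blast
next
  show "x \<squnion> y \<noteq> \<bottom>" using assms by (metis bot_in bot_le join_ge1 le_trans)
qed

text \<open>Take \<open>p\<close> minimal among the elements below \<open>b\<close> but not below
  \<open>a\<close>. Everything strictly under \<open>p\<close> is then below \<open>a\<close>, so
  the meet of \<open>p\<close> and \<open>a\<close> is the unique lower cover of \<open>p\<close>.
  This replaces an arbitrary pair by a join-irreducible edge.\<close>

lemma ex_jcov:
  assumes "a \<in> A" "b \<in> A" "\<not> b \<sqsubseteq> a"
  obtains l p where "jcov l p" "p \<sqsubseteq> b" "\<not> p \<sqsubseteq> a" "l \<sqsubseteq> a"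
proof -
  obtain p where p: "p \<in> A" "p \<sqsubseteq> b \<and> \<not> p \<sqsubseteq> a" "\<forall>y\<in>A. y \<sqsubset> p \<longrightarrow> \<not> (y \<sqsubseteq> b \<and> \<not> y \<sqsubseteq> a)"
    by (rule ex_minimal[OF assms(2), where Q = "\<lambda>y. y \<sqsubseteq> b \<and> \<not> y \<sqsubseteq> a"]) (use assms in auto)
  have "p \<sqinter> a \<noteq> p" using p(2) by (simp add: le_iff_meet)
  moreover have "y \<sqsubseteq> p \<sqinter> a" if "y \<in> A" "y \<sqsubset> p" for y
    using p that assms by (metis le_trans meet_greatest)
  ultimately have "jcov (p \<sqinter> a) p" using p(1) assms by (simp add: jcov_def)
  then show ?thesis using that p assms by simp
qed

section \<open>Congruences of a finite lattice\<close>

abbreviation Cong :: "('a \<times> 'a) set set" where "Cong \<equiv> Con A join meet"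

lemma cong_refl: "\<theta> \<in> Cong \<Longrightarrow> a \<in> A \<Longrightarrow> (a, a) \<in> \<theta>"
  and cong_sym: "\<theta> \<in> Cong \<Longrightarrow> (a, b) \<in> \<theta> \<Longrightarrow> (b, a) \<in> \<theta>"
  and cong_trans: "\<theta> \<in> Cong \<Longrightarrow> (a, b) \<in> \<theta> \<Longrightarrow> (b, c) \<in> \<theta> \<Longrightarrow> (a, c) \<in> \<theta>"
  and cong_in: "\<theta> \<in> Cong \<Longrightarrow> (a, b) \<in> \<theta> \<Longrightarrow> a \<in> A" "\<theta> \<in> Cong \<Longrightarrow> (a, b) \<in> \<theta> \<Longrightarrow> b \<in> A"
  and cong_join2: "\<theta> \<in> Cong \<Longrightarrow> (a, b) \<in> \<theta> \<Longrightarrow> (c, d) \<in> \<theta> \<Longrightarrow> (a \<squnion> c, b \<squnion> d) \<in> \<theta>"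
  and cong_meet2: "\<theta> \<in> Cong \<Longrightarrow> (a, b) \<in> \<theta> \<Longrightarrow> (c, d) \<in> \<theta> \<Longrightarrow> (a \<sqinter> c, b \<sqinter> d) \<in> \<theta>"
  unfolding Con_def lat_cong_def mem_Collect_eq by (meson equivD)+

lemma cong_join: "\<theta> \<in> Cong \<Longrightarrow> (a, b) \<in> \<theta> \<Longrightarrow> c \<in> A \<Longrightarrow> (a \<squnion> c, b \<squnion> c) \<in> \<theta>"
  and cong_meet: "\<theta> \<in> Cong \<Longrightarrow> (a, b) \<in> \<theta> \<Longrightarrow> c \<in> A \<Longrightarrow> (a \<sqinter> c, b \<sqinter> c) \<in> \<theta>"
  by (simp_all add: cong_join2 cong_meet2 cong_refl)

lemma cong_subset: "\<theta> \<in> Cong \<Longrightarrow> \<theta> \<subseteq> A \<times> A"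
  using cong_in by auto

lemma finite_Cong: "finite Cong"
  using finite_A cong_subset by (intro finite_subset[of Cong "Pow (A \<times> A)"]) auto

lemma CongI:
  assumes "\<theta> \<subseteq> A \<times> A" "\<And>a. a \<in> A \<Longrightarrow> (a, a) \<in> \<theta>" "\<And>a b. (a, b) \<in> \<theta> \<Longrightarrow> (b, a) \<in> \<theta>"
    and trans: "\<And>a b c. (a, b) \<in> \<theta> \<Longrightarrow> (b, c) \<in> \<theta> \<Longrightarrow> (a, c) \<in> \<theta>"
    and join: "\<And>a b c. (a, b) \<in> \<theta> \<Longrightarrow> c \<in> A \<Longrightarrow> (a \<squnion> c, b \<squnion> c) \<in> \<theta>"
    and meet: "\<And>a b c. (a, b) \<in> \<theta> \<Longrightarrow> c \<in> A \<Longrightarrow> (a \<sqinter> c, b \<sqinter> c) \<in> \<theta>"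
  shows "\<theta> \<in> Cong"
proof -
  have "(a \<squnion> c, b \<squnion> d) \<in> \<theta>" "(a \<sqinter> c, b \<sqinter> d) \<in> \<theta>" if "(a, b) \<in> \<theta>" "(c, d) \<in> \<theta>" for a b c d
  proof -
    have A: "a \<in> A" "b \<in> A" "c \<in> A" "d \<in> A" using that assms(1) by auto
    show "(a \<squnion> c, b \<squnion> d) \<in> \<theta>"
      using trans[OF join[OF that(1) A(3)], of "b \<squnion> d"] join[OF that(2) A(2)] A
      by (simp add: join_commute)
    show "(a \<sqinter> c, b \<sqinter> d) \<in> \<theta>"
      using trans[OF meet[OF that(1) A(3)], of "b \<sqinter> d"] meet[OF that(2) A(2)] A
      by (simp add: meet_commute)
  qed
  moreover have "equiv A \<theta>"
    unfolding equiv_def refl_on_def sym_def trans_def using assms by blast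
  ultimately show ?thesis unfolding Con_def lat_cong_def by blast
qed

lemma Id_in_Cong: "Id_on A \<in> Cong"
  by (rule CongI) auto

lemma full_in_Cong: "A \<times> A \<in> Cong"
  by (rule CongI) auto

lemma Int_in_Cong: "\<theta> \<in> Cong \<Longrightarrow> \<phi> \<in> Cong \<Longrightarrow> \<theta> \<inter> \<phi> \<in> Cong"
  using cong_subset by (intro CongI) (auto intro: cong_refl cong_sym cong_trans cong_join cong_meet)

text \<open>Meeting the pair with \<open>p\<close> relates \<open>p\<close> to an element strictly
  below it, hence to one below \<open>l\<close>; joining with \<open>l\<close> then lands on the
  edge.\<close>

lemma cong_jcov:
  assumes "\<theta> \<in> Cong" "jcov l p" "(a, b) \<in> \<theta>" "\<not> p \<sqsubseteq> a" "p \<sqsubseteq> b"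
  shows "(l, p) \<in> \<theta>"
proof -
  have in_A: "a \<in> A" "b \<in> A" "l \<in> A" "p \<in> A" using assms cong_in jcov_in by auto
  have "(a \<sqinter> p, p) \<in> \<theta>" using cong_meet[OF assms(1,3) in_A(4)] assms(5) in_A by (simp add: meet_absorb2)
  moreover have "a \<sqinter> p \<noteq> p" using assms(4) in_A by (metis meet_le1)
  then have "a \<sqinter> p \<sqsubseteq> l" using jcov_below[OF assms(2)] in_A by simp
  ultimately show ?thesis
    using cong_join[OF assms(1) _ in_A(3), of "a \<sqinter> p" p] in_A jcov_lt[OF assms(2)]
    by (simp add: join_absorb1 join_absorb2)
qed

text \<open>For \<open>a\<close> below \<open>b\<close>, let \<open>x\<close> be the highest point
  of the interval that \<phi> relates to \<open>a\<close>. If \<open>x\<close> were not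
  \<open>b\<close>, \<open>ex_jcov\<close> would give an edge \<open>(l, p)\<close> with
  \<open>l\<close> below \<open>x\<close> and \<open>p\<close> not. It is collapsed by \<theta>,
  hence by \<phi>, and joining it with \<open>x\<close> leads higher up.\<close>

lemma cong_subset_if_coll_subset:
  assumes \<theta>: "\<theta> \<in> Cong" and \<phi>: "\<phi> \<in> Cong" and sub: "coll \<theta> \<subseteq> coll \<phi>"
  shows "\<theta> \<subseteq> \<phi>"
proof -
  have le: "(a, b) \<in> \<phi>" if ab: "(a, b) \<in> \<theta>" "a \<sqsubseteq> b" for a b
  proof -
    have A: "a \<in> A" "b \<in> A" using ab cong_in \<theta> by auto
    obtain x where x: "x \<in> A" "a \<sqsubseteq> x \<and> x \<sqsubseteq> b \<and> (a, x) \<in> \<phi>"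
      "\<forall>y\<in>A. x \<sqsubset> y \<longrightarrow> \<not> (a \<sqsubseteq> y \<and> y \<sqsubseteq> b \<and> (a, y) \<in> \<phi>)"
      by (rule ex_maximal[OF A(1), where Q = "\<lambda>x. a \<sqsubseteq> x \<and> x \<sqsubseteq> b \<and> (a, x) \<in> \<phi>"])
        (use A ab cong_refl[OF \<phi>] in auto)
    have "b \<sqsubseteq> x"
    proof (rule ccontr)
      assume "\<not> b \<sqsubseteq> x"
      then obtain l p where p: "jcov l p" "p \<sqsubseteq> b" "\<not> p \<sqsubseteq> x" "l \<sqsubseteq> x"
        using ex_jcov[OF x(1) A(2)] by metis
      note lp = jcov_in[OF p(1)]
      have "(a \<squnion> x, b \<squnion> x) \<in> \<theta>" using cong_join[OF \<theta> ab(1) x(1)] .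
      then have "(x, b) \<in> \<theta>" using x A by (simp add: join_absorb1 join_absorb2)
      then have "(l, p) \<in> \<theta>" using cong_jcov[OF \<theta> p(1)] p by simp
      then have "(l, p) \<in> \<phi>" using sub coll_iff[OF p(1)] by auto
      then have "(l \<squnion> x, p \<squnion> x) \<in> \<phi>" using cong_join[OF \<phi> _ x(1)] by simp
      then have "(x, p \<squnion> x) \<in> \<phi>" using p x lp by (simp add: join_absorb1)
      then have "(a, p \<squnion> x) \<in> \<phi>" using cong_trans[OF \<phi>] x by blast
      moreover have "a \<sqsubseteq> p \<squnion> x" "p \<squnion> x \<sqsubseteq> b"
        using x p lp A le_trans[of a x "p \<squnion> x"] by (simp_all add: join_least)
      moreover have "x \<sqsubset> p \<squnion> x" using x p lp by (metis join_ge1 join_ge2)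
      ultimately show False using x lp by auto
    qed
    then show ?thesis using x A le_antisym by blast
  qed
  show ?thesis
  proof
    fix e assume e: "e \<in> \<theta>"
    obtain a b where ab: "e = (a, b)" by fastforce
    have A: "a \<in> A" "b \<in> A" using e ab cong_in \<theta> by auto
    have "(a \<sqinter> b, b) \<in> \<theta>" "(a \<sqinter> b, a) \<in> \<theta>"
      using cong_meet[OF \<theta>, of a b b] cong_meet[OF \<theta>, of b a a] cong_sym[OF \<theta>] e ab A
      by (simp_all add: meet_absorb1 meet_commute)
    then show "e \<in> \<phi>" using le A ab cong_trans[OF \<phi>] cong_sym[OF \<phi>] by (metis meet_le1 meet_le2)
  qed
qed

lemma coll_subset_iff: "\<theta> \<in> Cong \<Longrightarrow> \<phi> \<in> Cong \<Longrightarrow> coll \<theta> \<subseteq> coll \<phi> \<longleftrightarrow> \<theta> \<subseteq> \<phi>"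
  using cong_subset_if_coll_subset by (auto simp: coll_def)

lemma coll_Int: "coll (\<theta> \<inter> \<phi>) = coll \<theta> \<inter> coll \<phi>"
  using jcov_unique unfolding coll_def by blast

lemma trancl_Un_in_Cong:
  assumes \<theta>: "\<theta> \<in> Cong" and \<phi>: "\<phi> \<in> Cong"
  shows "(\<theta> \<union> \<phi>)\<^sup>+ \<in> Cong"
proof (rule CongI)
  show "(\<theta> \<union> \<phi>)\<^sup>+ \<subseteq> A \<times> A" using cong_subset \<theta> \<phi> by (intro trancl_subset_Sigma) auto
  show "(a, a) \<in> (\<theta> \<union> \<phi>)\<^sup>+" if "a \<in> A" for a using cong_refl[OF \<theta> that] by auto
  have "sym (\<theta> \<union> \<phi>)" using cong_sym[OF \<theta>] cong_sym[OF \<phi>] by (auto intro!: symI)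
  then show "(b, a) \<in> (\<theta> \<union> \<phi>)\<^sup>+" if "(a, b) \<in> (\<theta> \<union> \<phi>)\<^sup>+" for a b
    using that sym_trancl symD by metis
  show "(a, c) \<in> (\<theta> \<union> \<phi>)\<^sup>+" if "(a, b) \<in> (\<theta> \<union> \<phi>)\<^sup>+" "(b, c) \<in> (\<theta> \<union> \<phi>)\<^sup>+" for a b c
    using that by (rule trancl_trans)
  show "(a \<squnion> c, b \<squnion> c) \<in> (\<theta> \<union> \<phi>)\<^sup>+" if "(a, b) \<in> (\<theta> \<union> \<phi>)\<^sup>+" "c \<in> A" for a b c
    using that(1)
  proof (induction rule: trancl_induct)
    case (base y) then show ?case using cong_join \<theta> \<phi> that(2) by auto
  next
    case (step y z)
    then have "(y \<squnion> c, z \<squnion> c) \<in> \<theta> \<union> \<phi>" using cong_join \<theta> \<phi> that(2) by auto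
    then show ?case using step.IH by (rule trancl_into_trancl[rotated])
  qed
  show "(a \<sqinter> c, b \<sqinter> c) \<in> (\<theta> \<union> \<phi>)\<^sup>+" if "(a, b) \<in> (\<theta> \<union> \<phi>)\<^sup>+" "c \<in> A" for a b c
    using that(1)
  proof (induction rule: trancl_induct)
    case (base y) then show ?case using cong_meet \<theta> \<phi> that(2) by auto
  next
    case (step y z)
    then have "(y \<sqinter> c, z \<sqinter> c) \<in> \<theta> \<union> \<phi>" using cong_meet \<theta> \<phi> that(2) by auto
    then show ?case using step.IH by (rule trancl_into_trancl[rotated])
  qed
qed

text \<open>If neither congruence collapses \<open>p\<close>, then by \<open>cong_jcov\<close> no
  step of either enters the up-set of \<open>p\<close> from outside, so a chain of steps from
  \<open>l\<close> never reaches \<open>p\<close>. This is the source of distributivity.\<close>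

lemma coll_trancl_Un:
  assumes \<theta>: "\<theta> \<in> Cong" and \<phi>: "\<phi> \<in> Cong"
  shows "coll ((\<theta> \<union> \<phi>)\<^sup>+) = coll \<theta> \<union> coll \<phi>"
proof
  show "coll ((\<theta> \<union> \<phi>)\<^sup>+) \<subseteq> coll \<theta> \<union> coll \<phi>"
  proof
    fix p assume "p \<in> coll ((\<theta> \<union> \<phi>)\<^sup>+)"
    then obtain l where l: "jcov l p" "(l, p) \<in> (\<theta> \<union> \<phi>)\<^sup>+" unfolding coll_def by blast
    show "p \<in> coll \<theta> \<union> coll \<phi>"
    proof (rule ccontr)
      assume "p \<notin> coll \<theta> \<union> coll \<phi>"
      then have not: "(l, p) \<notin> \<theta>" "(l, p) \<notin> \<phi>" using coll_iff[OF l(1)] by auto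
      have start: "\<not> p \<sqsubseteq> l" using jcov_lt jcov_in l(1) le_antisym by metis
      have step: "\<not> p \<sqsubseteq> y" if "(x, y) \<in> \<theta> \<union> \<phi>" "\<not> p \<sqsubseteq> x" for x y
        using that cong_jcov[OF \<theta> l(1)] cong_jcov[OF \<phi> l(1)] not by auto
      have "\<not> p \<sqsubseteq> x" if "(l, x) \<in> (\<theta> \<union> \<phi>)\<^sup>+" for x
        using that by (induction rule: trancl_induct) (use step start in blast)+
      then show False using l jcov_in le_refl by blast
    qed
  qed
qed (auto simp: coll_def)

sublocale Con: set_ring_representation Cong coll "Id_on A" "A \<times> A"
proof
  fix \<theta> \<phi> assume "\<theta> \<in> Cong" "\<phi> \<in> Cong"
  then show "\<exists>\<psi>\<in>Cong. coll \<psi> = coll \<theta> \<union> coll \<phi>"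
    using trancl_Un_in_Cong coll_trancl_Un by blast
next
  fix \<theta> \<phi> assume "\<theta> \<in> Cong" "\<phi> \<in> Cong"
  then show "\<exists>\<psi>\<in>Cong. coll \<psi> = coll \<theta> \<inter> coll \<phi>"
    using Int_in_Cong coll_Int by blast
next
  show "coll (Id_on A) = {}" unfolding coll_def using jcov_lt by auto
next
  fix \<theta> assume "\<theta> \<in> Cong"
  show "coll \<theta> \<subseteq> coll (A \<times> A)" unfolding coll_def using jcov_in by auto
qed (simp_all add: finite_Cong coll_subset_iff Id_in_Cong full_in_Cong)

section \<open>Counting congruences by join-irreducibles\<close>

lemma coll_full: "coll (A \<times> A) = JI"
  unfolding coll_def JI_def using jcov_in by auto

lemma coll_inj: "inj_on coll Cong"
  using Con.E_inject by (intro inj_onI) simp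

lemma card_Cong_eq: "card Cong = card (coll ` Cong)"
  by (simp add: card_image coll_inj)

lemma card_Cong_le: "card Cong \<le> 2 ^ card JI"
proof -
  have "card (coll ` Cong) \<le> card (Pow JI)"
    using coll_subset finite_JI by (intro card_mono) auto
  then show ?thesis by (simp add: card_Cong_eq card_Pow finite_JI)
qed

lemma iso_L2pow_if_card_eq:
  assumes "card Cong = 2 ^ card JI"
  shows "iso_L2pow Cong (card JI)"
proof (rule iso_L2powI[OF finite_JI refl])
  have "coll ` Cong = Pow JI"
    using assms coll_subset finite_JI by (intro card_subset_eq) (auto simp: card_Cong_eq card_Pow)
  then show "bij_betw coll Cong (Pow JI)" using coll_inj by (simp add: bij_betw_def)
qed (simp add: coll_subset_iff)

lemma card_JI_le: "card JI \<le> card A - 1"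
  using card_mono[OF _ JI_subset] finite_A by simp

text \<open>The bottom and the join of an incomparable pair are two elements outside
  \<open>JI\<close>. When nothing else is outside, all incomparable pairs are forced to have the
  same join.\<close>

lemma card_JI_not_chain:
  assumes "x \<in> A" "y \<in> A" "x \<parallel> y"
  shows "card JI \<le> card A - 2"
    and "card JI = card A - 2 \<Longrightarrow> A - JI = {\<bottom>, x \<squnion> y}"
proof -
  have sub: "{\<bottom>, x \<squnion> y} \<subseteq> A - JI" using join_not_JI[OF assms] assms JI_subset by auto
  have two: "card {\<bottom>, x \<squnion> y} = 2" using join_not_JI[OF assms] by auto
  have eq: "card (A - JI) = card A - card JI"
    using JI_subset finite_JI by (intro card_Diff_subset) auto
  have fin: "finite (A - JI)" using finite_A by simp
  have le: "2 \<le> card (A - JI)" using card_mono[OF fin sub] two by simp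
  then show "card JI \<le> card A - 2" using eq by simp
  assume "card JI = card A - 2"
  moreover have "2 \<le> card A" using le card_mono[OF finite_A, of "A - JI"] by simp
  ultimately have "card (A - JI) = card {\<bottom>, x \<squnion> y}" using eq two by simp
  then show "A - JI = {\<bottom>, x \<squnion> y}" using card_subset_eq[OF fin sub] by simp
qed

definition join_prime :: "'a \<Rightarrow> bool" where
  "join_prime p \<longleftrightarrow> p \<in> A \<and> (\<forall>x\<in>A. \<forall>y\<in>A. p \<sqsubseteq> x \<squnion> y \<longrightarrow> p \<sqsubseteq> x \<or> p \<sqsubseteq> y)"

lemma join_prime_iff: "join_prime p \<Longrightarrow> x \<in> A \<Longrightarrow> y \<in> A \<Longrightarrow> p \<sqsubseteq> x \<squnion> y \<longleftrightarrow> p \<sqsubseteq> x \<or> p \<sqsubseteq> y"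
  unfolding join_prime_def by (meson join_ge1 join_ge2 join_in le_trans)

lemma prime_cong:
  assumes "\<And>p. p \<in> S \<Longrightarrow> join_prime p"
  shows "{(x, y) \<in> A \<times> A. \<forall>p\<in>S. p \<sqsubseteq> x \<longleftrightarrow> p \<sqsubseteq> y} \<in> Cong"
proof -
  have "S \<subseteq> A" using assms join_prime_def by auto
  then show ?thesis
    using assms by (intro CongI) (auto simp: join_prime_iff le_meet_iff subset_iff)
qed

text \<open>Up-sets of join-primes are prime filters, so agreement on any collection of them is a
  congruence. Agreement on \<open>JI - S\<close> collapses exactly \<open>S\<close>, so every subset
  of \<open>JI\<close> occurs.\<close>

lemma card_Cong_prime:
  assumes "\<And>p. p \<in> JI \<Longrightarrow> join_prime p"
  shows "card Cong = 2 ^ card JI"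
proof -
  have "Pow JI \<subseteq> coll ` Cong"
  proof
    fix S assume S: "S \<in> Pow JI"
    define \<theta> where "\<theta> = {(x, y) \<in> A \<times> A. \<forall>p\<in>JI - S. p \<sqsubseteq> x \<longleftrightarrow> p \<sqsubseteq> y}"
    have "\<theta> \<in> Cong" unfolding \<theta>_def using assms by (intro prime_cong) auto
    moreover have "coll \<theta> = S"
    proof -
      have "p \<in> coll \<theta> \<longleftrightarrow> p \<in> S" if p: "p \<in> JI" for p
      proof -
        obtain l where l: "jcov l p" using p unfolding JI_def by auto
        note lp = jcov_in[OF l]
        \<comment> \<open>Only the cut belonging to \<open>p\<close> itself separates
          \<open>l\<close> from \<open>p\<close>.\<close>
        have "q \<sqsubseteq> l \<longleftrightarrow> q \<sqsubseteq> p" if "q \<in> A" "q \<noteq> p" for q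
          using that lp jcov_lt[OF l] jcov_below[OF l] le_trans by metis
        moreover have "\<not> p \<sqsubseteq> l" using jcov_lt[OF l] lp le_antisym by metis
        ultimately show ?thesis using p lp JI_subset by (auto simp: coll_iff[OF l] \<theta>_def)
      qed
      then show ?thesis using S coll_subset by blast
    qed
    ultimately show "S \<in> coll ` Cong" by auto
  qed
  then have "card (Pow JI) \<le> card (coll ` Cong)" using finite_Cong by (intro card_mono) auto
  then show ?thesis using card_Cong_le finite_JI by (simp add: card_Cong_eq card_Pow)
qed

section \<open>Complements of congruences in modular lattices\<close>

text \<open>The complement of \<theta> relates two elements when the interval from their meet to
  their join contains no nontrivial pair of \<theta>. Modularity lets such intervals be concatenated
  and translated, which makes the relation a congruence. An edge below a join-irreducible has no
  inner points, so it is collapsed by exactly one of the two.\<close>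

lemma boolean_Con_if_modular:
  assumes "modular_lat A join meet"
  shows "boolean_family Cong"
proof -
  have modular: "x \<squnion> (y \<sqinter> z) = (x \<squnion> y) \<sqinter> z" if "x \<in> A" "y \<in> A" "z \<in> A" "x \<sqsubseteq> z" for x y z
    using assms that unfolding modular_lat_def by simp
  have "\<exists>\<phi>\<in>Cong. coll \<phi> = JI - coll \<theta>" if \<theta>: "\<theta> \<in> Cong" for \<theta>
  proof -
    define triv where "triv x y \<longleftrightarrow>
      (\<forall>u\<in>A. \<forall>w\<in>A. x \<sqsubseteq> u \<and> u \<sqsubseteq> w \<and> w \<sqsubseteq> y \<and> (u, w) \<in> \<theta> \<longrightarrow> u = w)" for x y
    have triv_sub: "triv x' y'" if "triv x y" "x \<in> A" "y \<in> A" "x' \<in> A" "y' \<in> A" "x \<sqsubseteq> x'" "y' \<sqsubseteq> y" for x y x' y'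
      using that unfolding triv_def by (meson le_trans)
    have triv_trans: "triv x z" if A: "x \<in> A" "y \<in> A" "z \<in> A" and le: "x \<sqsubseteq> y" "y \<sqsubseteq> z"
      and t: "triv x y" "triv y z" for x y z
      unfolding triv_def
    proof (intro ballI impI, elim conjE)
      fix u w assume uw: "u \<in> A" "w \<in> A" "x \<sqsubseteq> u" "u \<sqsubseteq> w" "w \<sqsubseteq> z" "(u, w) \<in> \<theta>"
      have 1: "u \<sqinter> y = w \<sqinter> y"
      proof -
        have "(u \<sqinter> y, w \<sqinter> y) \<in> \<theta>" using cong_meet[OF \<theta> uw(6) A(2)] .
        moreover have "x \<sqsubseteq> u \<sqinter> y" using A uw le by (simp add: meet_greatest)
        moreover have "u \<sqinter> y \<sqsubseteq> w \<sqinter> y"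
          using A uw by (metis le_trans meet_greatest meet_in meet_le1 meet_le2)
        ultimately show ?thesis using t(1) A uw unfolding triv_def by simp
      qed
      have 2: "u \<squnion> y = w \<squnion> y"
      proof -
        have "(u \<squnion> y, w \<squnion> y) \<in> \<theta>" using cong_join[OF \<theta> uw(6) A(2)] .
        moreover have "w \<squnion> y \<sqsubseteq> z" using A uw le by (simp add: join_least)
        moreover have "u \<squnion> y \<sqsubseteq> w \<squnion> y"
          using A uw by (metis le_trans join_least join_in join_ge1 join_ge2)
        ultimately show ?thesis using t(2) A uw unfolding triv_def by simp
      qed
      \<comment> \<open>Modular cancellation: comparable \<open>u\<close> and \<open>w\<close> with
        the same meet and the same join with \<open>y\<close> coincide.\<close>
      have "w = (w \<squnion> y) \<sqinter> w" using A uw by (simp add: meet_absorb2)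
      also have "\<dots> = (u \<squnion> y) \<sqinter> w" using 2 by simp
      also have "\<dots> = u \<squnion> (y \<sqinter> w)" using modular[OF uw(1) A(2) uw(2,4)] by simp
      also have "\<dots> = u \<squnion> (u \<sqinter> y)" using 1 A uw by (simp add: meet_commute)
      also have "\<dots> = u" using A uw by (simp add: join_meet_absorb)
      finally show "u = w" ..
    qed
    have triv_join: "triv (x \<squnion> c) (y \<squnion> c)" if A: "x \<in> A" "y \<in> A" "c \<in> A" and le: "x \<sqsubseteq> y"
      and t: "triv x y" for x y c
      unfolding triv_def
    proof (intro ballI impI, elim conjE)
      fix u w assume uw: "u \<in> A" "w \<in> A" "x \<squnion> c \<sqsubseteq> u" "u \<sqsubseteq> w" "w \<sqsubseteq> y \<squnion> c" "(u, w) \<in> \<theta>"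
      have xc: "x \<sqsubseteq> u" "c \<sqsubseteq> u" using uw A by (simp_all add: join_le_iff)
      have "c \<sqsubseteq> w" using xc(2) uw A le_trans by blast
      have "u \<sqsubseteq> y \<squnion> c" using uw A le_trans[of u w "y \<squnion> c"] by simp
      have "u \<sqinter> y = w \<sqinter> y"
      proof -
        have "(u \<sqinter> y, w \<sqinter> y) \<in> \<theta>" using cong_meet[OF \<theta> uw(6) A(2)] .
        moreover have "x \<sqsubseteq> u \<sqinter> y" using A uw le xc by (simp add: meet_greatest)
        moreover have "u \<sqinter> y \<sqsubseteq> w \<sqinter> y"
          using A uw by (metis le_trans meet_greatest meet_in meet_le1 meet_le2)
        ultimately show ?thesis using t A uw unfolding triv_def by simp
      qed
      \<comment> \<open>By modularity an element of the translated interval is recovered from its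
        meet with \<open>y\<close>, which lies in the original interval.\<close>
      moreover have "u = c \<squnion> (u \<sqinter> y)"
        using modular[OF A(3,2) uw(1) xc(2)] A uw \<open>u \<sqsubseteq> y \<squnion> c\<close>
        by (simp add: meet_commute join_commute meet_absorb1)
      moreover have "w = c \<squnion> (w \<sqinter> y)"
        using modular[OF A(3,2) uw(2) \<open>c \<sqsubseteq> w\<close>] A uw
        by (simp add: meet_commute join_commute meet_absorb1)
      ultimately show "u = w" by simp
    qed
    have triv_meet: "triv (x \<sqinter> c) (y \<sqinter> c)" if A: "x \<in> A" "y \<in> A" "c \<in> A" and le: "x \<sqsubseteq> y"
      and t: "triv x y" for x y c
      unfolding triv_def
    proof (intro ballI impI, elim conjE)
      fix u w assume uw: "u \<in> A" "w \<in> A" "x \<sqinter> c \<sqsubseteq> u" "u \<sqsubseteq> w" "w \<sqsubseteq> y \<sqinter> c" "(u, w) \<in> \<theta>"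
      have yc: "w \<sqsubseteq> y" "w \<sqsubseteq> c" using uw A by (simp_all add: le_meet_iff)
      have "u \<sqsubseteq> c" using yc(2) uw A le_trans by blast
      have "x \<sqinter> c \<sqsubseteq> w" using uw A le_trans[of "x \<sqinter> c" u w] by simp
      have "u \<squnion> x = w \<squnion> x"
      proof -
        have "(u \<squnion> x, w \<squnion> x) \<in> \<theta>" using cong_join[OF \<theta> uw(6) A(1)] .
        moreover have "w \<squnion> x \<sqsubseteq> y" using A uw le yc by (simp add: join_least)
        moreover have "u \<squnion> x \<sqsubseteq> w \<squnion> x"
          using A uw by (metis le_trans join_least join_in join_ge1 join_ge2)
        ultimately show ?thesis using t A uw unfolding triv_def by simp
      qed
      moreover have "u = (u \<squnion> x) \<sqinter> c"
        using modular[OF uw(1) A(1,3) \<open>u \<sqsubseteq> c\<close>] A uw by (simp add: join_absorb2)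
      moreover have "w = (w \<squnion> x) \<sqinter> c"
        using modular[OF uw(2) A(1,3) yc(2)] A uw \<open>x \<sqinter> c \<sqsubseteq> w\<close> by (simp add: join_absorb2)
      ultimately show "u = w" by simp
    qed
    define \<phi> where "\<phi> = {(x, y) \<in> A \<times> A. triv (x \<sqinter> y) (x \<squnion> y)}"
    \<comment> \<open>Transitivity of the relation. Translating the two halves of the second
      interval, below and above \<open>y\<close>, extends the first interval to one from
      \<open>?lo\<close> to \<open>?hi\<close> that contains the interval for \<open>x\<close> and
      \<open>z\<close>.\<close>
    have bounds: "triv (x \<sqinter> z) (x \<squnion> z)" if A: "x \<in> A" "y \<in> A" "z \<in> A" and
      t: "triv (x \<sqinter> y) (x \<squnion> y)" "triv (y \<sqinter> z) (y \<squnion> z)" for x y z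
    proof -
      let ?lo = "(x \<sqinter> y) \<sqinter> (y \<sqinter> z)" and ?hi = "(x \<squnion> y) \<squnion> (y \<squnion> z)"
      have "triv (y \<sqinter> z) y" by (rule triv_sub[OF t(2)]) (use A in auto)
      then have "triv ((y \<sqinter> z) \<sqinter> (x \<sqinter> y)) (y \<sqinter> (x \<sqinter> y))" using A by (intro triv_meet) auto
      moreover have "(y \<sqinter> z) \<sqinter> (x \<sqinter> y) = ?lo" "y \<sqinter> (x \<sqinter> y) = x \<sqinter> y"
        using A by (simp_all add: meet_commute meet_absorb2)
      ultimately have lo: "triv ?lo (x \<sqinter> y)" by simp
      have "triv y (y \<squnion> z)" by (rule triv_sub[OF t(2)]) (use A in auto)
      then have "triv (y \<squnion> (x \<squnion> y)) ((y \<squnion> z) \<squnion> (x \<squnion> y))" using A by (intro triv_join) auto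
      moreover have "(y \<squnion> z) \<squnion> (x \<squnion> y) = ?hi" "y \<squnion> (x \<squnion> y) = x \<squnion> y"
        using A by (simp_all add: join_commute join_absorb1)
      ultimately have hi: "triv (x \<squnion> y) ?hi" by simp
      have xy: "x \<sqinter> y \<sqsubseteq> x \<squnion> y" using A le_trans[of "x \<sqinter> y" x "x \<squnion> y"] by simp
      have "triv (x \<sqinter> y) ?hi" by (rule triv_trans[OF _ _ _ xy _ t(1) hi]) (use A in auto)
      moreover have "x \<sqinter> y \<sqsubseteq> ?hi" using A xy le_trans[of "x \<sqinter> y" "x \<squnion> y" ?hi] by simp
      ultimately have "triv ?lo ?hi"
        by (intro triv_trans[OF _ _ _ _ _ lo, of ?hi]) (use A in auto)
      moreover have "?lo \<sqsubseteq> x \<sqinter> z"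
      proof -
        have "?lo \<sqsubseteq> x" "?lo \<sqsubseteq> z"
          using A le_trans[of ?lo "x \<sqinter> y" x] le_trans[of ?lo "y \<sqinter> z" z] by auto
        then show ?thesis using A by (simp add: meet_greatest)
      qed
      moreover have "x \<squnion> z \<sqsubseteq> ?hi"
      proof -
        have "x \<sqsubseteq> ?hi" "z \<sqsubseteq> ?hi"
          using A le_trans[of x "x \<squnion> y" ?hi] le_trans[of z "y \<squnion> z" ?hi] by auto
        then show ?thesis using A by (simp add: join_least)
      qed
      ultimately show ?thesis using A triv_sub[of ?lo ?hi "x \<sqinter> z" "x \<squnion> z"] by simp
    qed
    have "\<phi> \<in> Cong"
    proof (rule CongI)
      show "\<phi> \<subseteq> A \<times> A" unfolding \<phi>_def by auto
      show "(a, a) \<in> \<phi>" if "a \<in> A" for a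
        using that le_antisym[OF _ _ _ le_trans]
        by (simp add: \<phi>_def triv_def meet_absorb1 join_absorb1)
      show "(b, a) \<in> \<phi>" if "(a, b) \<in> \<phi>" for a b
        using that by (auto simp: \<phi>_def join_commute meet_commute)
      show "(a, c) \<in> \<phi>" if "(a, b) \<in> \<phi>" "(b, c) \<in> \<phi>" for a b c
        using that bounds by (auto simp: \<phi>_def)
      fix a b c assume ab: "(a, b) \<in> \<phi>" and c: "c \<in> A"
      then have A: "a \<in> A" "b \<in> A" and t: "triv (a \<sqinter> b) (a \<squnion> b)" by (auto simp: \<phi>_def)
      have le: "a \<sqinter> b \<sqsubseteq> a \<squnion> b" using A le_trans[of "a \<sqinter> b" a "a \<squnion> b"] by simp
      have "triv (a \<sqinter> b \<squnion> c) (a \<squnion> b \<squnion> c)" using triv_join[OF _ _ c le t] A by simp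
      then have "triv ((a \<squnion> c) \<sqinter> (b \<squnion> c)) ((a \<squnion> c) \<squnion> (b \<squnion> c))"
      proof (rule triv_sub)
        show "a \<sqinter> b \<squnion> c \<sqsubseteq> (a \<squnion> c) \<sqinter> (b \<squnion> c)"
          using A c by (simp add: join_le_iff le_meet_iff) (meson join_ge1 join_in le_trans meet_in meet_le1 meet_le2)
        show "(a \<squnion> c) \<squnion> (b \<squnion> c) \<sqsubseteq> a \<squnion> b \<squnion> c"
          using A c by (simp add: join_le_iff) (meson join_ge1 join_ge2 join_in le_trans)
      qed (use A c in auto)
      then show "(a \<squnion> c, b \<squnion> c) \<in> \<phi>" using A c by (simp add: \<phi>_def)
      have "triv (a \<sqinter> b \<sqinter> c) ((a \<squnion> b) \<sqinter> c)" using triv_meet[OF _ _ c le t] A by simp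
      then have "triv ((a \<sqinter> c) \<sqinter> (b \<sqinter> c)) ((a \<sqinter> c) \<squnion> (b \<sqinter> c))"
      proof (rule triv_sub)
        show "a \<sqinter> b \<sqinter> c \<sqsubseteq> (a \<sqinter> c) \<sqinter> (b \<sqinter> c)"
          using A c by (simp add: le_meet_iff) (meson meet_le1 meet_le2 meet_in le_trans)
        show "(a \<sqinter> c) \<squnion> (b \<sqinter> c) \<sqsubseteq> (a \<squnion> b) \<sqinter> c"
          using A c by (simp add: join_le_iff le_meet_iff) (meson join_ge1 join_ge2 join_in le_trans meet_in meet_le1)
      qed (use A c in auto)
      then show "(a \<sqinter> c, b \<sqinter> c) \<in> \<phi>" using A c by (simp add: \<phi>_def)
    qed
    moreover have "p \<in> coll \<phi> \<longleftrightarrow> p \<notin> coll \<theta>" if "p \<in> JI" for p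
    proof -
      obtain l where l: "jcov l p" using \<open>p \<in> JI\<close> unfolding JI_def by auto
      note lp = jcov_in[OF l]
      have only: "u = l \<or> u = p" if "u \<in> A" "l \<sqsubseteq> u" "u \<sqsubseteq> p" for u
        using that jcov_below[OF l] lp le_antisym by metis
      have "\<not> p \<sqsubseteq> l" using jcov_lt[OF l] lp le_antisym by metis
      have "triv l p \<longleftrightarrow> (l, p) \<notin> \<theta>"
      proof
        assume "triv l p"
        then show "(l, p) \<notin> \<theta>" unfolding triv_def using lp jcov_lt[OF l] by force
      next
        assume not: "(l, p) \<notin> \<theta>"
        show "triv l p" unfolding triv_def
        proof (intro ballI impI, elim conjE)
          fix u w assume uw: "u \<in> A" "w \<in> A" "l \<sqsubseteq> u" "u \<sqsubseteq> w" "w \<sqsubseteq> p" "(u, w) \<in> \<theta>"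
          have "u = l \<or> u = p" "w = l \<or> w = p"
            using only uw lp le_trans[of u w p] le_trans[of l u w] by auto
          then show "u = w" using uw not \<open>\<not> p \<sqsubseteq> l\<close> by auto
        qed
      qed
      then show ?thesis
        using lp jcov_lt[OF l] by (simp add: coll_iff[OF l] \<phi>_def meet_absorb1 join_absorb1)
    qed
    ultimately show ?thesis using coll_subset by (intro bexI[of _ \<phi>]) auto
  qed
  then show ?thesis by (simp add: Con.boolean_family_iff coll_full)
qed

end

section \<open>Congruences compatible with an involution\<close>

text \<open>An intrinsic description of a four-element lattice glued between two chains: there is
  exactly one incomparable pair. An involution forces the two chains to have equal length, see
  \<open>diamond_glued\<close>.\<close>

definition (in finite_lattice) diamond :: "'a \<Rightarrow> 'a \<Rightarrow> bool" where
  "diamond p q \<longleftrightarrow> p \<in> A \<and> q \<in> A \<and> p \<parallel> q \<and> (\<forall>x\<in>A. \<forall>y\<in>A. x \<parallel> y \<longrightarrow> {x, y} = {p, q})"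

locale finite_i_lattice = finite_lattice A join meet
  for A :: "'a set" and join :: "'a \<Rightarrow> 'a \<Rightarrow> 'a" (infixl "\<squnion>" 65)
    and meet :: "'a \<Rightarrow> 'a \<Rightarrow> 'a" (infixl "\<sqinter>" 70) +
  fixes v :: "'a \<Rightarrow> 'a"
  assumes i_lattice: "i_lattice A join meet v"
begin

lemma inv_in [simp]: "x \<in> A \<Longrightarrow> v x \<in> A"
  and inv_inv [simp]: "x \<in> A \<Longrightarrow> v (v x) = x"
  and inv_antimono: "x \<in> A \<Longrightarrow> y \<in> A \<Longrightarrow> x \<sqsubseteq> y \<Longrightarrow> v y \<sqsubseteq> v x"
  using i_lattice unfolding i_lattice_def by blast+

lemma inv_le_iff: "x \<in> A \<Longrightarrow> y \<in> A \<Longrightarrow> v x \<sqsubseteq> v y \<longleftrightarrow> y \<sqsubseteq> x"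
  using inv_antimono[of y x] inv_antimono[of "v x" "v y"] by auto

lemma inv_le_swap: "x \<in> A \<Longrightarrow> y \<in> A \<Longrightarrow> x \<sqsubseteq> v y \<longleftrightarrow> y \<sqsubseteq> v x"
  using inv_le_iff[of "v y" x] by simp

lemma inv_eq_iff: "x \<in> A \<Longrightarrow> y \<in> A \<Longrightarrow> v x = v y \<longleftrightarrow> x = y"
  by (metis inv_inv)

lemma inv_join: "x \<in> A \<Longrightarrow> y \<in> A \<Longrightarrow> v (x \<squnion> y) = v x \<sqinter> v y"
  by (intro le_antisym) (simp_all add: le_meet_iff inv_le_iff inv_le_swap[of "v x \<sqinter> v y"]
      join_le_iff inv_le_swap[of x "v x \<sqinter> v y"] inv_le_swap[of y "v x \<sqinter> v y"])

lemma inv_meet: "x \<in> A \<Longrightarrow> y \<in> A \<Longrightarrow> v (x \<sqinter> y) = v x \<squnion> v y"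
  using inv_join[of "v x" "v y"] by (metis inv_in inv_inv join_in)

abbreviation BI :: "('a \<times> 'a) set set" where "BI \<equiv> ConBI A join meet v"

lemma BI_iff: "\<theta> \<in> BI \<longleftrightarrow> \<theta> \<in> Cong \<and> (\<forall>a b. (a, b) \<in> \<theta> \<longrightarrow> (v a, v b) \<in> \<theta>)"
  unfolding ConBI_def by simp

lemma BI_Cong: "\<theta> \<in> BI \<Longrightarrow> \<theta> \<in> Cong"
  and BI_inv: "\<theta> \<in> BI \<Longrightarrow> (a, b) \<in> \<theta> \<Longrightarrow> (v a, v b) \<in> \<theta>"
  by (simp_all add: BI_iff)

definition inv_cong :: "('a \<times> 'a) set \<Rightarrow> ('a \<times> 'a) set" where
  "inv_cong \<theta> = {(a, b) \<in> A \<times> A. (v a, v b) \<in> \<theta>}"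

lemma inv_cong_in:
  assumes "\<theta> \<in> Cong"
  shows "inv_cong \<theta> \<in> Cong"
  unfolding inv_cong_def
  by (rule CongI) (auto simp: inv_join inv_meet cong_refl[OF assms] cong_join[OF assms]
      cong_meet[OF assms] intro: cong_sym[OF assms] cong_trans[OF assms])

lemma trancl_Un_in_BI:
  assumes "\<theta> \<in> BI" "\<phi> \<in> BI"
  shows "(\<theta> \<union> \<phi>)\<^sup>+ \<in> BI"
proof -
  have "(v a, v b) \<in> (\<theta> \<union> \<phi>)\<^sup>+" if "(a, b) \<in> (\<theta> \<union> \<phi>)\<^sup>+" for a b
    using that
  proof (induction rule: trancl_induct)
    case (base y) then show ?case using assms BI_inv by blast
  next
    case (step y z)
    then have "(v y, v z) \<in> \<theta> \<union> \<phi>" using assms BI_inv by blast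
    with step.IH show ?case by (rule trancl_into_trancl)
  qed
  then show ?thesis using trancl_Un_in_Cong assms by (simp add: BI_iff)
qed

lemma finite_BI: "finite BI"
  using finite_Cong by (rule finite_subset[rotated]) (auto simp: BI_iff)

sublocale BI: set_ring_representation BI coll "Id_on A" "A \<times> A"
proof
  fix \<theta> \<phi> assume "\<theta> \<in> BI" "\<phi> \<in> BI"
  then show "\<exists>\<psi>\<in>BI. coll \<psi> = coll \<theta> \<union> coll \<phi>"
    using trancl_Un_in_BI coll_trancl_Un BI_Cong by blast
next
  fix \<theta> \<phi> assume *: "\<theta> \<in> BI" "\<phi> \<in> BI"
  then have "\<theta> \<inter> \<phi> \<in> BI" using Int_in_Cong by (simp add: BI_iff)
  then show "\<exists>\<psi>\<in>BI. coll \<psi> = coll \<theta> \<inter> coll \<phi>" using coll_Int by blast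
next
  show "Id_on A \<in> BI" "A \<times> A \<in> BI" by (auto simp: BI_iff Id_in_Cong full_in_Cong)
qed (simp_all add: finite_BI coll_subset_iff BI_Cong Con.E_b Con.E_t)

text \<open>If \<phi> complements an invariant \<theta>, so does its image
  \<open>inv_cong \<phi>\<close>, because the involution maps \<theta> to itself. Complements in a
  distributive lattice are unique, so \<phi> is invariant.\<close>

lemma boolean_BI_if_boolean_Con:
  assumes "boolean_family Cong"
  shows "boolean_family BI"
proof -
  have "\<exists>\<phi>\<in>BI. coll \<phi> = JI - coll \<theta>" if \<theta>: "\<theta> \<in> BI" for \<theta>
  proof -
    note \<theta>C = BI_Cong[OF \<theta>]
    obtain \<phi> where \<phi>: "\<phi> \<in> Cong" "coll \<phi> = JI - coll \<theta>"
      using assms \<theta>C by (auto simp: Con.boolean_family_iff coll_full)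
    note i\<phi> = inv_cong_in[OF \<phi>(1)]
    have "\<theta> \<inter> \<phi> = Id_on A"
      using \<phi> coll_Int Con.E_inject[OF Int_in_Cong[OF \<theta>C \<phi>(1)] Id_in_Cong] Con.E_b by auto
    have "(\<theta> \<union> \<phi>)\<^sup>+ = A \<times> A"
      using \<phi> coll_trancl_Un[OF \<theta>C \<phi>(1)] coll_subset[of \<theta>]
        Con.E_inject[OF trancl_Un_in_Cong[OF \<theta>C \<phi>(1)] full_in_Cong] coll_full by auto
    have "coll (inv_cong \<phi>) \<inter> coll \<theta> = {}"
    proof -
      have "a = b" if "(a, b) \<in> inv_cong \<phi> \<inter> \<theta>" for a b
      proof -
        have "a \<in> A" "b \<in> A" "(v a, v b) \<in> \<theta> \<inter> \<phi>"
          using that BI_inv[OF \<theta>] by (auto simp: inv_cong_def)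
        then show ?thesis using \<open>\<theta> \<inter> \<phi> = Id_on A\<close> inv_eq_iff by blast
      qed
      then have "inv_cong \<phi> \<inter> \<theta> \<subseteq> Id_on A" by (auto simp: inv_cong_def)
      then show ?thesis using Con.E_b unfolding coll_Int[symmetric] by (auto simp: coll_def)
    qed
    moreover have "JI \<subseteq> coll (inv_cong \<phi>) \<union> coll \<theta>"
    proof
      fix p assume "p \<in> JI"
      then obtain l where l: "jcov l p" unfolding JI_def by auto
      note lp = jcov_in[OF l]
      have "(a, b) \<in> (\<theta> \<union> \<phi>)\<^sup>+ \<Longrightarrow> (v a, v b) \<in> (inv_cong \<phi> \<union> \<theta>)\<^sup>+" for a b
      proof (induction rule: trancl_induct)
        case (base y)
        then have "(v a, v y) \<in> inv_cong \<phi> \<union> \<theta>"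
          using BI_inv[OF \<theta>] cong_in[OF \<phi>(1)] by (auto simp: inv_cong_def)
        then show ?case by blast
      next
        case (step y z)
        then have "(v y, v z) \<in> inv_cong \<phi> \<union> \<theta>"
          using BI_inv[OF \<theta>] cong_in[OF \<phi>(1)] by (auto simp: inv_cong_def)
        with step.IH show ?case by (rule trancl_into_trancl)
      qed
      from this[of "v l" "v p"] have "(l, p) \<in> (inv_cong \<phi> \<union> \<theta>)\<^sup>+"
        using \<open>(\<theta> \<union> \<phi>)\<^sup>+ = A \<times> A\<close> lp by simp
      then show "p \<in> coll (inv_cong \<phi>) \<union> coll \<theta>"
        using coll_trancl_Un[OF i\<phi> \<theta>C] coll_iff[OF l] by auto
    qed
    ultimately have "coll (inv_cong \<phi>) = coll \<phi>"
      using \<phi>(2) coll_subset[of "inv_cong \<phi>"] by auto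
    then have "inv_cong \<phi> = \<phi>" using Con.E_inject[OF i\<phi> \<phi>(1)] by simp
    then have "(v a, v b) \<in> \<phi>" if "(a, b) \<in> \<phi>" for a b
      using that unfolding inv_cong_def by auto
    then have "\<phi> \<in> BI" using \<phi>(1) by (simp add: BI_iff)
    then show ?thesis using \<phi>(2) by blast
  qed
  then show ?thesis by (simp add: BI.boolean_family_iff coll_full)
qed

section \<open>Classes moved by the involution, as a rank\<close>

text \<open>For invariant \<theta> the involution carries the class of \<open>x\<close> onto the
  class of \<open>v x\<close>, so \<open>(x, v x) \<in> \<theta>\<close> says that the class is
  mapped to itself.\<close>

definition nonfixed_classes :: "('a \<times> 'a) set \<Rightarrow> 'a set set" where
  "nonfixed_classes \<theta> = (\<lambda>x. \<theta> `` {x}) ` {x \<in> A. (x, v x) \<notin> \<theta>}"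

lemma class_eq_iff:
  assumes "\<theta> \<in> Cong" "x \<in> A" "y \<in> A"
  shows "\<theta> `` {x} = \<theta> `` {y} \<longleftrightarrow> (x, y) \<in> \<theta>"
  using assms by (intro eq_equiv_class_iff) (auto simp: Con_def lat_cong_def)

lemma fixed_class:
  assumes "\<theta> \<in> BI" "(x, y) \<in> \<theta>" "(x, v x) \<in> \<theta>"
  shows "(y, v y) \<in> \<theta>"
  using assms BI_inv[OF assms(1,2)] cong_sym cong_trans BI_Cong by metis

lemma finite_nonfixed_classes: "finite (nonfixed_classes \<theta>)"
  unfolding nonfixed_classes_def using finite_A by simp

lemma even_card_nonfixed_classes:
  assumes \<theta>: "\<theta> \<in> BI"
  shows "even (card (nonfixed_classes \<theta>))"
proof (rule even_card_involution[OF finite_nonfixed_classes])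
  note C = BI_Cong[OF \<theta>]
  fix X assume "X \<in> nonfixed_classes \<theta>"
  then obtain x where x: "x \<in> A" "(x, v x) \<notin> \<theta>" "X = \<theta> `` {x}" unfolding nonfixed_classes_def by auto
  have img: "v ` (\<theta> `` {y}) = \<theta> `` {v y}" if "y \<in> A" for y
  proof
    show "v ` (\<theta> `` {y}) \<subseteq> \<theta> `` {v y}" using BI_inv[OF \<theta>] by auto
    show "\<theta> `` {v y} \<subseteq> v ` (\<theta> `` {y})"
    proof
      fix z assume "z \<in> \<theta> `` {v y}"
      then have "(v y, z) \<in> \<theta>" by simp
      then have "(y, v z) \<in> \<theta>" "z = v (v z)" using BI_inv[OF \<theta>] cong_in[OF C] that by force+
      then show "z \<in> v ` (\<theta> `` {y})" by blast
    qed
  qed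
  have "(v x, v (v x)) \<notin> \<theta>" using x cong_sym[OF C, of "v x" x] by auto
  then have "v ` X \<in> nonfixed_classes \<theta>" using x img unfolding nonfixed_classes_def by auto
  moreover have "v ` (v ` X) = X" using x img[of x] img[of "v x"] by simp
  moreover have "v ` X \<noteq> X" using x img[of x] class_eq_iff[OF C, of "v x" x] cong_sym[OF C] by auto
  ultimately show "v ` X \<in> nonfixed_classes \<theta> \<and> v ` (v ` X) = X \<and> v ` X \<noteq> X" by simp
qed

lemma ex_comparable_in_diff:
  assumes \<theta>: "\<theta> \<in> Cong" and \<phi>: "\<phi> \<in> Cong" and "\<theta> \<subset> \<phi>"
  obtains a b where "(a, b) \<in> \<phi>" "(a, b) \<notin> \<theta>" "a \<sqsubseteq> b"
proof -
  obtain a b where ab: "(a, b) \<in> \<phi>" "(a, b) \<notin> \<theta>" using assms(3) by auto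
  have A: "a \<in> A" "b \<in> A" using cong_in[OF \<phi> ab(1)] by auto
  have "(a \<sqinter> b, b) \<in> \<phi>" "(a \<sqinter> b, a) \<in> \<phi>"
    using cong_meet[OF \<phi> ab(1) A(2)] cong_meet[OF \<phi> cong_sym[OF \<phi> ab(1)] A(1)] A
    by (simp_all add: meet_absorb1 meet_commute)
  moreover have "(a \<sqinter> b, b) \<notin> \<theta> \<or> (a \<sqinter> b, a) \<notin> \<theta>"
    using ab(2) cong_sym[OF \<theta>] cong_trans[OF \<theta>] by blast
  ultimately show ?thesis using that A meet_le1 meet_le2 by blast
qed

text \<open>Every nonfixed class of \<phi> contains a nonfixed class of \<theta>. Strictness needs
  one nonfixed class of \<theta>, that of \<open>c\<close>, which can be spared in choosing these
  representatives.\<close>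

lemma card_nonfixed_classes_less:
  assumes \<theta>: "\<theta> \<in> BI" and \<phi>: "\<phi> \<in> BI" and "\<theta> \<subset> \<phi>"
  shows "card (nonfixed_classes \<phi>) < card (nonfixed_classes \<theta>)"
proof -
  note C = BI_Cong[OF \<theta>] BI_Cong[OF \<phi>]
  have sub: "(x, y) \<in> \<phi>" if "(x, y) \<in> \<theta>" for x y using that assms(3) by auto
  obtain a b where ab: "(a, b) \<in> \<phi>" "(a, b) \<notin> \<theta>" "a \<sqsubseteq> b"
    using ex_comparable_in_diff[OF C assms(3)] by metis
  have A: "a \<in> A" "b \<in> A" using cong_in[OF C(2) ab(1)] by auto
  have img: "\<phi> `` (\<theta> `` {x}) = \<phi> `` {x}" if "x \<in> A" for x
    using cong_refl[OF C(1) that] cong_trans[OF C(2)] sub by blast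
  have "\<exists>c\<in>A. (c, v c) \<notin> \<theta> \<and> (\<forall>x\<in>A. (x, v x) \<notin> \<phi> \<longrightarrow>
      (\<exists>y\<in>A. (y, v y) \<notin> \<theta> \<and> (x, y) \<in> \<phi> \<and> (y, c) \<notin> \<theta>))"
  proof (cases "(a, v a) \<in> \<phi>")
    case True
    \<comment> \<open>Here the merged class is fixed, so a nonfixed class of \<theta> inside it can
      be spared. One exists because comparable elements whose classes are both fixed are related:
      meeting the two pairs gives \<open>(a, v b)\<close>. This is why a comparable pair was
      chosen.\<close>
    have "(a, v a) \<notin> \<theta> \<or> (b, v b) \<notin> \<theta>"
    proof (rule ccontr)
      assume "\<not> ((a, v a) \<notin> \<theta> \<or> (b, v b) \<notin> \<theta>)"
      then have fab: "(a, v a) \<in> \<theta>" "(b, v b) \<in> \<theta>" by auto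
      have "(a \<sqinter> b, v a \<sqinter> v b) \<in> \<theta>" using cong_meet2[OF C(1) fab] .
      moreover have "v b \<sqsubseteq> v a" using ab(3) A by (simp add: inv_le_iff)
      ultimately have "(a, v b) \<in> \<theta>" using ab(3) A by (simp add: meet_absorb1 meet_absorb2)
      then show False using fab(2) ab(2) cong_sym[OF C(1)] cong_trans[OF C(1)] by blast
    qed
    moreover have "(b, v b) \<in> \<phi>" using fixed_class[OF \<phi> ab(1) True] .
    ultimately obtain c where c: "c \<in> A" "(c, v c) \<notin> \<theta>" "(c, v c) \<in> \<phi>" using A True by auto
    have "(x, c) \<notin> \<theta>" if "(x, v x) \<notin> \<phi>" for x
      using that c sub fixed_class[OF \<phi> _ c(3)] cong_sym[OF C(2)] by blast
    then show ?thesis using c cong_refl[OF C(2)] sub by blast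
  next
    case False
    have b: "(b, v b) \<notin> \<phi>" using False fixed_class[OF \<phi> cong_sym[OF C(2) ab(1)]] by blast
    \<comment> \<open>Here the merged class is nonfixed and contains the distinct classes of
      \<open>a\<close> and \<open>b\<close>; the second can stand in for the first.\<close>
    have "\<exists>y\<in>A. (y, v y) \<notin> \<theta> \<and> (x, y) \<in> \<phi> \<and> (y, a) \<notin> \<theta>" if x: "x \<in> A" "(x, v x) \<notin> \<phi>" for x
    proof (cases "(x, a) \<in> \<phi>")
      case True
      then have "(x, b) \<in> \<phi>" using ab cong_trans[OF C(2)] by blast
      then show ?thesis using b sub A ab(2) cong_sym[OF C(1)] by blast
    next
      case False then show ?thesis using x sub cong_refl[OF C(2)] by blast
    qed
    then show ?thesis using A False sub by blast
  qed
  then obtain c where c: "c \<in> A" "(c, v c) \<notin> \<theta>"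
    and cover: "\<forall>x\<in>A. (x, v x) \<notin> \<phi> \<longrightarrow> (\<exists>y\<in>A. (y, v y) \<notin> \<theta> \<and> (x, y) \<in> \<phi> \<and> (y, c) \<notin> \<theta>)"
    by blast
  let ?N = "nonfixed_classes \<theta> - {\<theta> `` {c}}"
  have "nonfixed_classes \<phi> \<subseteq> (\<lambda>X. \<phi> `` X) ` ?N"
  proof
    fix X assume "X \<in> nonfixed_classes \<phi>"
    then obtain x where x: "x \<in> A" "(x, v x) \<notin> \<phi>" "X = \<phi> `` {x}" unfolding nonfixed_classes_def by auto
    then obtain y where y: "y \<in> A" "(y, v y) \<notin> \<theta>" "(x, y) \<in> \<phi>" "(y, c) \<notin> \<theta>" using cover by blast
    have "\<theta> `` {y} \<in> ?N"
      using y c class_eq_iff[OF C(1)] unfolding nonfixed_classes_def by auto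
    moreover have "X = \<phi> `` (\<theta> `` {y})" using x y img class_eq_iff[OF C(2)] by auto
    ultimately show "X \<in> (\<lambda>X. \<phi> `` X) ` ?N" by blast
  qed
  then have "card (nonfixed_classes \<phi>) \<le> card ?N"
    using finite_nonfixed_classes by (meson card_image_le card_mono finite_Diff finite_imageI order_trans)
  also have "\<dots> < card (nonfixed_classes \<theta>)"
    using c finite_nonfixed_classes by (intro card_Diff1_less) (auto simp: nonfixed_classes_def)
  finally show ?thesis .
qed

definition rank :: "('a \<times> 'a) set \<Rightarrow> nat" where
  "rank \<theta> = card (nonfixed_classes \<theta>) div 2"

text \<open>Both counts are even, so halving keeps the decrease strict.\<close>

lemma rank_less: "\<theta> \<in> BI \<Longrightarrow> \<phi> \<in> BI \<Longrightarrow> \<theta> \<subset> \<phi> \<Longrightarrow> rank \<phi> < rank \<theta>"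
  using card_nonfixed_classes_less[of \<theta> \<phi>] even_card_nonfixed_classes[of \<theta>]
    even_card_nonfixed_classes[of \<phi>]
  unfolding rank_def by (auto elim!: evenE)

lemma card_nonfixed_classes_Id: "card (nonfixed_classes (Id_on A)) = card {x \<in> A. v x \<noteq> x}"
proof -
  have "nonfixed_classes (Id_on A) = (\<lambda>x. {x}) ` {x \<in> A. v x \<noteq> x}"
    unfolding nonfixed_classes_def by (auto simp: Image_def Id_on_iff image_iff)
  then show ?thesis by (simp add: card_image)
qed

lemma rank_Id_le: "rank (Id_on A) \<le> card A div 2"
  unfolding rank_def card_nonfixed_classes_Id
  using finite_A by (intro div_le_mono card_mono) auto

theorem card_BI_le: "card BI \<le> 2 ^ (card A div 2)"
proof -
  have "card BI \<le> 2 ^ rank (Id_on A)" by (rule BI.card_le_rank[where r = rank, OF rank_less])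
  also have "\<dots> \<le> 2 ^ (card A div 2)" using rank_Id_le by (intro power_increasing) auto
  finally show ?thesis .
qed

section \<open>Structure forced by equality in the upper bound\<close>

context
  assumes extremal: "card BI = 2 ^ (card A div 2)"
begin

lemma rank_Id_eq: "rank (Id_on A) = card A div 2"
proof -
  have "2 ^ (card A div 2) \<le> (2::nat) ^ rank (Id_on A)"
    using BI.card_le_rank[where r = rank, OF rank_less] extremal by simp
  then have "card A div 2 \<le> rank (Id_on A)"
    by (simp only: power_increasing_iff one_less_numeral_iff semiring_norm)
  then show ?thesis using rank_Id_le by simp
qed

text \<open>Two fixed points would leave at most \<open>card A - 2\<close> moved singletons, and the
  rank at the bottom would fall short of \<open>card A div 2\<close>.\<close>

lemma fixed_point_unique:
  assumes "x \<in> A" "y \<in> A" "v x = x" "v y = y"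
  shows "x = y"
proof (rule ccontr)
  assume "x \<noteq> y"
  have "{x \<in> A. v x \<noteq> x} \<subseteq> A - {x, y}" using assms by auto
  then have "card {x \<in> A. v x \<noteq> x} \<le> card (A - {x, y})" using finite_A by (intro card_mono) auto
  also have "\<dots> = card A - 2" using assms \<open>x \<noteq> y\<close> by (simp add: card_Diff_subset)
  finally have "card {x \<in> A. v x \<noteq> x} \<le> card A - 2" .
  moreover have "2 \<le> card A" using card_mono[OF finite_A, of "{x, y}"] assms \<open>x \<noteq> y\<close> by simp
  ultimately show False
    using rank_Id_eq unfolding rank_def card_nonfixed_classes_Id by linarith
qed

lemma iso_L2pow_BI: "iso_L2pow BI (card A div 2)"
proof -
  have "card BI = 2 ^ rank (Id_on A)" using extremal rank_Id_eq by simp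
  then obtain k where k: "iso_L2pow BI k"
    using BI.iso_L2pow_if_complemented BI.extremal_atom(2)[where r = rank, OF rank_less] by metis
  then have "2 ^ k = (2::nat) ^ (card A div 2)" using card_iso_L2pow extremal by metis
  then have "k = card A div 2" by simp
  then show ?thesis using k by simp
qed

text \<open>An atom of the congruence lattice lowers the number of classes not fixed by the involution
  by exactly two, so at most two points can be dropped from a system of representatives.\<close>

lemma atom_redundant:
  assumes a: "BI.atom \<theta>" and S: "S \<subseteq> A" and nonfixed: "\<forall>x\<in>S. v x \<noteq> x"
    and red: "\<forall>x\<in>S. (x, v x) \<in> \<theta> \<or> (\<exists>y\<in>A - S. (x, y) \<in> \<theta>)"
  shows "card S \<le> 2"
proof -
  note \<theta> = BI.atom_in[OF a] note C = BI_Cong[OF \<theta>]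
  let ?F = "{x \<in> A. v x \<noteq> x}"
  have "Suc (rank \<theta>) = rank (Id_on A)"
    using BI.extremal_atom(1)[where r = rank, OF rank_less _ a] extremal rank_Id_eq by simp
  then have two: "card (nonfixed_classes \<theta>) + 2 = card ?F"
    using even_card_nonfixed_classes[OF \<theta>] even_card_nonfixed_classes[OF BI.b_in]
    unfolding rank_def card_nonfixed_classes_Id by (auto elim!: evenE)
  have "nonfixed_classes \<theta> \<subseteq> (\<lambda>x. \<theta> `` {x}) ` (?F - S)"
  proof
    fix X assume "X \<in> nonfixed_classes \<theta>"
    then obtain x where x: "x \<in> A" "(x, v x) \<notin> \<theta>" "X = \<theta> `` {x}" unfolding nonfixed_classes_def by auto
    obtain y where y: "y \<in> A - S" "(x, y) \<in> \<theta>" using x red cong_refl[OF C x(1)] by blast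
    have "(y, v y) \<notin> \<theta>" using x y fixed_class[OF \<theta> cong_sym[OF C y(2)]] by blast
    then have "v y \<noteq> y" using y cong_refl[OF C] by force
    moreover have "X = \<theta> `` {y}" using x y class_eq_iff[OF C] by auto
    ultimately show "X \<in> (\<lambda>x. \<theta> `` {x}) ` (?F - S)" using y by blast
  qed
  then have "card (nonfixed_classes \<theta>) \<le> card (?F - S)"
    using finite_A by (intro surj_card_le) auto
  moreover have "S \<subseteq> ?F" using S nonfixed by auto
  then have "card (?F - S) = card ?F - card S" "card S \<le> card ?F"
    using finite_A by (auto intro: card_Diff_subset card_mono finite_subset)
  ultimately show ?thesis using two by linarith
qed

lemma atom_no_three:
  assumes a: "BI.atom \<theta>" and xyz: "x \<in> A" "y \<in> A" "z \<in> A" "x \<noteq> y" "x \<noteq> z" "y \<noteq> z"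
    and nonfixed: "v x \<noteq> x" "v y \<noteq> y" "v z \<noteq> z"
    and red: "\<And>s. s \<in> {x, y, z} \<Longrightarrow> (s, v s) \<in> \<theta> \<or> (\<exists>t\<in>A - {x, y, z}. (s, t) \<in> \<theta>)"
  shows False
  using atom_redundant[OF a, of "{x, y, z}"] assms by simp

text \<open>Were the class of \<open>a\<close> fixed, three redundant points would arise. If the
  class of \<open>c\<close> is fixed too, all four points are redundant and at most one is a fixed
  point of \<open>v\<close>. Otherwise \<open>d\<close> is represented by \<open>c\<close>,
  \<open>v d\<close> by \<open>v c\<close>, and one of \<open>a\<close>, \<open>b\<close> is moved
  by \<open>v\<close> but lies in a fixed class.\<close>

lemma atom_pair_nonfixed:
  assumes at: "BI.atom \<theta>" and A: "a \<in> A" "b \<in> A" "c \<in> A" "d \<in> A"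
    and dist: "a \<noteq> b" "a \<noteq> c" "a \<noteq> d" "b \<noteq> c" "b \<noteq> d" "c \<noteq> d"
    and pairs: "(a, b) \<in> \<theta>" "(c, d) \<in> \<theta>"
  shows "(a, v a) \<notin> \<theta>"
proof
  assume fa: "(a, v a) \<in> \<theta>"
  note \<theta> = BI.atom_in[OF at] note C = BI_Cong[OF \<theta>]
  note sym = cong_sym[OF C] and trans = cong_trans[OF C] and refl = cong_refl[OF C]
  have fb: "(b, v b) \<in> \<theta>" using fixed_class[OF \<theta> pairs(1) fa] .
  show False
  proof (cases "(c, v c) \<in> \<theta>")
    case True
    then have fd: "(d, v d) \<in> \<theta>" using fixed_class[OF \<theta> pairs(2)] by simp
    let ?S = "{x \<in> {a, b, c, d}. v x \<noteq> x}"
    have "card ?S \<le> 2"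
      using at A fa fb fd True by (intro atom_redundant) auto
    moreover obtain e where "{a, b, c, d} - {e} \<subseteq> ?S"
    proof (cases "\<exists>e\<in>{a, b, c, d}. v e = e")
      case True
      then obtain e where e: "e \<in> {a, b, c, d}" "v e = e" by blast
      have "{a, b, c, d} - {e} \<subseteq> ?S"
      proof
        fix x assume x: "x \<in> {a, b, c, d} - {e}"
        then have "x \<in> A" "e \<in> A" using e(1) A by auto
        then have "v x \<noteq> x" using fixed_point_unique[of x e] x e(2) by auto
        then show "x \<in> ?S" using x by simp
      qed
      then show ?thesis by (rule that)
    next
      case False
      then have "{a, b, c, d} - {a} \<subseteq> ?S" by auto
      then show ?thesis by (rule that)
    qed
    then have "card ({a, b, c, d} - {e}) \<le> card ?S" by (intro card_mono) auto
    moreover have "card {a, b, c, d} = 4" using dist by simp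
    then have "3 \<le> card ({a, b, c, d} - {e})" by (simp add: card_Diff_singleton_if)
    ultimately show False by linarith
  next
    case False
    then have fd: "(d, v d) \<notin> \<theta>" using fixed_class[OF \<theta> sym[OF pairs(2)]] by blast
    obtain x where x: "x \<in> {a, b}" "v x \<noteq> x" using fixed_point_unique A dist by blast
    have xA: "x \<in> A" and fx: "(x, v x) \<in> \<theta>" using x A fa fb by auto
    have vcd: "(v d, v c) \<in> \<theta>" using BI_inv[OF \<theta> sym[OF pairs(2)]] .
    have ne: "c \<noteq> v d" "v c \<noteq> d" "v c \<noteq> x" "d \<noteq> v d" "x \<noteq> v d" "v d \<noteq> v c"
      using False fd refl A pairs sym fx dist inv_inv inv_eq_iff by metis+
    show False
    proof (rule atom_no_three[OF at, of d "v d" x])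
      fix s assume "s \<in> {d, v d, x}"
      moreover have "c \<in> A - {d, v d, x}" "v c \<in> A - {d, v d, x}" using ne x dist A by auto
      ultimately show "(s, v s) \<in> \<theta> \<or> (\<exists>t\<in>A - {d, v d, x}. (s, t) \<in> \<theta>)"
        using fx vcd sym[OF pairs(2)] by blast
    qed (use ne x xA dist A in auto)
  qed
qed

text \<open>The points \<open>b\<close> and \<open>d\<close>, represented by \<open>a\<close> and
  \<open>c\<close>, exhaust the budget of two. Any further coincidence would make a third point
  redundant, so the involution can only exchange the two pairs, and it reverses their order.\<close>

lemma atom_two_pairs:
  assumes at: "BI.atom \<theta>" and A: "a \<in> A" "b \<in> A" "c \<in> A" "d \<in> A"
    and dist: "a \<noteq> b" "a \<noteq> c" "a \<noteq> d" "b \<noteq> c" "b \<noteq> d" "c \<noteq> d"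
    and pairs: "(a, b) \<in> \<theta>" "(c, d) \<in> \<theta>" and le: "a \<sqsubseteq> b" "c \<sqsubseteq> d"
  shows "v a = d" "v b = c" "\<And>x y. (x, y) \<in> \<theta> \<Longrightarrow> x \<noteq> y \<Longrightarrow> x \<in> {a, b, c, d}"
proof -
  note \<theta> = BI.atom_in[OF at] note C = BI_Cong[OF \<theta>]
  note sym = cong_sym[OF C] and trans = cong_trans[OF C] and refl = cong_refl[OF C]
  have fa: "(a, v a) \<notin> \<theta>" by (rule atom_pair_nonfixed[OF at A dist pairs])
  have fc: "(c, v c) \<notin> \<theta>"
    by (rule atom_pair_nonfixed[OF at A(3,4,1,2) _ _ _ _ _ _ pairs(2,1)]) (use dist in auto)
  have fb: "(b, v b) \<notin> \<theta>" and fd: "(d, v d) \<notin> \<theta>"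
    using fa fc fixed_class[OF \<theta> sym] pairs by blast+
  have vne: "v b \<noteq> b" "v c \<noteq> c" "v d \<noteq> d" using fb fc fd refl A by metis+
  have vab: "(v a, v b) \<in> \<theta>" using BI_inv[OF \<theta> pairs(1)] .
  have ac: "(a, c) \<notin> \<theta>"
  proof
    assume ac: "(a, c) \<in> \<theta>"
    show False
    proof (rule atom_no_three[OF at, of b c d])
      fix s assume "s \<in> {b, c, d}"
      then have "(s, a) \<in> \<theta>" using ac pairs sym trans by blast
      then show "(s, v s) \<in> \<theta> \<or> (\<exists>t\<in>A - {b, c, d}. (s, t) \<in> \<theta>)" using A dist by blast
    qed (use A dist vne in auto)
  qed
  \<comment> \<open>Otherwise \<open>v b\<close>, represented by \<open>v a\<close>, would be a
    third redundant point.\<close>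
  have vac: "(v a, c) \<in> \<theta>"
  proof (rule ccontr)
    assume vac: "(v a, c) \<notin> \<theta>"
    have "a \<noteq> v b" "c \<noteq> v b" "v a \<noteq> b" "v a \<noteq> d" "v a \<noteq> v b" "d \<noteq> v b"
      using vac fa vab pairs sym trans A dist inv_eq_iff by metis+
    note ne = this
    show False
    proof (rule atom_no_three[OF at, of b d "v b"])
      fix s assume "s \<in> {b, d, v b}"
      moreover have "a \<in> A - {b, d, v b}" "c \<in> A - {b, d, v b}" "v a \<in> A - {b, d, v b}"
        using ne A dist by auto
      ultimately show "(s, v s) \<in> \<theta> \<or> (\<exists>t\<in>A - {b, d, v b}. (s, t) \<in> \<theta>)"
        using sym[OF pairs(1)] sym[OF pairs(2)] sym[OF vab] by blast
    qed (use A dist vne ne in auto)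
  qed
  show only: "x \<in> {a, b, c, d}" if xy: "(x, y) \<in> \<theta>" "x \<noteq> y" for x y
  proof (rule ccontr)
    assume x: "x \<notin> {a, b, c, d}"
    have xA: "x \<in> A" "y \<in> A" using cong_in[OF C xy(1)] by auto
    \<comment> \<open>A further nontrivially related \<open>x\<close> supplies the third redundant
      point: in a fixed class it is whichever of \<open>x\<close>, \<open>y\<close> is moved by
      \<open>v\<close>; otherwise it is \<open>x\<close>, represented by \<open>a\<close>,
      \<open>c\<close> or \<open>y\<close>.\<close>
    have "\<exists>e\<in>A. e \<notin> {b, d, a, c} \<and> v e \<noteq> e \<and> ((e, v e) \<in> \<theta> \<or> (\<exists>t\<in>A - {b, d, e}. (e, t) \<in> \<theta>))"
    proof (cases "(x, v x) \<in> \<theta>")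
      case True
      then have "(y, v y) \<in> \<theta>" using fixed_class[OF \<theta> xy(1)] by simp
      moreover obtain e where e: "e \<in> {x, y}" "v e \<noteq> e" using fixed_point_unique xA xy by blast
      ultimately have fe: "(e, v e) \<in> \<theta>" using True by auto
      then have "e \<notin> {b, d, a, c}" using fa fb fc fd by auto
      moreover have "e \<in> A" using e(1) xA by auto
      ultimately show ?thesis using fe e(2) by blast
    next
      case False
      then have "v x \<noteq> x" using refl xA by metis
      moreover have "\<exists>t\<in>A - {b, d, x}. (x, t) \<in> \<theta>"
      proof (cases "(x, a) \<in> \<theta> \<or> (x, c) \<in> \<theta>")
        case True then show ?thesis using x A dist by blast
      next
        case False
        then have "y \<noteq> b" "y \<noteq> d" using xy pairs sym trans by blast+
        then show ?thesis using xy xA by blast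
      qed
      ultimately show ?thesis using x xA by blast
    qed
    then obtain e where e: "e \<in> A" "e \<notin> {b, d, a, c}" "v e \<noteq> e"
      "(e, v e) \<in> \<theta> \<or> (\<exists>t\<in>A - {b, d, e}. (e, t) \<in> \<theta>)" by blast
    show False
    proof (rule atom_no_three[OF at, of b d e])
      fix s assume "s \<in> {b, d, e}"
      moreover have "a \<in> A - {b, d, e}" "c \<in> A - {b, d, e}" using e A dist by auto
      ultimately show "(s, v s) \<in> \<theta> \<or> (\<exists>t\<in>A - {b, d, e}. (s, t) \<in> \<theta>)"
        using sym[OF pairs(1)] sym[OF pairs(2)] e(4) by blast
    qed (use A dist vne e in auto)
  qed
  have vbc: "(v b, c) \<in> \<theta>" using vab vac sym trans by blast
  have "v a \<noteq> a" "v a \<noteq> b" using fa refl[OF A(1)] pairs(1) by auto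
  then have va: "v a \<in> {c, d}" using only[OF vac] by auto
  have "a \<noteq> v b" using fa vab sym by metis
  then have vb: "v b \<in> {c, d}"
    using only[OF vbc] vne(1) by auto
  have "v b \<sqsubseteq> v a" "v a \<noteq> v b" using le(1) A dist by (simp_all add: inv_le_iff inv_eq_iff)
  moreover have "\<not> d \<sqsubseteq> c" using le(2) A dist le_antisym by blast
  ultimately show "v a = d" "v b = c" using va vb by auto
qed

text \<open>An atom collapsing a join-irreducible edge under \<open>x\<close> but not under
  \<open>y\<close> also collapses the edge translated up to the meet \<open>z\<close> of
  \<open>x\<close> and \<open>y\<close>, namely \<open>(z, p)\<close>, and its join with
  \<open>y\<close>. These are two disjoint pairs, so \<open>atom_two_pairs\<close> determines the
  involution on them.\<close>

lemma extremal_incomparable_half: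
  assumes x: "x \<in> A" and y: "y \<in> A" and inc: "x \<parallel> y"
  obtains \<theta> p where "\<theta> \<in> Cong" "p \<in> A" "x \<sqinter> y \<sqsubseteq> p" "p \<sqsubseteq> x" "\<not> p \<sqsubseteq> y" "(x \<sqinter> y, p) \<in> \<theta>"
    "v (x \<sqinter> y) = y \<squnion> p" "v p = y"
    "\<forall>s t. (s, t) \<in> \<theta> \<and> s \<noteq> t \<longrightarrow> s \<in> {x \<sqinter> y, p, y, y \<squnion> p}"
proof -
  obtain l r where r: "jcov l r" "r \<sqsubseteq> x" "\<not> r \<sqsubseteq> y" "l \<sqsubseteq> y" using ex_jcov[OF y x] inc by metis
  note lr = jcov_in[OF r(1)] jcov_lt[OF r(1)]
  have "r \<in> coll (A \<times> A)" using r(1) coll_full unfolding JI_def by auto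
  moreover have "card BI = 2 ^ rank (Id_on A)" using extremal rank_Id_eq by simp
  ultimately obtain \<theta> where \<theta>: "BI.atom \<theta>" "r \<in> coll \<theta>"
    using BI.atomistic_if_complemented BI.extremal_atom(2)[where r = rank, OF rank_less] by metis
  note C = BI_Cong[OF BI.atom_in[OF \<theta>(1)]]
  define z p where "z = x \<sqinter> y" and "p = z \<squnion> r"
  have in_A: "z \<in> A" "p \<in> A" using x y lr by (simp_all add: z_def p_def)
  have "l \<sqsubseteq> x" using lr r(2) x le_trans[of l r x] by blast
  then have "l \<sqsubseteq> z" using lr r(4) x y by (simp add: z_def meet_greatest)
  moreover have "(l \<squnion> z, r \<squnion> z) \<in> \<theta>" using cong_join[OF C _ in_A(1)] \<theta>(2) coll_iff[OF r(1)] by simp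
  ultimately have zp: "(z, p) \<in> \<theta>" using lr in_A by (simp add: p_def join_absorb1 join_commute)
  have le: "z \<sqsubseteq> p" "p \<sqsubseteq> x" "z \<sqsubseteq> y" "z \<sqsubseteq> x" using x y lr r(2) in_A by (simp_all add: p_def z_def join_least)
  have npy: "\<not> p \<sqsubseteq> y" using r(3) lr in_A y le_trans[of r p y] by (auto simp: p_def)
  have "(z \<squnion> y, p \<squnion> y) \<in> \<theta>" using cong_join[OF C zp y] .
  then have yw: "(y, y \<squnion> p) \<in> \<theta>" using in_A y le by (simp add: join_absorb1 join_commute)
  have wA: "y \<squnion> p \<in> A" using in_A y by simp
  have dist: "z \<noteq> p" "z \<noteq> y" "z \<noteq> y \<squnion> p" "p \<noteq> y" "p \<noteq> y \<squnion> p" "y \<noteq> y \<squnion> p"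
  proof -
    show "z \<noteq> p" "p \<noteq> y" using npy le(3) y by auto
    show "z \<noteq> y" using le(4) inc by auto
    show "y \<noteq> y \<squnion> p" using npy join_ge2[OF y in_A(2)] by auto
    show "z \<noteq> y \<squnion> p" using npy le(3) join_ge2[OF y in_A(2)] le_trans[OF in_A(2,1) y] by auto
    show "p \<noteq> y \<squnion> p" using join_ge1[OF y in_A(2)] le(2) inc le_trans[OF y in_A(2) x] by auto
  qed
  show ?thesis
  proof (rule that[OF C in_A(2)])
    show "v (x \<sqinter> y) = y \<squnion> p" "v p = y"
      "\<forall>s t. (s, t) \<in> \<theta> \<and> s \<noteq> t \<longrightarrow> s \<in> {x \<sqinter> y, p, y, y \<squnion> p}"
      using atom_two_pairs[OF \<theta>(1) in_A y wA dist zp yw le(1) join_ge1[OF y in_A(2)]]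
      unfolding z_def by blast+
  qed (use le npy zp in \<open>simp_all add: z_def\<close>)
qed

text \<open>The mirrored construction yields \<open>q\<close> below \<open>y\<close> with
  \<open>v q = x\<close>. The first atom moves \<open>q\<close> to its join with \<open>p\<close>,
  so \<open>q\<close> is one of the four points listed for that atom, and only \<open>y\<close> is
  possible.\<close>

lemma extremal_incomparable:
  assumes x: "x \<in> A" and y: "y \<in> A" and inc: "x \<parallel> y"
  shows "v x = y"
proof -
  obtain \<theta> p where \<theta>: "\<theta> \<in> Cong" and p: "p \<in> A" "x \<sqinter> y \<sqsubseteq> p" "p \<sqsubseteq> x" "\<not> p \<sqsubseteq> y"
    and zp: "(x \<sqinter> y, p) \<in> \<theta>"
    and only: "\<forall>s t. (s, t) \<in> \<theta> \<and> s \<noteq> t \<longrightarrow> s \<in> {x \<sqinter> y, p, y, y \<squnion> p}"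
    by (rule extremal_incomparable_half[OF assms])
  obtain q where q: "q \<in> A" "y \<sqinter> x \<sqsubseteq> q" "q \<sqsubseteq> y" "\<not> q \<sqsubseteq> x" and vq: "v q = x"
    by (rule extremal_incomparable_half[OF y x]) (use inc in auto)
  have "(q, p \<squnion> q) \<in> \<theta>"
    using cong_join[OF \<theta> zp q(1)] q(2) x y q(1) by (simp add: meet_commute join_absorb1)
  moreover have "q \<noteq> p \<squnion> q" using p q y le_trans[of p q y] join_ge1[of p q] by metis
  ultimately have "q \<in> {x \<sqinter> y, p, y, y \<squnion> p}" using only by blast
  moreover have "q \<noteq> x \<sqinter> y" "q \<noteq> p" using q p x y meet_le1 by metis+
  moreover have "q \<noteq> y \<squnion> p" using p q y le_trans[of p q y] join_ge2[of y p] by metis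
  ultimately have "q = y" by simp
  then show ?thesis using vq y inv_inv by metis
qed

text \<open>Incomparable pairs are exchanged by \<open>v\<close>. Given two different ones with
  \<open>a\<close> below \<open>c\<close>, the partner \<open>d\<close> of \<open>c\<close> is below
  the partner \<open>b\<close> of \<open>a\<close>. As \<open>c\<close> and \<open>b\<close> are
  comparable, one of the pairs becomes comparable.\<close>

lemma extremal_classification:
  "(\<forall>x\<in>A. \<forall>y\<in>A. x \<sqsubseteq> y \<or> y \<sqsubseteq> x) \<or> (\<exists>p q. diamond p q \<and> v p = q)"
proof (cases "\<forall>x\<in>A. \<forall>y\<in>A. x \<sqsubseteq> y \<or> y \<sqsubseteq> x")
  case False
  then obtain x y where xy: "x \<in> A" "y \<in> A" "x \<parallel> y" by blast
  have vx: "v x = y" using extremal_incomparable[OF xy] .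
  have no: False if "a \<in> A" "b \<in> A" "a \<parallel> b" "c \<in> A" "d \<in> A" "c \<parallel> d" "a \<noteq> c" "a \<noteq> d" "a \<sqsubseteq> c" for a b c d
  proof -
    have v: "v a = b" "v c = d" using extremal_incomparable that by auto
    have "d \<sqsubseteq> b" using inv_antimono[of a c] v that by simp
    have "c \<noteq> b" using v that inv_inv by metis
    then have "c \<sqsubseteq> b \<or> b \<sqsubseteq> c" using extremal_incomparable[of c b] v(2) that
      by (metis inv_eq_iff inv_inv v(1))
    then show False using that \<open>d \<sqsubseteq> b\<close> le_trans[of a c b] le_trans[of d b c] by blast
  qed
  have "{a, b} = {x, y}" if ab: "a \<in> A" "b \<in> A" "a \<parallel> b" for a b
  proof -
    have vb: "v a = b" "v b = a" using extremal_incomparable[OF ab] ab by auto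
    show ?thesis
    proof (rule ccontr)
      assume "{a, b} \<noteq> {x, y}"
      then have "a \<noteq> x" "a \<noteq> y" using vb vx xy inv_inv by (metis insert_commute)+
      then have ne: "x \<noteq> a" "x \<noteq> b" using vb vx xy inv_inv by metis+
      have "x \<sqsubseteq> a \<or> a \<sqsubseteq> x" using extremal_incomparable[OF xy(1) ab(1)] vx \<open>a \<noteq> y\<close> by auto
      then show False using no[OF xy ab] no[OF ab xy] ne \<open>a \<noteq> y\<close> by auto
    qed
  qed
  then have "diamond x y" using xy unfolding diamond_def by blast
  then show ?thesis using vx by blast
qed simp

end

end

section \<open>Chains and glued four-element lattices\<close>

context finite_lattice
begin

definition chain :: bool where
  "chain \<longleftrightarrow> (\<forall>x\<in>A. \<forall>y\<in>A. x \<sqsubseteq> y \<or> y \<sqsubseteq> x)"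

definition below :: "'a \<Rightarrow> 'a set" where
  "below x = {y \<in> A. y \<sqsubset> x}"

lemma finite_below: "finite (below x)"
  using finite_A by (simp add: below_def)

lemma below_mono: "x \<in> A \<Longrightarrow> y \<in> A \<Longrightarrow> x \<sqsubseteq> y \<Longrightarrow> below x \<subseteq> below y"
  unfolding below_def using le_trans le_antisym by blast

lemma card_below_less:
  assumes "x \<in> A" "y \<in> A" "x \<sqsubset> y"
  shows "card (below x) < card (below y)"
proof (rule psubset_card_mono[OF finite_below])
  have "x \<in> below y - below x" using assms by (simp add: below_def)
  then show "below x \<subset> below y" using below_mono[of x y] assms by blast
qed

lemma iso_chain_iff: "iso_chain A join meet (card A) \<longleftrightarrow> chain"
proof
  assume "iso_chain A join meet (card A)"
  then obtain f where f: "bij_betw f A {..<card A}"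
    and hom: "\<And>x y. x \<in> A \<Longrightarrow> y \<in> A \<Longrightarrow> f (x \<sqinter> y) = min (f x) (f y)"
    unfolding iso_chain_def lat_iso_def by blast
  have "x \<sqinter> y = x \<or> y \<sqinter> x = y" if "x \<in> A" "y \<in> A" for x y
  proof -
    have "f (x \<sqinter> y) = f x \<or> f (y \<sqinter> x) = f y"
      using hom[OF that] hom[OF that(2,1)] by (simp add: min_def)
    then show ?thesis using f that meet_in unfolding bij_betw_def inj_on_def by blast
  qed
  then show chain unfolding chain_def le_iff_meet by blast
next
  assume chain
  \<comment> \<open>The number of strictly smaller elements is the position in the chain, starting
    at 0.\<close>
  let ?f = "\<lambda>x. card (below x)"
  have mono: "?f x \<le> ?f y \<longleftrightarrow> x \<sqsubseteq> y" if "x \<in> A" "y \<in> A" for x y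
    using that \<open>chain\<close> card_below_less[of y x] card_mono[OF finite_below below_mono[of x y]] le_refl
    unfolding chain_def by (metis leD)
  have inj: "inj_on ?f A"
    using mono le_antisym by (intro inj_onI) (metis order_refl)
  have "?f x < card A" if "x \<in> A" for x
    using that finite_A by (intro psubset_card_mono) (auto simp: below_def)
  then have "?f ` A = {..<card A}"
    using inj by (intro card_subset_eq) (auto simp: card_image)
  with inj have "bij_betw ?f A {..<card A}" by (simp add: bij_betw_def)
  moreover have "?f (x \<squnion> y) = max (?f x) (?f y) \<and> ?f (x \<sqinter> y) = min (?f x) (?f y)"
    if xy: "x \<in> A" "y \<in> A" for x y
  proof (cases "x \<sqsubseteq> y")
    case True
    then show ?thesis using mono[OF xy] xy by (simp add: join_absorb1 meet_absorb1)
  next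
    case False
    then have "y \<sqsubseteq> x" using \<open>chain\<close> xy unfolding chain_def by blast
    then show ?thesis using mono[OF xy(2,1)] xy by (simp add: join_absorb2 meet_absorb2 max_absorb1 min_absorb2)
  qed
  ultimately show "iso_chain A join meet (card A)" unfolding iso_chain_def lat_iso_def by blast
qed

lemma JI_chain:
  assumes chain
  shows "JI = A - {\<bottom>}"
proof
  show "A - {\<bottom>} \<subseteq> JI"
  proof
    fix x assume "x \<in> A - {\<bottom>}"
    then show "x \<in> JI" using assms by (intro JI_I) (auto simp: chain_def)
  qed
qed (rule JI_subset)

lemma join_prime_chain:
  assumes chain "p \<in> A"
  shows "join_prime p"
  unfolding join_prime_def
proof (intro conjI ballI impI)
  fix x y assume xy: "x \<in> A" "y \<in> A" "p \<sqsubseteq> x \<squnion> y"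
  have "x \<sqsubseteq> y \<or> y \<sqsubseteq> x" using assms(1) xy unfolding chain_def by blast
  then show "p \<sqsubseteq> x \<or> p \<sqsubseteq> y" using xy by (auto simp: join_absorb1 join_absorb2)
qed (rule assms)

lemma card_Cong_chain: "chain \<Longrightarrow> card Cong = 2 ^ (card A - 1)"
  using card_Cong_prime join_prime_chain JI_chain finite_A by simp

lemma diamond_sym: "diamond p q \<Longrightarrow> diamond q p"
  unfolding diamond_def by (metis insert_commute)

lemma diamond_in: "diamond p q \<Longrightarrow> p \<in> A" "diamond p q \<Longrightarrow> q \<in> A"
  and diamond_incomp: "diamond p q \<Longrightarrow> p \<parallel> q"
  and diamond_only: "diamond p q \<Longrightarrow> x \<in> A \<Longrightarrow> y \<in> A \<Longrightarrow> x \<parallel> y \<Longrightarrow> {x, y} = {p, q}"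
  unfolding diamond_def by blast+

lemma not_chain_diamond: "diamond p q \<Longrightarrow> \<not> chain"
  unfolding diamond_def chain_def by blast

lemma diamond_comparable:
  assumes "diamond p q" "x \<in> A" "y \<in> A" "x \<noteq> p" "x \<noteq> q"
  shows "x \<sqsubseteq> y \<or> y \<sqsubseteq> x"
  using diamond_only[OF assms(1-3)] assms(4,5) by blast

lemma diamond_above:
  assumes D: "diamond p q" and x: "x \<in> A" "p \<sqsubset> x"
  shows "p \<squnion> q \<sqsubseteq> x"
proof -
  note D' = diamond_in[OF D] diamond_incomp[OF D]
  have "x \<noteq> q" using x D' by blast
  then have "x \<sqsubseteq> q \<or> q \<sqsubseteq> x" using diamond_comparable[OF D x(1) D'(2)] x by blast
  then have "q \<sqsubseteq> x" using x D' le_trans by blast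
  then show ?thesis using x D' by (simp add: join_least)
qed

lemma diamond_below:
  assumes D: "diamond p q" and x: "x \<in> A" "x \<sqsubset> p"
  shows "x \<sqsubseteq> p \<sqinter> q"
proof -
  note D' = diamond_in[OF D] diamond_incomp[OF D]
  have "x \<noteq> q" using x D' by blast
  then have "x \<sqsubseteq> q \<or> q \<sqsubseteq> x" using diamond_comparable[OF D x(1) D'(2)] x by blast
  then have "x \<sqsubseteq> q" using x D' le_trans by blast
  then show ?thesis using x D' by (simp add: meet_greatest)
qed

lemma diamond_strict:
  assumes D: "diamond p q"
  shows "p \<sqsubset> p \<squnion> q" "q \<sqsubset> p \<squnion> q" "p \<sqinter> q \<sqsubset> p" "p \<sqinter> q \<sqsubset> q"
    "p \<squnion> q \<in> A" "p \<sqinter> q \<in> A"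
proof -
  note D' = diamond_in[OF D] diamond_incomp[OF D]
  show "p \<squnion> q \<in> A" "p \<sqinter> q \<in> A" using D' by simp_all
  show "p \<sqsubset> p \<squnion> q" "q \<sqsubset> p \<squnion> q" using D' by (metis join_ge1 join_ge2)+
  show "p \<sqinter> q \<sqsubset> p" "p \<sqinter> q \<sqsubset> q" using D' by (metis meet_le1 meet_le2)+
qed

lemma JI_diamond:
  assumes D: "diamond p q"
  shows "JI = A - {\<bottom>, p \<squnion> q}" "card JI = card A - 2"
proof -
  note D' = diamond_in[OF D] diamond_incomp[OF D]
  have "x \<in> JI" if x: "x \<in> A - {\<bottom>, p \<squnion> q}" for x
  proof (rule JI_I)
    fix a b assume "a \<in> A" "b \<in> A" "a \<parallel> b"
    then have "{a, b} = {p, q}" using diamond_only[OF D] by blast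
    then have "a \<squnion> b = p \<squnion> q" using join_commute[OF D'(1,2)] by (auto simp: doubleton_eq_iff)
    then show "a \<squnion> b \<noteq> x" using x by auto
  qed (use x in auto)
  then show "JI = A - {\<bottom>, p \<squnion> q}" using JI_subset join_not_JI[OF D'] by auto
  then show "card JI = card A - 2"
    using join_not_JI(2)[OF D'] D' finite_A by (simp add: card_Diff_subset)
qed

text \<open>Only the join of \<open>p\<close> and \<open>q\<close> needs testing. An element
  strictly below it but below neither \<open>p\<close> nor \<open>q\<close> would be above
  \<open>p\<close>, hence above the join by \<open>diamond_above\<close>.\<close>

lemma join_prime_diamond:
  assumes D: "diamond p q" and r: "r \<in> JI"
  shows "join_prime r"
  unfolding join_prime_def
proof (intro conjI ballI impI)
  note D' = diamond_in[OF D] diamond_incomp[OF D]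
  show rA: "r \<in> A" using r JI_subset by auto
  fix x y assume xy: "x \<in> A" "y \<in> A" "r \<sqsubseteq> x \<squnion> y"
  show "r \<sqsubseteq> x \<or> r \<sqsubseteq> y"
  proof (cases "x \<parallel> y")
    case False
    then show ?thesis using xy by (auto simp: join_absorb1 join_absorb2)
  next
    case True
    then have eq: "{x, y} = {p, q}" using diamond_only[OF D] xy by blast
    then have "x \<squnion> y = p \<squnion> q" using join_commute[OF D'(1,2)] by (auto simp: doubleton_eq_iff)
    then have rw: "r \<sqsubset> p \<squnion> q" using xy r JI_diamond[OF D] by auto
    have "r \<sqsubseteq> p \<or> r \<sqsubseteq> q"
    proof (rule ccontr)
      assume not: "\<not> (r \<sqsubseteq> p \<or> r \<sqsubseteq> q)"
      then have "r \<noteq> p" "r \<noteq> q" using D' by auto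
      then have "p \<sqsubset> r" using diamond_comparable[OF D rA D'(1)] not by blast
      then have "p \<squnion> q \<sqsubseteq> r" using diamond_above[OF D rA] by blast
      then show False using rw rA diamond_strict(5)[OF D] le_antisym by blast
    qed
    then show ?thesis using eq by auto
  qed
qed

lemma card_Cong_diamond: "diamond p q \<Longrightarrow> card Cong = 2 ^ (card A - 2)"
  using card_Cong_prime join_prime_diamond JI_diamond(2) by metis

lemma diamond_if_lat_iso_glued:
  assumes "lat_iso A join meet (gl_car k) (gl_join k) (gl_meet k) f"
  obtains p q where "diamond p q" "f p = (k, 0)" "f q = (k, 1)"
proof -
  have f: "bij_betw f A (gl_car k)"
    and hom: "\<And>x y. x \<in> A \<Longrightarrow> y \<in> A \<Longrightarrow> f (x \<squnion> y) = gl_join k (f x) (f y)"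
      "\<And>x y. x \<in> A \<Longrightarrow> y \<in> A \<Longrightarrow> f (x \<sqinter> y) = gl_meet k (f x) (f y)"
    using assms unfolding lat_iso_def by blast+
  have inj: "x = y" if "x \<in> A" "y \<in> A" "f x = f y" for x y
    using f that unfolding bij_betw_def inj_on_def by blast
  have img: "f ` A = gl_car k" using f by (simp add: bij_betw_def)
  moreover have "(k, 0) \<in> gl_car k" "(k, 1) \<in> gl_car k" unfolding gl_car_def by auto
  ultimately obtain p q where pq: "p \<in> A" "q \<in> A" "f p = (k, 0)" "f q = (k, 1)"
    by (metis imageE)
  have "f (p \<squnion> q) \<in> gl_car k" using img pq by auto
  \<comment> \<open>For \<open>k = 0\<close> the join \<open>(1, 0)\<close> of the two tagged
    elements would lie outside the carrier. Positivity also makes the truncated \<open>k - 1\<close>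
    in \<open>gl_meet\<close> a level strictly below \<open>k\<close>.\<close>
  then have "k \<ge> 1" using hom(1)[OF pq(1,2)] pq(3,4) by (auto simp: gl_join_def gl_car_def)
  have le: "x \<sqsubseteq> y \<longleftrightarrow> gl_meet k (f x) (f y) = f x" if "x \<in> A" "y \<in> A" for x y
    using hom(2)[OF that] inj[of "x \<sqinter> y" x] that by (auto simp: le_iff_meet)
  have "p \<parallel> q" using pq \<open>k \<ge> 1\<close> by (simp add: le gl_meet_def)
  moreover have "{x, y} = {p, q}" if xy: "x \<in> A" "y \<in> A" "x \<parallel> y" for x y
  proof -
    have "fst (f x) = fst (f y)" "f x \<noteq> f y"
      using xy by (auto simp: le gl_meet_def split: if_splits)
    moreover have "f x \<in> gl_car k" "f y \<in> gl_car k" using img xy by auto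
    ultimately have "f x = f p \<and> f y = f q \<or> f x = f q \<and> f y = f p"
      using pq unfolding gl_car_def by auto
    then show ?thesis using inj xy pq by auto
  qed
  ultimately have "diamond p q" using pq unfolding diamond_def by blast
  then show ?thesis using that pq by blast
qed

lemma card_gl_car: "card (gl_car k) = 2 * k + 2"
proof -
  have "gl_car k = insert (k, 1) ((\<lambda>i. (i, 0)) ` {..2 * k})"
    unfolding gl_car_def by auto
  moreover have "card ((\<lambda>i. (i, 0::nat)) ` {..2 * k}) = 2 * k + 1"
    by (subst card_image) (auto simp: inj_on_def)
  moreover have "(k, 1) \<notin> (\<lambda>i. (i, 0::nat)) ` {..2 * k}" by auto
  ultimately show ?thesis by simp
qed

end

section \<open>Diamonds with an involution\<close>

context finite_i_lattice
begin

lemma diamond_if_glued: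
  assumes "iso_BI_glued A join meet v k sw"
  obtains p q where "diamond p q" "v p = (if sw then q else p)"
proof -
  obtain f where f: "lat_iso A join meet (gl_car k) (gl_join k) (gl_meet k) f"
    and inv: "\<And>x. x \<in> A \<Longrightarrow> f (v x) = gl_inv k sw (f x)"
    using assms unfolding iso_BI_glued_def bi_iso_def by blast
  obtain p q where D: "diamond p q" and pq: "f p = (k, 0)" "f q = (k, 1)"
    using diamond_if_lat_iso_glued[OF f] by metis
  note D' = diamond_in[OF D]
  have "f (v p) = f (if sw then q else p)" using inv[OF D'(1)] pq by (simp add: gl_inv_def)
  moreover have "inj_on f A" using f unfolding lat_iso_def bij_betw_def by blast
  ultimately have "v p = (if sw then q else p)" using D' by (auto dest: inj_onD)
  then show ?thesis using that D by blast
qed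

text \<open>The involution preserves incomparability, so it permutes the only incomparable
  pair.\<close>

lemma diamond_inv:
  assumes D: "diamond p q"
  shows "v p = p \<and> v q = q \<or> v p = q \<and> v q = p" "v (p \<squnion> q) = p \<sqinter> q" "v (p \<sqinter> q) = p \<squnion> q"
proof -
  note D' = diamond_in[OF D] diamond_incomp[OF D]
  have "v p \<parallel> v q" using D' by (simp add: inv_le_iff)
  then have "{v p, v q} = {p, q}" by (intro diamond_only[OF D]) (use D' in simp_all)
  then show 1: "v p = p \<and> v q = q \<or> v p = q \<and> v q = p" by (auto simp: doubleton_eq_iff)
  show "v (p \<squnion> q) = p \<sqinter> q" using 1 D' by (auto simp: inv_join meet_commute)
  then show "v (p \<sqinter> q) = p \<squnion> q" using inv_inv[of "p \<squnion> q"] D' by simp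
qed

lemma card_above: "x \<in> A \<Longrightarrow> card {y \<in> A. x \<sqsubset> y} = card (below (v x))"
proof -
  assume x: "x \<in> A"
  have "bij_betw v {y \<in> A. x \<sqsubset> y} (below (v x))"
  proof (rule bij_betw_byWitness[where f' = v])
    show "v ` {y \<in> A. x \<sqsubset> y} \<subseteq> below (v x)"
      using x by (auto simp: below_def inv_le_iff inv_eq_iff)
    show "v ` below (v x) \<subseteq> {y \<in> A. x \<sqsubset> y}"
    proof
      fix y assume "y \<in> v ` below (v x)"
      then obtain u where u: "u \<in> A" "u \<sqsubset> v x" "y = v u" unfolding below_def by auto
      then have "x \<sqsubseteq> v u" using inv_le_swap[OF u(1) x] by simp
      moreover have "x \<noteq> v u" using u by auto
      ultimately show "y \<in> {y \<in> A. x \<sqsubset> y}" using u by simp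
    qed
  qed (auto simp: below_def)
  then show ?thesis by (rule bij_betw_same_card)
qed

text \<open>Levels are found by counting strictly smaller elements, with a correction because
  \<open>p\<close> and \<open>q\<close> share a level. As \<open>v p\<close> is \<open>p\<close> or
  \<open>q\<close>, and both have the same elements below them, as many elements lie above
  \<open>p\<close> as below; this makes the chains equally long.\<close>

lemma diamond_glued:
  assumes D: "diamond p q"
  shows "even (card A)" "card A \<ge> 4" "iso_BI_glued A join meet v (card A div 2 - 1) (v p = q)"
proof -
  note pq = diamond_in[OF D] diamond_incomp[OF D] and D' = diamond_sym[OF D]
  note strict = diamond_strict[OF D] and vpq = diamond_inv[OF D]
  define k where "k = card (below p)"
  define w z where "w = p \<squnion> q" and "z = p \<sqinter> q"
  have wz: "w \<in> A" "z \<in> A" "p \<sqsubset> w" "q \<sqsubset> w" "z \<sqsubset> p" "z \<sqsubset> q" "v w = z" "v z = w"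
    using strict vpq pq by (simp_all add: w_def z_def)
  have neq: "p \<noteq> q" using pq by auto
  have above_w: "p \<sqsubset> x \<longleftrightarrow> w \<sqsubseteq> x" "q \<sqsubset> x \<longleftrightarrow> w \<sqsubseteq> x" if "x \<in> A" for x
  proof -
    show "p \<sqsubset> x \<longleftrightarrow> w \<sqsubseteq> x"
      using diamond_above[OF D that] that wz pq le_trans[of p w x] le_antisym[of p w] by (auto simp: w_def)
    show "q \<sqsubset> x \<longleftrightarrow> w \<sqsubseteq> x"
      using diamond_above[OF D' that] that wz pq le_trans[of q w x] le_antisym[of q w]
      by (auto simp: w_def join_commute[OF pq(1,2)])
  qed
  have below_z: "x \<sqsubset> p \<longleftrightarrow> x \<sqsubseteq> z" "x \<sqsubset> q \<longleftrightarrow> x \<sqsubseteq> z" if "x \<in> A" for x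
  proof -
    show "x \<sqsubset> p \<longleftrightarrow> x \<sqsubseteq> z"
      using diamond_below[OF D that] that wz pq le_trans[of x z p] le_antisym[of p z] by (auto simp: z_def)
    show "x \<sqsubset> q \<longleftrightarrow> x \<sqsubseteq> z"
      using diamond_below[OF D' that] that wz pq le_trans[of x z q] le_antisym[of q z]
      by (auto simp: z_def meet_commute[OF pq(1,2)])
  qed
  have trich: "x = p \<or> x = q \<or> x \<sqsubseteq> z \<or> w \<sqsubseteq> x" if "x \<in> A" for x
    using diamond_comparable[OF D that pq(1)] above_w[OF that] below_z[OF that] by blast
  have not_both: "\<not> (x \<sqsubseteq> z \<and> w \<sqsubseteq> x)" if "x \<in> A" for x
    using above_w(1)[OF that] below_z(1)[OF that] that pq le_antisym by blast
  have bq: "below q = below p" using below_z unfolding below_def by auto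
  have kq: "card (below q) = k" using bq k_def by simp
  have kv: "card (below (v p)) = k" "card (below (v q)) = k" using vpq(1) k_def kq by auto
  have split: "card (below x) + card (below (v x)) = card A - 1" if x: "x \<in> A" "x \<noteq> p" "x \<noteq> q" for x
  proof -
    have "A - {x} = below x \<union> {y \<in> A. x \<sqsubset> y}"
      using diamond_comparable[OF D x(1) _ x(2,3)] unfolding below_def by auto
    moreover have "below x \<inter> {y \<in> A. x \<sqsubset> y} = {}" using x le_antisym unfolding below_def by blast
    ultimately have "card (A - {x}) = card (below x) + card {y \<in> A. x \<sqsubset> y}"
      using finite_A finite_below by (simp add: card_Un_disjoint)
    then show ?thesis using x card_above by simp
  qed
  have n: "card A = 2 * k + 2"
  proof -
    have "A - {p, q} = below p \<union> {y \<in> A. p \<sqsubset> y}"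
      using diamond_comparable[OF D _ pq(1)] pq unfolding below_def by auto
    moreover have "below p \<inter> {y \<in> A. p \<sqsubset> y} = {}" using pq le_antisym unfolding below_def by blast
    ultimately have "card (A - {p, q}) = k + card {y \<in> A. p \<sqsubset> y}"
      using finite_A finite_below k_def by (simp add: card_Un_disjoint)
    then have "card A - 2 = 2 * k"
      using kv card_above[OF pq(1)] pq neq by (simp add: card_Diff_subset)
    moreover have "2 \<le> card A" using card_mono[OF finite_A, of "{p, q}"] pq neq by simp
    ultimately show ?thesis by simp
  qed
  have "z \<in> below p" using wz by (simp add: below_def)
  then have k1: "k \<ge> 1" unfolding k_def using finite_below by (metis One_nat_def Suc_leI card_gt_0_iff empty_iff)
  show "even (card A)" "card A \<ge> 4" using n k1 by simp_all
  \<comment> \<open>From \<open>w\<close> upwards both \<open>p\<close> and \<open>q\<close> are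
    counted although they occupy one level, hence the subtraction of 1.\<close>
  define g where "g x = card (below x) - (if w \<sqsubseteq> x then 1 else 0)" for x
  have g_pos: "card (below x) \<ge> 2" if "x \<in> A" "w \<sqsubseteq> x" for x
  proof -
    have "{p, q} \<subseteq> below x" using above_w[OF that(1)] that(2) pq by (auto simp: below_def)
    then show ?thesis using card_mono[OF finite_below, of "{p, q}" x] neq by simp
  qed
  have g_less: "g x < g y" if xy: "x \<in> A" "y \<in> A" "x \<sqsubset> y" for x y
  proof (cases "w \<sqsubseteq> y \<and> \<not> w \<sqsubseteq> x")
    case True
    have "{p, q} \<union> below x \<subseteq> below y"
      using below_mono[of x y] xy above_w[OF xy(2)] True pq by (auto simp: below_def)
    then have "card ({p, q} \<union> below x) \<le> card (below y)" by (intro card_mono finite_below)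
    moreover have "p \<notin> below x" "q \<notin> below x" using above_w[OF xy(1)] True by (auto simp: below_def)
    then have "card ({p, q} \<union> below x) = card (below x) + 2" using finite_below neq by simp
    ultimately show ?thesis using True by (simp add: g_def)
  next
    case False
    then have "w \<sqsubseteq> y \<longleftrightarrow> w \<sqsubseteq> x" using le_trans[of w x y] wz xy by blast
    then show ?thesis
      using card_below_less[OF xy] g_pos[OF xy(1)] by (auto simp: g_def)
  qed
  have not_wp: "\<not> w \<sqsubseteq> p" "\<not> w \<sqsubseteq> q" using above_w pq by auto
  have gp: "g p = k" "g q = k" using not_wp kq by (simp_all add: g_def k_def)
  have g_inv: "g x + g (v x) = 2 * k" if x: "x \<in> A" for x
  proof (cases "x = p \<or> x = q")
    case True
    then show ?thesis using gp vpq(1) by auto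
  next
    case False
    have "w \<sqsubseteq> v x \<longleftrightarrow> x \<sqsubseteq> z" using inv_le_swap[of w x] wz x by simp
    \<comment> \<open>Exactly one of \<open>x\<close> and \<open>v x\<close> lies above
      \<open>w\<close>, so the corrections sum to 1 and turn the total 2k + 1 into 2k.\<close>
    then have "(if w \<sqsubseteq> x then 1 else 0) + (if w \<sqsubseteq> v x then 1 else 0) = (1::nat)"
      using trich[OF x] not_both[OF x] False by auto
    moreover have "card (below x) + card (below (v x)) = 2 * k + 1" using split[OF x] False n by simp
    ultimately show ?thesis
      using g_pos[OF x] g_pos[of "v x"] x unfolding g_def by (auto split: if_splits)
  qed
  have gw: "g w = k + 1"
  proof -
    have "below w = {p, q} \<union> below p"
    proof
      show "below w \<subseteq> {p, q} \<union> below p"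
      proof
        fix y assume "y \<in> below w"
        then have y: "y \<in> A" "y \<sqsubset> w" unfolding below_def by auto
        then have "\<not> w \<sqsubseteq> y" using wz le_antisym by blast
        then show "y \<in> {p, q} \<union> below p" using trich[OF y(1)] y(1) below_z(1)[OF y(1)] by (auto simp: below_def)
      qed
      show "{p, q} \<union> below p \<subseteq> below w" using below_mono[of p w] wz pq by (auto simp: below_def)
    qed
    moreover have "p \<notin> below p" "q \<notin> below p" using pq by (auto simp: below_def)
    ultimately have "card (below w) = k + 2" using finite_below neq k_def by simp
    then show ?thesis using wz by (simp add: g_def)
  qed
  have gz: "g z = k - 1" using g_inv[OF wz(2)] wz gw by simp
  define f where "f x = (g x, if x = q then 1 else 0::nat)" for x
  have inj: "inj_on f A"
  proof (rule inj_onI)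
    fix x y assume xy: "x \<in> A" "y \<in> A" "f x = f y"
    then have "g x = g y" "x = q \<longleftrightarrow> y = q" by (auto simp: f_def split: if_splits)
    then have "\<not> x \<sqsubset> y" "\<not> y \<sqsubset> x" using g_less xy by (metis less_irrefl)+
    then show "x = y" using diamond_only[OF D xy(1,2)] \<open>x = q \<longleftrightarrow> y = q\<close>
      by (auto simp: doubleton_eq_iff)
  qed
  have "f ` A \<subseteq> gl_car k"
  proof
    fix e assume "e \<in> f ` A"
    then obtain x where x: "x \<in> A" "e = f x" by blast
    have "g x \<le> 2 * k" using g_inv[OF x(1)] by simp
    moreover have "g x \<noteq> k" if "x \<noteq> p" "x \<noteq> q"
      using trich[OF x(1)] above_w(1)[OF x(1)] below_z(1)[OF x(1)] that g_less[OF x(1) pq(1)]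
        g_less[OF pq(1) x(1)] gp by auto
    ultimately show "e \<in> gl_car k" using x gp by (auto simp: f_def gl_car_def)
  qed
  moreover have "finite (gl_car k)" using card_gl_car[of k] by (intro card_ge_0_finite) simp
  ultimately have "f ` A = gl_car k"
    using inj n by (intro card_subset_eq) (simp_all add: card_image card_gl_car)
  with inj have bij: "bij_betw f A (gl_car k)" by (simp add: bij_betw_def)
  have hom_le: "f (x \<squnion> y) = gl_join k (f x) (f y) \<and> f (x \<sqinter> y) = gl_meet k (f x) (f y)
      \<and> f (y \<squnion> x) = gl_join k (f y) (f x) \<and> f (y \<sqinter> x) = gl_meet k (f y) (f x)"
    if xy: "x \<in> A" "y \<in> A" "x \<sqsubseteq> y" for x y
  proof (cases "x = y")
    case True then show ?thesis
      using xy by (simp add: join_absorb1 meet_absorb1 gl_join_def gl_meet_def)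
  next
    case False
    then have "g x < g y" using g_less xy by blast
    then show ?thesis using xy
      by (simp add: join_absorb1 join_absorb2 meet_absorb1 meet_absorb2 gl_join_def gl_meet_def f_def)
  qed
  have hom_pq: "f (p \<squnion> q) = gl_join k (f p) (f q) \<and> f (p \<sqinter> q) = gl_meet k (f p) (f q)
      \<and> f (q \<squnion> p) = gl_join k (f q) (f p) \<and> f (q \<sqinter> p) = gl_meet k (f q) (f p)"
  proof -
    have "f w = (k + 1, 0)" "f z = (k - 1, 0)" using gw gz wz by (auto simp: f_def)
    then show ?thesis using gp neq join_commute[OF pq(1,2)] meet_commute[OF pq(1,2)]
      by (simp add: w_def z_def f_def gl_join_def gl_meet_def)
  qed
  have hom: "f (x \<squnion> y) = gl_join k (f x) (f y) \<and> f (x \<sqinter> y) = gl_meet k (f x) (f y)"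
    if xy: "x \<in> A" "y \<in> A" for x y
  proof (cases "x \<parallel> y")
    case True
    then have "{x, y} = {p, q}" using diamond_only[OF D xy] by blast
    then have "x = p \<and> y = q \<or> x = q \<and> y = p" by (simp add: doubleton_eq_iff)
    then show ?thesis using hom_pq by blast
  next
    case False
    then show ?thesis using hom_le[OF xy] hom_le[OF xy(2,1)] by blast
  qed
  have "f (v x) = gl_inv k (v p = q) (f x)" if x: "x \<in> A" for x
  proof -
    have g: "g (v x) = 2 * k - g x" using g_inv[OF x] by simp
    show ?thesis
    proof (cases "x = p \<or> x = q")
      case True
      then show ?thesis using gp vpq(1) neq by (auto simp: f_def gl_inv_def)
    next
      case False
      then have "g x \<noteq> k" using trich[OF x] above_w(1)[OF x] below_z(1)[OF x] g_less[OF x pq(1)]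
          g_less[OF pq(1) x] gp by auto
      moreover have "v x \<noteq> q" using False vpq(1) inv_inv[OF x] by metis
      ultimately show ?thesis using False g by (simp add: f_def gl_inv_def)
    qed
  qed
  then have "iso_BI_glued A join meet v k (v p = q)"
    unfolding iso_BI_glued_def bi_iso_def lat_iso_def using bij hom by blast
  then show "iso_BI_glued A join meet v (card A div 2 - 1) (v p = q)" using n by simp
qed

text \<open>The cuts \<open>h \<sqsubseteq> x\<close> and \<open>h \<sqsubseteq> v x\<close> given by join-primes \<open>h\<close> yield involution-invariant
  congruences; they are independent if no two of these cuts separate the same edge.\<close>

lemma card_BI_ge:
  assumes H: "H \<subseteq> JI" "\<And>h. h \<in> H \<Longrightarrow> join_prime h"
    and indep: "\<And>h h' l. h \<in> H \<Longrightarrow> h' \<in> H \<Longrightarrow> jcov l h \<Longrightarrow> l \<sqsubseteq> v h' \<Longrightarrow> \<not> h \<sqsubseteq> v h' \<Longrightarrow> h = h'"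
  shows "2 ^ card H \<le> card BI"
proof -
  define \<theta> where
    "\<theta> S = {(x, y) \<in> A \<times> A. \<forall>h\<in>S. (h \<sqsubseteq> x \<longleftrightarrow> h \<sqsubseteq> y) \<and> (h \<sqsubseteq> v x \<longleftrightarrow> h \<sqsubseteq> v y)}" for S
  have HA: "h \<in> A" if "h \<in> H" for h using that H JI_subset by auto
  have "\<theta> S \<in> BI" if S: "S \<subseteq> H" for S
  proof -
    have prime: "h \<in> A" "join_prime h" if "h \<in> S" for h using that S H HA by auto
    have "\<theta> S \<in> Cong" unfolding \<theta>_def
      by (rule CongI) (auto simp: join_prime_iff prime le_meet_iff inv_join inv_meet)
    moreover have "(v a, v b) \<in> \<theta> S" if "(a, b) \<in> \<theta> S" for a b
      using that unfolding \<theta>_def by auto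
    ultimately show ?thesis by (simp add: BI_iff)
  qed
  then have "\<theta> ` Pow H \<subseteq> BI" by blast
  moreover have "inj_on \<theta> (Pow H)"
  proof (rule inj_onI)
    fix S S' assume S: "S \<in> Pow H" "S' \<in> Pow H" "\<theta> S = \<theta> S'"
    \<comment> \<open>The edges separated by the congruence recover \<open>S\<close>; independence
      ensures that no other cut separates the edge of \<open>h\<close>.\<close>
    have mem: "h \<in> S \<longleftrightarrow> (l, h) \<notin> \<theta> S" if S: "S \<subseteq> H" and h: "h \<in> H" and l: "jcov l h" for S h l
    proof
      note lh = jcov_in[OF l] jcov_lt[OF l]
      assume "h \<in> S"
      moreover have "\<not> h \<sqsubseteq> l" using lh le_antisym by blast
      ultimately show "(l, h) \<notin> \<theta> S" using le_refl[OF lh(2)] unfolding \<theta>_def by blast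
    next
      note lh = jcov_in[OF l] jcov_lt[OF l]
      assume not: "(l, h) \<notin> \<theta> S"
      show "h \<in> S"
      proof (rule ccontr)
        assume "h \<notin> S"
        have "(h' \<sqsubseteq> l \<longleftrightarrow> h' \<sqsubseteq> h) \<and> (h' \<sqsubseteq> v l \<longleftrightarrow> h' \<sqsubseteq> v h)" if h': "h' \<in> S" for h'
        proof -
          have ne: "h' \<noteq> h" and h'H: "h' \<in> H" "h' \<in> A" using h' \<open>h \<notin> S\<close> S HA by auto
          have "h' \<sqsubseteq> l \<longleftrightarrow> h' \<sqsubseteq> h"
            using jcov_below[OF l h'H(2)] ne lh le_trans[of h' l h] h'H by blast
          moreover have "l \<sqsubseteq> v h' \<longleftrightarrow> h \<sqsubseteq> v h'"
            using indep[OF h h'H(1) l] ne lh h'H le_trans[of l h "v h'"] by auto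
          ultimately show ?thesis
            using lh h'H inv_le_swap[of h' l] inv_le_swap[of h' h] by blast
        qed
        then show False using not lh by (auto simp: \<theta>_def)
      qed
    qed
    have "h \<in> S \<longleftrightarrow> h \<in> S'" if h: "h \<in> H" for h
    proof -
      obtain l where l: "jcov l h" using h H(1) unfolding JI_def by auto
      show ?thesis using mem[OF _ h l] S by simp
    qed
    then show "S = S'" using S by blast
  qed
  ultimately have "card (Pow H) \<le> card BI" using finite_BI by (metis card_inj_on_le)
  then show ?thesis using finite_subset[OF H(1) finite_JI] by (simp add: card_Pow)
qed

section \<open>Invariant congruences of chains and diamonds\<close>

lemma card_pos_neg:
  "card {x \<in> A. v x \<sqsubset> x} = card {x \<in> A. x \<sqsubset> v x}"
proof (rule bij_betw_same_card)
  show "bij_betw v {x \<in> A. v x \<sqsubset> x} {x \<in> A. x \<sqsubset> v x}"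
    by (rule bij_betw_byWitness[where f' = v]) auto
qed

text \<open>The upper half, where \<open>v x\<close> is strictly below \<open>x\<close>, indexes the
  cuts: a chain has at most one fixed point, so this half has \<open>card A div 2\<close>
  elements.\<close>

lemma card_BI_chain:
  assumes chain
  shows "card BI = 2 ^ (card A div 2)"
proof -
  note total = assms[unfolded chain_def, rule_format]
  let ?P = "{x \<in> A. v x \<sqsubset> x}" and ?N = "{x \<in> A. x \<sqsubset> v x}" and ?F = "{x \<in> A. v x = x}"
  have "x \<in> ?P \<union> ?N \<union> ?F" if "x \<in> A" for x using total[of x "v x"] that by auto
  then have A: "A = ?P \<union> ?N \<union> ?F" by auto
  have "x = y" if "x \<in> ?F" "y \<in> ?F" for x y
  proof -
    have xy: "x \<in> A" "y \<in> A" "v x = x" "v y = y" using that by auto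
    then have "x \<sqsubseteq> y \<longleftrightarrow> y \<sqsubseteq> x" using inv_le_iff[of x y] by simp
    then show ?thesis using total[OF xy(1,2)] le_antisym[OF xy(1,2)] by blast
  qed
  moreover have "finite ?F" using finite_A by simp
  ultimately have "card ?F \<le> 1" unfolding One_nat_def by (subst card_le_Suc0_iff_eq) (assumption, blast)
  moreover have "card A = card ?P + card ?N + card ?F"
  proof -
    have "?P \<inter> ?N = {}" using le_antisym by auto
    moreover have "(?P \<union> ?N) \<inter> ?F = {}" by auto
    ultimately have "card (?P \<union> ?N \<union> ?F) = card ?P + card ?N + card ?F"
      using finite_A by (simp add: card_Un_disjoint)
    then show ?thesis using A by simp
  qed
  ultimately have "card ?P = card A div 2" using card_pos_neg by linarith
  moreover have "2 ^ card ?P \<le> card BI"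
  proof (rule card_BI_ge)
    have "x \<noteq> \<bottom>" if "x \<in> ?P" for x using that bot_le[of "v x"] le_antisym[of x "v x"] by auto
    then show "?P \<subseteq> JI" using JI_chain[OF assms] by auto
    show "join_prime h" if "h \<in> ?P" for h using join_prime_chain[OF assms] that by simp
    fix h h' l assume h: "h \<in> ?P" and h': "h' \<in> ?P" and l: "jcov l h" "l \<sqsubseteq> v h'" "\<not> h \<sqsubseteq> v h'"
    note lh = jcov_in[OF l(1)] jcov_lt[OF l(1)]
    have hA: "h' \<in> A" "v h' \<in> A" using h' by auto
    have "v h' \<sqsubset> h" using total[of h "v h'"] l(3) lh hA le_refl by auto
    \<comment> \<open>A cut of \<open>v h'\<close> separating \<open>l\<close> from \<open>h\<close>
      must sit exactly at \<open>l\<close>. Then \<open>h'\<close> is below \<open>h\<close> but not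
      below \<open>l\<close>, which leaves only \<open>h\<close>.\<close>
    then have eq: "v h' = l" using jcov_below[OF l(1) hA(2)] l(2) lh hA le_antisym by blast
    have "v h \<sqsubseteq> l" using jcov_below[OF l(1), of "v h"] h lh by simp
    then have "h' \<sqsubseteq> h" using eq lh hA inv_le_iff[of h h'] by simp
    moreover have "\<not> h' \<sqsubseteq> l" using h' eq hA le_antisym[of h' l] lh by auto
    ultimately show "h = h'" using jcov_below[OF l(1) hA(1)] by blast
  qed
  ultimately show ?thesis using card_BI_le by simp
qed

text \<open>Here the upper half has \<open>(card A - 2) div 2\<close> elements and misses
  \<open>p\<close> and \<open>q\<close>. Its least element \<open>w\<close> is not join-irreducible;
  replacing it by both \<open>p\<close> and \<open>q\<close> yields the required
  \<open>card A div 2\<close> cuts.\<close>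

lemma card_BI_diamond:
  assumes D: "diamond p q" and vp: "v p = q"
  shows "card BI = 2 ^ (card A div 2)"
proof -
  note pq = diamond_in[OF D] diamond_incomp[OF D] and D' = diamond_sym[OF D]
  have vq: "v q = p" using vp pq inv_inv by metis
  define w z where "w = p \<squnion> q" and "z = p \<sqinter> q"
  have wz: "w \<in> A" "z \<in> A" "p \<sqsubset> w" "q \<sqsubset> w" "z \<sqsubset> p" "z \<sqsubset> q" "v w = z" "v z = w"
    using diamond_strict[OF D] diamond_inv[OF D] pq by (simp_all add: w_def z_def)
  let ?P = "{x \<in> A. v x \<sqsubset> x}" and ?N = "{x \<in> A. x \<sqsubset> v x}"
  have fixfree: "v x \<noteq> x" if x: "x \<in> A" for x
  proof
    assume fx: "v x = x"
    then have ne: "x \<noteq> p" "x \<noteq> q" using vp vq pq by auto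
    then have "x \<sqsubseteq> p \<or> p \<sqsubseteq> x" using diamond_comparable[OF D x pq(1)] by blast
    then show False
      using inv_antimono[of x p] inv_antimono[of p x] fx vp x pq le_trans[of q x p] le_trans[of p x q] by auto
  qed
  have PN: "A - {p, q} = ?P \<union> ?N"
  proof -
    have "x \<sqsubset> v x \<or> v x \<sqsubset> x" if "x \<in> A" "x \<noteq> p" "x \<noteq> q" for x
      using diamond_comparable[OF D that(1) inv_in that(2,3)] that(1) fixfree[OF that(1)] by metis
    then show ?thesis using vp vq pq by auto
  qed
  have neq: "p \<noteq> q" using pq by auto
  have "?P \<inter> ?N = {}" using le_antisym by auto
  then have "card (A - {p, q}) = card ?P + card ?N"
    using finite_A by (simp add: PN card_Un_disjoint)
  then have cardP: "card A - 2 = 2 * card ?P"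
    using card_pos_neg pq neq by (simp add: card_Diff_subset)
  have "w \<in> ?P" using wz le_trans[of z p w] pq le_antisym[of w p] by auto
  define H where "H = insert p (insert q (?P - {w}))"
  have "p \<notin> ?P" "q \<notin> ?P" using vp vq pq by auto
  then have "card H = card ?P + 1"
    using \<open>w \<in> ?P\<close> neq finite_A card_gt_0_iff[of ?P] unfolding H_def by (auto simp: card_Diff_singleton_if)
  moreover have "card A \<ge> 4" using diamond_glued[OF D] by simp
  ultimately have cardH: "card H = card A div 2" using cardP by linarith
  have above_h: "w \<sqsubset> h" if "h \<in> ?P - {w}" for h
  proof -
    have h: "h \<in> A" "v h \<sqsubset> h" "h \<noteq> w" "h \<noteq> p" "h \<noteq> q" using that vp vq pq by auto
    have "\<not> h \<sqsubseteq> p"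
      using inv_antimono[of h p] h vp pq le_trans[of q "v h" h] le_trans[of q h p] by auto
    then have "p \<sqsubset> h" using diamond_comparable[OF D h(1) pq(1) h(4,5)] h by auto
    then show ?thesis using diamond_above[OF D h(1)] h(3) by (simp add: w_def)
  qed
  \<comment> \<open>Stated for either orientation of the pair, to serve both \<open>h = p\<close>
    and \<open>h = q\<close>.\<close>
  have atom_case: "a = h'" if a: "diamond a b" "v a = b" "a \<squnion> b = w" "a \<sqinter> b = z"
    and h': "h' = a \<or> h' = b \<or> h' \<in> ?P - {w}" and l: "jcov l a" "l \<sqsubseteq> v h'" "\<not> a \<sqsubseteq> v h'" for a b h' l
  proof -
    note ab = diamond_in[OF a(1)] diamond_incomp[OF a(1)]
    have vb: "v b = a" using a(2) ab inv_inv by metis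
    show ?thesis
    proof (rule ccontr)
      assume "a \<noteq> h'"
      moreover have "h' \<noteq> b" using l(3) vb ab by auto
      ultimately have "w \<sqsubset> h'" "h' \<in> A" using h' above_h by auto
      then have "v h' \<sqsubset> z" using wz inv_antimono[of w h'] inv_eq_iff[of w h'] by auto
      moreover have "z \<sqsubset> a" using diamond_strict[OF a(1)] a(4) by simp
      then have "z \<sqsubseteq> l" using jcov_below[OF l(1) wz(2)] by simp
      then have "z \<sqsubseteq> v h'" using l(2) le_trans wz(2) jcov_in(1)[OF l(1)] inv_in[OF \<open>h' \<in> A\<close>] by blast
      ultimately show False using le_antisym[OF wz(2) inv_in[OF \<open>h' \<in> A\<close>]] by auto
    qed
  qed
  have "2 ^ card H \<le> card BI"
  proof (rule card_BI_ge)
    show "H \<subseteq> JI"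
    proof
      fix h assume h: "h \<in> H"
      have "p \<noteq> \<bottom>" "q \<noteq> \<bottom>" using bot_le pq by metis+
      moreover have "h \<noteq> \<bottom>" if "h \<in> ?P" using that bot_le[of "v h"] le_antisym[of h "v h"] by auto
      ultimately have "h \<in> A - {\<bottom>, w}" using h wz pq unfolding H_def by auto
      then show "h \<in> JI" using JI_diamond[OF D] by (simp add: w_def)
    qed
    then show "join_prime h" if "h \<in> H" for h using join_prime_diamond[OF D] that by auto
    fix h h' l assume h: "h \<in> H" and h': "h' \<in> H" and l: "jcov l h" "l \<sqsubseteq> v h'" "\<not> h \<sqsubseteq> v h'"
    note lh = jcov_in[OF l(1)] jcov_lt[OF l(1)]
    have h'A: "h' \<in> A" using h' pq unfolding H_def by auto
    consider "h = p" | "h = q" | "h \<in> ?P - {w}" using h unfolding H_def by blast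
    then show "h = h'"
    proof cases
      case 1
      then show ?thesis using atom_case[OF D vp _ _ _ _ l(2)] h' l unfolding H_def w_def z_def by auto
    next
      case 2
      then show ?thesis using atom_case[OF D' vq _ _ _ _ l(2)] h' l pq
        unfolding H_def w_def z_def by (auto simp: join_commute meet_commute)
    next
      case 3
      \<comment> \<open>The lower cover of an \<open>h\<close> above \<open>w\<close> is still above
        \<open>w\<close>, so a conflicting \<open>h'\<close> would have to lie below
        \<open>z\<close>, where \<open>H\<close> has no elements.\<close>
      then have "w \<sqsubseteq> l" using above_h jcov_below[OF l(1) wz(1)] by blast
      then have "w \<sqsubseteq> v h'" using l(2) wz lh h'A le_trans[of w l "v h'"] by simp
      then have hz: "h' \<sqsubseteq> z" using inv_le_swap[of h' w] inv_le_swap[of w h'] wz h'A by simp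
      then have "h' \<sqsubset> p" "h' \<sqsubset> q"
        using wz h'A pq le_trans[of h' z p] le_trans[of h' z q] le_antisym[of z] by metis+
      then have "w \<sqsubset> h'" using h' above_h pq unfolding H_def by auto
      then show ?thesis using \<open>h' \<sqsubset> p\<close> wz h'A pq le_trans[of w h' p] le_antisym[of p w] by blast
    qed
  qed
  then show ?thesis using cardH card_BI_le by simp
qed

lemma extremal_iff:
  "card BI = 2 ^ (card A div 2) \<longleftrightarrow> chain \<or> (\<exists>p q. diamond p q \<and> v p = q)"
  using extremal_classification card_BI_chain card_BI_diamond unfolding chain_def by blast

end

section \<open>A unique join-reducible element\<close>

text \<open>If \<open>w\<close> is the only join-reducible element besides \<open>\<bottom>\<close>, then all incomparable pairs have
  join \<open>w\<close> and, by the involution, meet \<open>z = v w\<close>. The elements covering \<open>z\<close> then generate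
  everything that is collapsed between \<open>z\<close> and \<open>w\<close>.\<close>

locale one_join_reducible = finite_i_lattice A join meet v
  for A :: "'a set" and join :: "'a \<Rightarrow> 'a \<Rightarrow> 'a" (infixl "\<squnion>" 65)
    and meet :: "'a \<Rightarrow> 'a \<Rightarrow> 'a" (infixl "\<sqinter>" 70) and v :: "'a \<Rightarrow> 'a" +
  fixes w z :: 'a
  assumes w_in: "w \<in> A" and z_def: "z = v w" and JI_eq: "JI = A - {\<bottom>, w}"
    and join_incomp: "x \<in> A \<Longrightarrow> y \<in> A \<Longrightarrow> x \<parallel> y \<Longrightarrow> x \<squnion> y = w"
begin

lemma z_in: "z \<in> A" and vz: "v z = w"
  using w_in by (simp_all add: z_def)

lemma meet_incomp: "x \<in> A \<Longrightarrow> y \<in> A \<Longrightarrow> x \<parallel> y \<Longrightarrow> x \<sqinter> y = z"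
  using join_incomp[of "v x" "v y"] inv_meet[of x y] inv_inv[of "x \<sqinter> y"] unfolding z_def
  by (simp add: inv_le_iff)

definition mid :: "'a set" where "mid = {u \<in> A. z \<sqsubset> u \<and> u \<sqsubset> w}"

text \<open>Using \<open>jcov\<close> rather than a plain covering relation makes
  \<open>p \<in> coll \<theta>\<close> mean \<open>(z, p) \<in> \<theta>\<close>.\<close>

definition cov :: "'a set" where "cov = {p. jcov z p \<and> p \<in> mid}"

lemma midD: "u \<in> mid \<Longrightarrow> u \<in> A" "u \<in> mid \<Longrightarrow> z \<sqsubset> u" "u \<in> mid \<Longrightarrow> u \<sqsubset> w"
  by (simp_all add: mid_def)

lemma covD: "p \<in> cov \<Longrightarrow> jcov z p" "p \<in> cov \<Longrightarrow> p \<in> mid" "p \<in> cov \<Longrightarrow> p \<in> A"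
  using midD by (simp_all add: cov_def)

lemma incomp_mid: "x \<in> A \<Longrightarrow> y \<in> A \<Longrightarrow> x \<parallel> y \<Longrightarrow> x \<in> mid"
  using join_incomp[of x y] meet_incomp[of x y] join_ge1[of x y] meet_le1[of x y]
    join_ge2[of x y] meet_le2[of x y]
  unfolding mid_def by auto

lemma not_w_le_mid: "u \<in> mid \<Longrightarrow> \<not> w \<sqsubseteq> u" and not_mid_le_z: "u \<in> mid \<Longrightarrow> \<not> u \<sqsubseteq> z"
  using midD[of u] le_antisym w_in z_in by blast+

lemma mid_JI: "u \<in> mid \<Longrightarrow> u \<in> JI"
  using midD[of u] bot_le[OF z_in] le_antisym[OF bot_in z_in] unfolding JI_eq by auto

lemma mid_cases:
  assumes s: "s \<in> mid" "s \<notin> cov"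
  obtains l where "jcov l s" "l \<in> mid"
proof -
  obtain l where l: "jcov l s" using mid_JI[OF s(1)] unfolding JI_def by blast
  note ls = jcov_in[OF l] jcov_lt[OF l] midD[OF s(1)]
  have "z \<sqsubseteq> l" using jcov_below[OF l z_in] ls by simp
  moreover have "z \<noteq> l" using l s unfolding cov_def by auto
  moreover have "l \<sqsubseteq> w" "l \<noteq> w" using ls w_in le_trans[of l s w] not_w_le_mid[OF s(1)] by auto
  ultimately show ?thesis using that l ls by (simp add: mid_def)
qed

lemma cov_below:
  assumes u: "u \<in> mid"
  obtains p where "p \<in> cov" "p \<sqsubseteq> u"
proof -
  obtain p where p: "p \<in> A" "z \<sqsubset> p \<and> p \<sqsubseteq> u" "\<forall>y\<in>A. y \<sqsubset> p \<longrightarrow> \<not> (z \<sqsubset> y \<and> y \<sqsubseteq> u)"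
    by (rule ex_minimal[OF midD(1)[OF u], where Q = "\<lambda>y. z \<sqsubset> y \<and> y \<sqsubseteq> u"])
      (use midD[OF u] in auto)
  have "p \<noteq> w" using p not_w_le_mid[OF u] by auto
  then have pm: "p \<in> mid" using p midD[OF u] le_trans[of p u w] w_in unfolding mid_def by auto
  have "p \<in> cov"
  proof (rule ccontr)
    assume "p \<notin> cov"
    then obtain l where l: "jcov l p" "l \<in> mid" using mid_cases[OF pm] by metis
    note lp = jcov_in[OF l(1)] jcov_lt[OF l(1)]
    have "l \<sqsubseteq> u" using lp p midD(1)[OF u] le_trans[of l p u] by simp
    then show False using p(3) lp midD(2)[OF l(2)] by blast
  qed
  then show ?thesis using that p by blast
qed

lemma cov_incomp:
  assumes "p \<in> cov" "q \<in> cov" "p \<noteq> q"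
  shows "p \<parallel> q" "p \<squnion> q = w" "p \<sqinter> q = z"
proof -
  have not_le: "\<not> a \<sqsubseteq> b" if ab: "a \<in> cov" "b \<in> cov" "a \<noteq> b" for a b
  proof
    assume "a \<sqsubseteq> b"
    then have "a \<sqsubseteq> z" using jcov_below[OF covD(1)[OF ab(2)] covD(3)[OF ab(1)]] ab(3) by simp
    then show False using not_mid_le_z[OF covD(2)[OF ab(1)]] by simp
  qed
  show inc: "p \<parallel> q" using not_le[OF assms] not_le[OF assms(2,1)] assms(3) by simp
  show "p \<squnion> q = w" "p \<sqinter> q = z"
    using join_incomp[OF _ _ inc] meet_incomp[OF _ _ inc] covD(3) assms(1,2) by simp_all
qed

lemma cov_to_top:
  assumes \<theta>: "\<theta> \<in> Cong" and p: "p \<in> cov" "p \<in> coll \<theta>" and x: "x \<in> A" "x \<parallel> p"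
  shows "(x, w) \<in> \<theta>"
proof -
  note pA = covD[OF p(1)]
  have "(z, p) \<in> \<theta>" using p coll_iff[OF pA(1)] by simp
  then have "(z \<squnion> x, p \<squnion> x) \<in> \<theta>" using cong_join[OF \<theta> _ x(1)] by blast
  moreover have "z \<sqsubseteq> x" using meet_incomp[OF x(1) pA(3) x(2)] meet_le1[OF x(1) pA(3)] by simp
  moreover have "p \<squnion> x = w" using join_incomp[OF pA(3) x(1)] x(2) by blast
  ultimately show ?thesis using x z_in by (simp add: join_absorb1)
qed

text \<open>It suffices to find \<open>x\<close> incomparable to \<open>p\<close> and not above
  \<open>s\<close>: then \<open>x\<close> is related to \<open>w\<close> by
  \<open>cov_to_top\<close>, and \<open>cong_jcov\<close> brings this pair down to the edge of
  \<open>s\<close>. If \<open>p\<close> is below \<open>s\<close>, the other cover \<open>q\<close>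
  serves as \<open>x\<close>; otherwise the lower cover of \<open>s\<close> does.\<close>

lemma cov_forces:
  assumes \<theta>: "\<theta> \<in> Cong" and p: "p \<in> cov" "p \<in> coll \<theta>" and q: "q \<in> cov" "p \<noteq> q"
    and s: "s \<in> mid" "s \<notin> cov"
  shows "s \<in> coll \<theta>"
proof -
  obtain l where l: "jcov l s" "l \<in> mid" using mid_cases[OF s] by metis
  note ls = jcov_in[OF l(1)] jcov_lt[OF l(1)] and pA = covD[OF p(1)] and qA = covD[OF q(1)]
  note pq = cov_incomp[OF p(1) q]
  have "\<exists>x\<in>A. x \<parallel> p \<and> \<not> s \<sqsubseteq> x"
  proof (cases "p \<sqsubseteq> s")
    case True
    then have "\<not> q \<sqsubseteq> s" using join_least[OF pA(3) qA(3) ls(2)] pq not_w_le_mid[OF s(1)] by auto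
    moreover have "\<not> s \<sqsubseteq> q" using True pq le_trans[OF pA(3) ls(2) qA(3)] by blast
    ultimately show ?thesis using pq qA by blast
  next
    case False
    have "\<not> l \<sqsubseteq> p"
    proof
      assume "l \<sqsubseteq> p"
      then have "l = p" using jcov_below[OF pA(1) ls(1)] not_mid_le_z[OF l(2)] by blast
      then show False using False ls by blast
    qed
    moreover have "\<not> p \<sqsubseteq> l" using False ls le_trans[OF pA(3) ls(1) ls(2)] by blast
    moreover have "\<not> s \<sqsubseteq> l" using ls le_antisym by blast
    ultimately show ?thesis using ls by blast
  qed
  then obtain x where x: "x \<in> A" "x \<parallel> p" "\<not> s \<sqsubseteq> x" by blast
  have "(x, w) \<in> \<theta>" using cov_to_top[OF \<theta> p x(1,2)] .
  then have "(l, s) \<in> \<theta>" using cong_jcov[OF \<theta> l(1) _ x(3)] midD(3)[OF s(1)] by blast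
  then show ?thesis using coll_iff[OF l(1)] by simp
qed

text \<open>The third cover mediates: \<open>(z, p)\<close> is projected up to \<open>(r, w)\<close>
  and from there down to \<open>(z, q)\<close>.\<close>

lemma three_cov_equivalent:
  assumes \<theta>: "\<theta> \<in> Cong" and p: "p \<in> cov" "p \<in> coll \<theta>" and q: "q \<in> cov" and r: "r \<in> cov"
    and "p \<noteq> r" "q \<noteq> r"
  shows "q \<in> coll \<theta>"
proof -
  note pA = covD[OF p(1)] and qA = covD[OF q] and rA = covD[OF r]
  have "(r, w) \<in> \<theta>" using cov_to_top[OF \<theta> p rA(3)] cov_incomp[OF p(1) r] assms by blast
  then have "(z, q) \<in> \<theta>"
    using cong_jcov[OF \<theta> qA(1)] cov_incomp[OF q r] midD(3)[OF qA(2)] assms by blast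
  then show ?thesis using coll_iff[OF qA(1)] by simp
qed

lemma family: "coll ` Cong \<subseteq> Pow JI"
  using coll_subset by blast

lemma cov_JI: "p \<in> cov \<Longrightarrow> p \<in> JI"
  using covD mid_JI by blast

lemma card_Cong_three_cov:
  assumes "p \<in> cov" "q \<in> cov" "r \<in> cov" "p \<noteq> q" "p \<noteq> r" "q \<noteq> r"
  shows "card Cong \<le> 2 ^ (card JI - 1)"
  unfolding card_Cong_eq
proof (rule card_family_equivalent[OF finite_JI family])
  show "p \<in> S \<longleftrightarrow> q \<in> S" if "S \<in> coll ` Cong" for S
    using that three_cov_equivalent[of _ p q r] three_cov_equivalent[of _ q p r] assms by blast
qed (use assms cov_JI in blast)+

lemma card_Cong_two_above:
  assumes "p \<in> cov" "q \<in> cov" "p \<noteq> q" "s \<in> mid - cov" "t \<in> mid - cov" "s \<noteq> t"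
  shows "card Cong \<le> 2 ^ (card JI - 1)"
  unfolding card_Cong_eq
proof (rule card_family_two_force_two[OF finite_JI family])
  show "{p, q, s, t} \<subseteq> JI" using assms cov_JI mid_JI by blast
  have "p \<noteq> s" "p \<noteq> t" "q \<noteq> s" "q \<noteq> t" using assms by blast+
  then show "card {p, q, s, t} = 4" using assms(3,6) by simp
  show "s \<in> S \<and> t \<in> S" if "S \<in> coll ` Cong" "p \<in> S \<or> q \<in> S" for S
    using that cov_forces[of _ p q s] cov_forces[of _ p q t] cov_forces[of _ q p s]
      cov_forces[of _ q p t] assms by blast
qed

lemma card_Cong_one_above:
  assumes "p \<in> cov" "q \<in> cov" "p \<noteq> q" "s \<in> mid - cov"
  shows "card Cong < 2 ^ card JI"
proof -
  have s: "s \<in> mid" "s \<notin> cov" using assms(4) by simp_all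
  have "{p} \<noteq> coll \<theta>" if "\<theta> \<in> Cong" for \<theta>
  proof
    assume eq: "{p} = coll \<theta>"
    then have "s \<in> coll \<theta>" using cov_forces[OF that assms(1) _ assms(2,3) s] by blast
    then show False using eq s(2) assms(1) by auto
  qed
  then have "{p} \<notin> coll ` Cong" by blast
  moreover have "{p} \<in> Pow JI" using cov_JI[OF assms(1)] by simp
  ultimately have "coll ` Cong \<subset> Pow JI" using family by (metis psubsetI)
  then have "card (coll ` Cong) < card (Pow JI)" using finite_JI by (intro psubset_card_mono) auto
  then show ?thesis by (simp add: card_Cong_eq card_Pow finite_JI)
qed

lemma diamond_if_two_mid:
  assumes "p \<in> cov" "q \<in> cov" "p \<noteq> q" "mid \<subseteq> {p, q}"
  shows "diamond p q"
  unfolding diamond_def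
proof (intro conjI ballI impI)
  fix x y assume xy: "x \<in> A" "y \<in> A" "x \<parallel> y"
  then have "x \<in> {p, q}" "y \<in> {p, q}" using incomp_mid[of x y] incomp_mid[of y x] assms(4) by blast+
  moreover have "x \<noteq> y" using xy by auto
  ultimately show "{x, y} = {p, q}" by auto
qed (use assms(1,2) cov_incomp(1)[OF assms(1-3)] covD(3) in simp_all)

lemma inv_mid:
  assumes u: "u \<in> mid"
  shows "v u \<in> mid"
proof -
  note uA = midD[OF u]
  have "z \<sqsubseteq> v u" using inv_antimono[OF uA(1) w_in] uA(3) by (simp add: z_def)
  moreover have "v u \<sqsubseteq> w" using inv_antimono[OF z_in uA(1)] uA(2) by (simp add: vz)
  moreover have "z \<noteq> v u" using inv_eq_iff[OF w_in uA(1)] uA(3) by (auto simp: z_def)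
  moreover have "v u \<noteq> w" using inv_inv[OF uA(1)] uA(2) by (auto simp: z_def)
  ultimately show ?thesis using uA(1) by (simp add: mid_def)
qed

text \<open>The involution preserves incomparability, and among the three inner elements only
  \<open>q\<close> is incomparable to both others. So \<open>q\<close> is fixed, and
  \<open>v\<close> reverses the edge from \<open>p\<close> to \<open>t\<close>.\<close>

lemma pentagon:
  assumes p: "p \<in> cov" and q: "q \<in> cov" and t: "t \<in> mid" "t \<notin> cov" and mid: "mid = {p, q, t}"
    and pq: "p \<noteq> q" and pt: "jcov p t"
  shows "v p = t" "v q = q" "p \<parallel> q"
proof -
  note pA = covD[OF p] and qA = covD[OF q] and ptA = jcov_in[OF pt] jcov_lt[OF pt]
  show pq': "p \<parallel> q" using cov_incomp[OF p q pq] by blast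
  have "\<not> q \<sqsubseteq> t" using join_least[OF pA(3) qA(3) ptA(2)] ptA cov_incomp[OF p q pq] not_w_le_mid[OF t(1)] by auto
  moreover have "\<not> t \<sqsubseteq> q" using pq' ptA le_trans[OF pA(3) ptA(2) qA(3)] by blast
  ultimately have qt: "q \<parallel> t" by blast
  have vm: "v p \<in> {p, q, t}" "v q \<in> {p, q, t}" "v t \<in> {p, q, t}"
    using inv_mid[OF pA(2)] inv_mid[OF qA(2)] inv_mid[OF t(1)] mid by auto
  have vq: "v q \<parallel> v p" "v q \<parallel> v t" using pq' qt pA qA ptA by (simp_all add: inv_le_iff)
  have vlt: "v t \<sqsubset> v p" using ptA by (auto simp: inv_le_iff inv_eq_iff)
  have "\<not> p \<parallel> t" "p \<noteq> t" using ptA by auto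
  have not_tp: "\<not> t \<sqsubseteq> p" using ptA le_antisym by blast
  show vqq: "v q = q"
    using vm vq vlt \<open>\<not> p \<parallel> t\<close> le_refl pA qA ptA by (metis insertE singletonD)
  have "v p \<noteq> q" "v t \<noteq> q" using vq vqq qA le_refl by auto
  then show "v p = t" using vm vlt not_tp by auto
qed

lemma pentagon_not_pseudo_kleene:
  assumes "v p = t" "v q = q" "p \<parallel> q" "jcov p t" "q \<in> A"
  shows "\<not> pseudo_kleene A join meet v"
proof
  assume "pseudo_kleene A join meet v"
  then have "p \<sqinter> v p \<sqsubseteq> q \<squnion> v q"
    using assms jcov_in unfolding pseudo_kleene_def by blast
  then show False using assms jcov_in[OF assms(4)] jcov_lt[OF assms(4)]
    by (simp add: meet_absorb1 join_absorb1)
qed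

text \<open>In a Boolean lattice of congruences, the congruence generated by the involution-invariant
  edge \<open>(p, t)\<close> has a complement; as \<open>(z, p)\<close> forces \<open>(p, t)\<close>, it has to contain \<open>(z, p)\<close> as well.\<close>

lemma pentagon_boolean:
  assumes p: "p \<in> cov" and q: "q \<in> cov" "p \<noteq> q" and t: "t \<in> mid" "t \<notin> cov"
    and pt: "jcov p t" "v p = t" and bool: "boolean_family BI"
  shows "card Cong \<le> 2 ^ (card JI - 1)"
  unfolding card_Cong_eq
proof (rule card_family_equivalent[OF finite_JI family])
  \<comment> \<open>The least congruence collapsing this edge is invariant because \<open>v\<close>
    exchanges \<open>p\<close> and \<open>t\<close>.\<close>
  define \<theta> where "\<theta> = \<Inter> {\<phi> \<in> Cong. (p, t) \<in> \<phi>}"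
  note pA = covD[OF p] and ptA = jcov_in[OF pt(1)] jcov_lt[OF pt(1)]
  have vt: "v t = p" using pt(2) inv_inv[OF pA(3)] by simp
  have full: "A \<times> A \<in> {\<phi> \<in> Cong. (p, t) \<in> \<phi>}" using full_in_Cong ptA by simp
  have \<theta>: "\<theta> \<in> Cong"
  proof (rule CongI)
    show "\<theta> \<subseteq> A \<times> A" using full unfolding \<theta>_def by blast
  qed (auto simp: \<theta>_def cong_refl cong_join cong_meet intro: cong_sym cong_trans)
  have pt\<theta>: "(p, t) \<in> \<theta>" unfolding \<theta>_def by blast
  have "(v a, v b) \<in> \<theta>" if ab: "(a, b) \<in> \<theta>" for a b
    unfolding \<theta>_def
  proof
    fix \<phi> assume \<phi>: "\<phi> \<in> {\<phi> \<in> Cong. (p, t) \<in> \<phi>}"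
    then have "(t, p) \<in> \<phi>" using cong_sym by blast
    then have "inv_cong \<phi> \<in> {\<phi> \<in> Cong. (p, t) \<in> \<phi>}"
      using \<phi> inv_cong_in ptA pt(2) vt by (simp add: inv_cong_def)
    then have "(a, b) \<in> inv_cong \<phi>" using ab unfolding \<theta>_def by blast
    then show "(v a, v b) \<in> \<phi>" by (simp add: inv_cong_def)
  qed
  then have "\<theta> \<in> BI" using \<theta> by (simp add: BI_iff)
  then obtain \<phi> where \<phi>: "\<phi> \<in> BI" "coll \<phi> = JI - coll \<theta>"
    using bool by (auto simp: BI.boolean_family_iff coll_full)
  have "t \<in> coll \<theta>" using pt\<theta> coll_iff[OF pt(1)] by simp
  then have "t \<notin> coll \<phi>" using \<phi>(2) by simp
  then have "p \<notin> coll \<phi>" using cov_forces[OF BI_Cong[OF \<phi>(1)] p _ q t] by blast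
  then have p\<theta>: "p \<in> coll \<theta>" using \<phi>(2) cov_JI[OF p] by blast
  show "p \<in> S \<longleftrightarrow> t \<in> S" if S: "S \<in> coll ` Cong" for S
  proof -
    obtain \<psi> where \<psi>: "\<psi> \<in> Cong" "S = coll \<psi>" using S by blast
    have "p \<in> coll \<psi>" if "t \<in> coll \<psi>"
    proof -
      \<comment> \<open>Since \<theta> is generated by the edge of \<open>t\<close> and collapses
        \<open>p\<close>, every congruence collapsing \<open>t\<close> collapses \<open>p\<close>;
        the converse is \<open>cov_forces\<close>.\<close>
      have "\<theta> \<subseteq> \<psi>" using that \<psi>(1) coll_iff[OF pt(1)] unfolding \<theta>_def by blast
      then show ?thesis using p\<theta> unfolding coll_def by blast
    qed
    then show ?thesis using cov_forces[OF \<psi>(1) p _ q t] \<psi>(2) by blast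
  qed
qed (use p t cov_JI mid_JI in auto)

text \<open>Covers of \<open>z\<close> below two incomparable elements are distinct, since those
  elements meet in \<open>z\<close>. Exceeding half of the power set rules out a third cover and a
  second further inner element, and without a diamond exactly one further element \<open>t\<close>
  remains.\<close>

lemma gap:
  assumes "\<not> chain" "\<nexists>p q. diamond p q"
  shows "card Cong < 2 ^ card JI"
    and "pseudo_kleene A join meet v \<or> boolean_family BI \<Longrightarrow> card Cong \<le> 2 ^ (card JI - 1)"
proof -
  obtain x y where xy: "x \<in> A" "y \<in> A" "x \<parallel> y" using assms(1) unfolding chain_def by blast
  then have xm: "x \<in> mid" and ym: "y \<in> mid" using incomp_mid by blast+
  obtain p where p: "p \<in> cov" "p \<sqsubseteq> x" using cov_below[OF xm] by metis
  obtain q where q: "q \<in> cov" "q \<sqsubseteq> y" using cov_below[OF ym] by metis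
  note pA = covD[OF p(1)] and qA = covD[OF q(1)]
  have pq: "p \<noteq> q"
  proof
    assume "p = q"
    then have "p \<sqsubseteq> x \<sqinter> y" using p q xy pA by (simp add: meet_greatest)
    then show False using meet_incomp[OF xy] not_mid_le_z[OF pA(2)] by simp
  qed
  have "0 < card JI" using cov_JI[OF p(1)] finite_JI card_gt_0_iff by blast
  then have half: "(2::nat) ^ (card JI - 1) < 2 ^ card JI" by simp
  have "card Cong < 2 ^ card JI \<and>
    (pseudo_kleene A join meet v \<or> boolean_family BI \<longrightarrow> card Cong \<le> 2 ^ (card JI - 1))"
  proof (cases "card Cong \<le> 2 ^ (card JI - 1)")
    case True
    then show ?thesis using half by linarith
  next
    case False
    have cov: "cov = {p, q}"
      using False card_Cong_three_cov[OF p(1) q(1) _ pq] p q by blast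
    have "\<not> mid \<subseteq> {p, q}" using diamond_if_two_mid[OF p(1) q(1) pq] assms(2) by blast
    then obtain t where t: "t \<in> mid" "t \<notin> cov" using cov by blast
    have mid: "mid = {p, q, t}"
      using False card_Cong_two_above[OF p(1) q(1) pq, of t] t pA qA cov by blast
    obtain l where l: "jcov l t" "l \<in> mid" using mid_cases[OF t] by metis
    have "l = p \<or> l = q" using l mid jcov_lt[OF l(1)] by auto
    \<comment> \<open>Either of the two covers may be the one under \<open>t\<close>; it is named
      \<open>l\<close>, the other \<open>l'\<close>.\<close>
    then obtain l' where l': "l \<in> cov" "l' \<in> cov" "l \<noteq> l'" "mid = {l, l', t}"
      using p(1) q(1) pq mid by (metis insert_commute)
    note pent = pentagon[OF l'(1,2) t l'(4,3) l(1)]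
    have "\<not> pseudo_kleene A join meet v"
      using pentagon_not_pseudo_kleene[OF pent l(1) covD(3)[OF l'(2)]] .
    moreover have "\<not> boolean_family BI"
      using pentagon_boolean[OF l'(1-3) t l(1) pent(1)] False by blast
    ultimately show ?thesis using card_Cong_one_above[OF p(1) q(1) pq] t by blast
  qed
  then show "card Cong < 2 ^ card JI"
    and "pseudo_kleene A join meet v \<or> boolean_family BI \<Longrightarrow> card Cong \<le> 2 ^ (card JI - 1)"
    by blast+
qed

end

section \<open>The gap in terms of the number of elements\<close>

context finite_i_lattice
begin

lemma card_Cong_gap:
  assumes "\<not> chain" "\<nexists>p q. diamond p q"
  shows "3 \<le> card A" and "card Cong < 2 ^ (card A - 2)"
    and "pseudo_kleene A join meet v \<or> boolean_family BI \<Longrightarrow> card Cong \<le> 2 ^ (card A - 3)"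
proof -
  obtain x y where xy: "x \<in> A" "y \<in> A" "x \<parallel> y" using assms(1) unfolding chain_def by blast
  have "{\<bottom>, x, y} \<subseteq> A" using xy by simp
  then have "card {\<bottom>, x, y} \<le> card A" using finite_A by (rule card_mono[rotated])
  moreover have "\<bottom> \<noteq> x" "\<bottom> \<noteq> y" "x \<noteq> y" using xy bot_le by auto
  ultimately show 3: "3 \<le> card A" by simp
  have "card Cong < 2 ^ (card A - 2) \<and>
    (pseudo_kleene A join meet v \<or> boolean_family BI \<longrightarrow> card Cong \<le> 2 ^ (card A - 3))"
  proof (cases "card JI = card A - 2")
    case True
    have in_A: "\<bottom> \<in> A" "x \<squnion> y \<in> A" using xy by simp_all
    have JI: "JI = A - {\<bottom>, x \<squnion> y}"
      using card_JI_not_chain(2)[OF xy True] JI_subset by blast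
    interpret one_join_reducible A join meet v "x \<squnion> y" "v (x \<squnion> y)"
    proof
      fix a b assume ab: "a \<in> A" "b \<in> A" "a \<parallel> b"
      then have "a \<squnion> b \<in> A - JI" "a \<squnion> b \<noteq> \<bottom>" using join_not_JI by simp_all
      then show "a \<squnion> b = x \<squnion> y" using JI by blast
    qed (use JI in_A in simp_all)
    show ?thesis using gap[OF assms] True by simp
  next
    case False
    then have "card JI \<le> card A - 3" using card_JI_not_chain(1)[OF xy] by linarith
    then have "(2::nat) ^ card JI \<le> 2 ^ (card A - 3)" by (intro power_increasing) auto
    then have "card Cong \<le> 2 ^ (card A - 3)" using card_Cong_le by linarith
    moreover have "(2::nat) ^ (card A - 3) < 2 ^ (card A - 2)" using 3 by (intro power_strict_increasing) auto
    ultimately show ?thesis by linarith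
  qed
  then show "card Cong < 2 ^ (card A - 2)"
    and "pseudo_kleene A join meet v \<or> boolean_family BI \<Longrightarrow> card Cong \<le> 2 ^ (card A - 3)"
    by blast+
qed

lemma diamond_fixed_not_pseudo_kleene:
  assumes D: "diamond p q" and "v p = p"
  shows "\<not> pseudo_kleene A join meet v"
proof
  assume "pseudo_kleene A join meet v"
  note pq = diamond_in[OF D] diamond_incomp[OF D]
  have "v q = q" using diamond_inv(1)[OF D] assms(2) pq by auto
  have "p \<sqinter> v p \<sqsubseteq> q \<squnion> v q"
    using \<open>pseudo_kleene A join meet v\<close> pq unfolding pseudo_kleene_def by blast
  then show False using \<open>v q = q\<close> assms(2) pq by (simp add: meet_absorb1 join_absorb1)
qed

lemma glued_True_iff:
  "even (card A) \<and> card A \<ge> 4 \<and> iso_BI_glued A join meet v (card A div 2 - 1) True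
    \<longleftrightarrow> (\<exists>p q. diamond p q \<and> v p = q)"
  using diamond_if_glued[of _ True] diamond_glued by (metis (full_types))

lemma glued_False_iff:
  "iso_BI_glued A join meet v (card A div 2 - 1) False \<longleftrightarrow> (\<exists>p q. diamond p q \<and> v p = p)"
proof
  assume "iso_BI_glued A join meet v (card A div 2 - 1) False"
  then obtain p q where "diamond p q" "v p = p" using diamond_if_glued by (metis (full_types))
  then show "\<exists>p q. diamond p q \<and> v p = p" by blast
next
  assume "\<exists>p q. diamond p q \<and> v p = p"
  then obtain p q where pq: "diamond p q" "v p = p" by blast
  then have "(v p = q) = False" using diamond_in[OF pq(1)] diamond_incomp[OF pq(1)] le_refl by metis
  then show "iso_BI_glued A join meet v (card A div 2 - 1) False"
    using diamond_glued(3)[OF pq(1)] by simp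
qed

lemma glued_iff:
  "even (card A) \<and> card A \<ge> 4 \<and> iso_glued A join meet (card A div 2 - 1)
    \<longleftrightarrow> (\<exists>p q. diamond p q)"
  using diamond_if_lat_iso_glued diamond_glued
  unfolding iso_glued_def iso_BI_glued_def bi_iso_def by metis

lemma diamond_unique:
  assumes "diamond p q" "diamond p' q'"
  shows "v p = p \<longleftrightarrow> v p' = p'"
proof -
  have "{p', q'} = {p, q}"
    using diamond_only[OF assms(1) diamond_in[OF assms(2)] diamond_incomp[OF assms(2)]] .
  then show ?thesis
    using diamond_inv(1)[OF assms(1)] diamond_incomp[OF assms(1)] by (auto simp: doubleton_eq_iff)
qed

end

section \<open>Assembly of the classification and the counts\<close>

text \<open>For small \<open>n\<close> the exponents n-2 and n-3 are negative, and the real power is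
  then below 1, hence below \<open>c\<close>. Truncated subtraction would give 1 instead, so the
  side condition \<open>k \<le> n\<close> has to appear.\<close>

lemma le_two_powi_iff:
  fixes c n k :: nat
  assumes "c \<ge> 1"
  shows "real c \<le> 2 powi (int n - int k) \<longleftrightarrow> k \<le> n \<and> c \<le> 2 ^ (n - k)"
    and "real c < 2 powi (int n - int k) \<longleftrightarrow> k \<le> n \<and> c < 2 ^ (n - k)"
    and "real c = 2 powi (int n - int k) \<longleftrightarrow> k \<le> n \<and> c = 2 ^ (n - k)"
proof -
  have small: "2 powi (int n - int k) < real c" if "n < k"
  proof -
    have "2 powi (int n - int k) < (2::real) powi 0" using that by (intro power_int_strict_increasing) auto
    then show ?thesis using assms by simp
  qed
  have big: "2 powi (int n - int k) = real (2 ^ (n - k))" if "k \<le> n"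
    using that by (simp add: power_int_def nat_diff_distrib flip: of_nat_diff)
  show "real c \<le> 2 powi (int n - int k) \<longleftrightarrow> k \<le> n \<and> c \<le> 2 ^ (n - k)"
    and "real c < 2 powi (int n - int k) \<longleftrightarrow> k \<le> n \<and> c < 2 ^ (n - k)"
    and "real c = 2 powi (int n - int k) \<longleftrightarrow> k \<le> n \<and> c = 2 ^ (n - k)"
    using small big by (cases "k \<le> n"; simp only: of_nat_le_iff of_nat_less_iff of_nat_eq_iff; fastforce)+
qed

theorem theorem5p2:
  fixes A :: "'a set" and j m :: "'a \<Rightarrow> 'a \<Rightarrow> 'a" and v :: "'a \<Rightarrow> 'a" and n :: nat
  assumes L: "i_lattice A j m v"
    and cardA: "card A = n"
    and npos: "n \<ge> 1"
  shows
    \<comment> \<open>(1)\<close>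
    "card (ConBI A j m v) \<le> 2 ^ (n div 2)
   \<and> \<comment> \<open>(2)\<close>
    ((card (ConBI A j m v) = 2 ^ (n div 2) \<longleftrightarrow> iso_L2pow (ConBI A j m v) (n div 2))
     \<and> (iso_L2pow (ConBI A j m v) (n div 2) \<longleftrightarrow>
          iso_chain A j m n \<or> (even n \<and> n \<ge> 4 \<and> iso_BI_glued A j m v (n div 2 - 1) True))
     \<and> ((iso_chain A j m n \<or> (even n \<and> n \<ge> 4 \<and> iso_BI_glued A j m v (n div 2 - 1) True)) \<longleftrightarrow>
          card (Con A j m) = 2 ^ (n - 1)
          \<or> (n \<ge> 2 \<and> \<not> iso_BI_glued A j m v (n div 2 - 1) False \<and> card (Con A j m) = 2 ^ (n - 2)))
     \<and> ((card (Con A j m) = 2 ^ (n - 1)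
          \<or> (n \<ge> 2 \<and> \<not> iso_BI_glued A j m v (n div 2 - 1) False \<and> card (Con A j m) = 2 ^ (n - 2)))
        \<longleftrightarrow> iso_L2pow (Con A j m) (n - 1)
          \<or> (n \<ge> 2 \<and> \<not> iso_BI_glued A j m v (n div 2 - 1) False \<and> iso_L2pow (Con A j m) (n - 2))))
   \<and> \<comment> \<open>(3)\<close>
    (pseudo_kleene A j m v \<longrightarrow>
       (card (ConBI A j m v) = 2 ^ (n div 2) \<longleftrightarrow> iso_L2pow (ConBI A j m v) (n div 2))
     \<and> (iso_L2pow (ConBI A j m v) (n div 2) \<longleftrightarrow>
          iso_chain A j m n \<or> (even n \<and> n \<ge> 4 \<and> iso_glued A j m (n div 2 - 1)))
     \<and> ((iso_chain A j m n \<or> (even n \<and> n \<ge> 4 \<and> iso_glued A j m (n div 2 - 1))) \<longleftrightarrow>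
          real (card (Con A j m)) \<in> {2 powi (int n - 1), 2 powi (int n - 2)})
     \<and> (real (card (Con A j m)) \<in> {2 powi (int n - 1), 2 powi (int n - 2)} \<longleftrightarrow>
          iso_L2pow (Con A j m) (n - 1) \<or> (n \<ge> 2 \<and> iso_L2pow (Con A j m) (n - 2))))
   \<and> \<comment> \<open>(4)\<close>
    (card (ConBI A j m v) < 2 ^ (n div 2) \<longleftrightarrow>
       (even n \<and> n \<ge> 4 \<and> iso_BI_glued A j m v (n div 2 - 1) False)
       \<or> real (card (Con A j m)) < 2 powi (int n - 2))
   \<and> \<comment> \<open>(5)\<close>
    (pseudo_kleene A j m v \<longrightarrow>
       (card (ConBI A j m v) < 2 ^ (n div 2) \<longleftrightarrow> real (card (Con A j m)) < 2 powi (int n - 2))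
     \<and> (real (card (Con A j m)) < 2 powi (int n - 2) \<longleftrightarrow>
          real (card (Con A j m)) \<le> 2 powi (int n - 3)))
   \<and> \<comment> \<open>(6)\<close>
    ((boolean_family (Con A j m) \<longrightarrow> boolean_family (ConBI A j m v))
     \<and> (modular_lat A j m \<longrightarrow> boolean_family (Con A j m))
     \<and> (boolean_family (ConBI A j m v) \<longrightarrow>
          (card (ConBI A j m v) < 2 ^ (n div 2) \<longleftrightarrow>
             real (card (ConBI A j m v)) \<le> 2 powi (int (n div 2) - 1))
        \<and> (real (card (ConBI A j m v)) \<le> 2 powi (int (n div 2) - 1) \<longleftrightarrow>
             (even n \<and> n \<ge> 4 \<and> iso_BI_glued A j m v (n div 2 - 1) False)
             \<or> real (card (Con A j m)) < 2 powi (int n - 2))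
        \<and> (((even n \<and> n \<ge> 4 \<and> iso_BI_glued A j m v (n div 2 - 1) False)
             \<or> real (card (Con A j m)) < 2 powi (int n - 2)) \<longleftrightarrow>
           (even n \<and> n \<ge> 4 \<and> iso_BI_glued A j m v (n div 2 - 1) False)
             \<or> real (card (Con A j m)) \<le> 2 powi (int n - 3))))
   \<and> \<comment> \<open>(7)\<close>
    (pseudo_kleene A j m v \<and> boolean_family (ConBI A j m v) \<longrightarrow>
       (card (ConBI A j m v) < 2 ^ (n div 2) \<longleftrightarrow>
          real (card (ConBI A j m v)) \<le> 2 powi (int (n div 2) - 1))
     \<and> (real (card (ConBI A j m v)) \<le> 2 powi (int (n div 2) - 1) \<longleftrightarrow>
          real (card (Con A j m)) < 2 powi (int n - 2))
     \<and> (real (card (Con A j m)) < 2 powi (int n - 2) \<longleftrightarrow>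
          real (card (Con A j m)) \<le> 2 powi (int n - 3)))"
proof -
  have "finite A" "A \<noteq> {}" using cardA npos card_ge_0_finite[of A] by auto
  then interpret finite_i_lattice A j m v
    using L by unfold_locales (auto simp: i_lattice_def)
  \<comment> \<open>Chain, diamond with swapped pair and diamond with fixed pair exclude each other.
    Every cardinality condition is expressed through these three alternatives, so that the clauses
    become propositional.\<close>
  define chn dT dF where "chn \<longleftrightarrow> chain" and "dT \<longleftrightarrow> (\<exists>p q. diamond p q \<and> v p = q)"
    and "dF \<longleftrightarrow> (\<exists>p q. diamond p q \<and> v p = p)"
  define c b where "c = card (Con A j m)" and "b = card (ConBI A j m v)"
  have d: "(\<exists>p q. diamond p q) \<longleftrightarrow> dT \<or> dF"
    using diamond_inv(1) unfolding dT_def dF_def by blast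
  have chain_iff: "iso_chain A j m n \<longleftrightarrow> chn" using iso_chain_iff cardA by (simp add: chn_def)
  have gT: "even n \<and> n \<ge> 4 \<and> iso_BI_glued A j m v (n div 2 - 1) True \<longleftrightarrow> dT"
    using glued_True_iff cardA by (simp add: dT_def)
  have gF: "iso_BI_glued A j m v (n div 2 - 1) False \<longleftrightarrow> dF"
    using glued_False_iff cardA by (simp add: dF_def)
  have g: "even n \<and> n \<ge> 4 \<and> iso_glued A j m (n div 2 - 1) \<longleftrightarrow> dT \<or> dF"
    using glued_iff d cardA by simp
  have excl: "\<not> (chn \<and> dT)" "\<not> (chn \<and> dF)" "\<not> (dT \<and> dF)"
  proof -
    show "\<not> (chn \<and> dT)" "\<not> (chn \<and> dF)"
      using not_chain_diamond unfolding chn_def dT_def dF_def by blast+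
    show "\<not> (dT \<and> dF)"
    proof
      assume "dT \<and> dF"
      then obtain p q p' q' where D: "diamond p q" "v p = q" "diamond p' q'" "v p' = p'"
        unfolding dT_def dF_def by blast
      then have "p = q" using diamond_unique[OF D(1,3)] by simp
      then show False using diamond_in[OF D(1)] diamond_incomp[OF D(1)] by simp
    qed
  qed
  have big: "even n \<and> n \<ge> 4" if "dT \<or> dF" using g that by blast
  have n2: "n \<ge> 2" if "\<not> chn"
    using card_Cong_gap(1) d that big cardA unfolding chn_def by fastforce
  have c_chain: "c = 2 ^ (n - 1)" if chn using card_Cong_chain that cardA by (simp add: chn_def c_def)
  have c_diamond: "c = 2 ^ (n - 2)" if "dT \<or> dF"
    using card_Cong_diamond d that cardA by (auto simp: c_def)
  have gap: "c < 2 ^ (n - 2)" "n \<ge> 3" if "\<not> chn" "\<not> dT" "\<not> dF"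
    using card_Cong_gap(1,2) d that cardA by (simp_all add: chn_def c_def)
  have gap3: "c \<le> 2 ^ (n - 3)"
    if "\<not> chn" "\<not> dT" "\<not> dF" "pseudo_kleene A j m v \<or> boolean_family (ConBI A j m v)"
    using card_Cong_gap(3) d that cardA by (simp add: chn_def c_def)
  have b_le: "b \<le> 2 ^ (n div 2)" using card_BI_le cardA by (simp add: b_def)
  have b_eq: "b = 2 ^ (n div 2) \<longleftrightarrow> chn \<or> dT" using extremal_iff cardA by (simp add: b_def chn_def dT_def)
  have b_iso: "iso_L2pow (ConBI A j m v) (n div 2) \<longleftrightarrow> b = 2 ^ (n div 2)"
    using iso_L2pow_BI card_iso_L2pow cardA unfolding b_def by blast
  have c_iso1: "iso_L2pow (Con A j m) (n - 1) \<longleftrightarrow> c = 2 ^ (n - 1)"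
  proof
    show "iso_L2pow (Con A j m) (n - 1) \<Longrightarrow> c = 2 ^ (n - 1)" using card_iso_L2pow c_def by blast
    assume "c = 2 ^ (n - 1)"
    then have "(2::nat) ^ (n - 1) \<le> 2 ^ card JI" using card_Cong_le c_def by simp
    then have "card JI = n - 1" using card_JI_le cardA by simp
    then show "iso_L2pow (Con A j m) (n - 1)"
      using iso_L2pow_if_card_eq \<open>c = 2 ^ (n - 1)\<close> by (simp add: c_def)
  qed
  have pow: "(2::nat) ^ (n - 2) < 2 ^ (n - 1)" if "n \<ge> 2"
    using that by (intro power_strict_increasing) auto
  have c_cases: "c = 2 ^ (n - 1) \<longleftrightarrow> chn"
    "n \<ge> 2 \<Longrightarrow> c = 2 ^ (n - 2) \<longleftrightarrow> dT \<or> dF"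
    "n \<ge> 2 \<and> c < 2 ^ (n - 2) \<longleftrightarrow> \<not> chn \<and> \<not> dT \<and> \<not> dF"
    using c_chain c_diamond gap excl pow n2
    by (cases chn; cases "dT \<or> dF"; force)+
  have c_iso2: "iso_L2pow (Con A j m) (n - 2) \<longleftrightarrow> c = 2 ^ (n - 2)" if n: "n \<ge> 2"
  proof
    show "iso_L2pow (Con A j m) (n - 2) \<Longrightarrow> c = 2 ^ (n - 2)" using card_iso_L2pow c_def by blast
    assume c: "c = 2 ^ (n - 2)"
    \<comment> \<open>The cardinality alone only bounds \<open>card JI\<close> from below; the
      diamond gives its exact value.\<close>
    then obtain p q where "diamond p q" using c_cases(2)[OF n] d by blast
    then have "card JI = n - 2" using JI_diamond(2) cardA by simp
    then show "iso_L2pow (Con A j m) (n - 2)" using iso_L2pow_if_card_eq c by (simp add: c_def)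
  qed
  have pos: "c \<ge> 1" "b \<ge> 1"
    using finite_Cong full_in_Cong finite_BI BI.t_in card_gt_0_iff
    unfolding c_def b_def by (metis One_nat_def Suc_leI empty_iff)+
  have powi: "real c = 2 powi (int n - 1) \<longleftrightarrow> chn" "real c = 2 powi (int n - 2) \<longleftrightarrow> dT \<or> dF"
    "real c < 2 powi (int n - 2) \<longleftrightarrow> \<not> chn \<and> \<not> dT \<and> \<not> dF"
    "real c \<le> 2 powi (int n - 3) \<longleftrightarrow> n \<ge> 3 \<and> c \<le> 2 ^ (n - 3)"
    "real b \<le> 2 powi (int (n div 2) - 1) \<longleftrightarrow> n div 2 \<ge> 1 \<and> b \<le> 2 ^ (n div 2 - 1)"
  proof -
    note powi_c = le_two_powi_iff[OF pos(1), of n]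
    show "real c = 2 powi (int n - 1) \<longleftrightarrow> chn"
      using powi_c(3)[of 1] npos c_cases(1) by simp
    show "real c = 2 powi (int n - 2) \<longleftrightarrow> dT \<or> dF"
      using powi_c(3)[of 2, unfolded of_nat_numeral] c_cases(2) big by linarith
    show "real c < 2 powi (int n - 2) \<longleftrightarrow> \<not> chn \<and> \<not> dT \<and> \<not> dF"
      using powi_c(2)[of 2, unfolded of_nat_numeral] c_cases(3) by (simp only:)
    show "real c \<le> 2 powi (int n - 3) \<longleftrightarrow> n \<ge> 3 \<and> c \<le> 2 ^ (n - 3)"
      using powi_c(1)[of 3, unfolded of_nat_numeral] .
    show "real b \<le> 2 powi (int (n div 2) - 1) \<longleftrightarrow> n div 2 \<ge> 1 \<and> b \<le> 2 ^ (n div 2 - 1)"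
      using le_two_powi_iff(1)[OF pos(2), of "n div 2" 1, unfolded of_nat_1] .
  qed
  have c3: "n \<ge> 3 \<and> c \<le> 2 ^ (n - 3) \<longrightarrow> \<not> chn \<and> \<not> dT \<and> \<not> dF"
  proof
    assume c: "n \<ge> 3 \<and> c \<le> 2 ^ (n - 3)"
    then have "(2::nat) ^ (n - 3) < 2 ^ (n - 2)" by (intro power_strict_increasing) auto
    then have "n \<ge> 2 \<and> c < 2 ^ (n - 2)" using c by linarith
    then show "\<not> chn \<and> \<not> dT \<and> \<not> dF" using c_cases(3) by blast
  qed
  have c3': "n \<ge> 3 \<and> c \<le> 2 ^ (n - 3) \<longleftrightarrow> \<not> chn \<and> \<not> dT \<and> \<not> dF"
    if "pseudo_kleene A j m v \<or> boolean_family (ConBI A j m v)"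
    using c3 gap gap3 that by blast
  have pk: "\<not> dF" if "pseudo_kleene A j m v"
    using diamond_fixed_not_pseudo_kleene that unfolding dF_def by blast
  have b_less: "b < 2 ^ (n div 2) \<longleftrightarrow> \<not> chn \<and> \<not> dT" using b_le b_eq by linarith
  have b_half: "n div 2 \<ge> 1 \<and> b \<le> 2 ^ (n div 2 - 1) \<longleftrightarrow> \<not> chn \<and> \<not> dT"
    if "boolean_family (ConBI A j m v)"
  proof
    assume half: "n div 2 \<ge> 1 \<and> b \<le> 2 ^ (n div 2 - 1)"
    then have "(2::nat) ^ (n div 2 - 1) < 2 ^ (n div 2)" by (intro power_strict_increasing) auto
    then show "\<not> chn \<and> \<not> dT" using half b_less by linarith
  next
    assume "\<not> chn \<and> \<not> dT"
    then have less: "b < 2 ^ (n div 2)" using b_less by blast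
    \<comment> \<open>In the Boolean case \<open>b\<close> is a power of two, so being below 2^(n
      div 2) already means being at most half of it.\<close>
    have "\<And>a. BI.atom a \<Longrightarrow> \<exists>y\<in>ConBI A j m v. coll y = coll (A \<times> A) - coll a"
      using that BI.atom_in by (simp add: BI.boolean_family_iff)
    then obtain k where "iso_L2pow (ConBI A j m v) k" by (rule BI.iso_L2pow_if_complemented)
    then have b: "b = 2 ^ k" using card_iso_L2pow b_def by blast
    then have "k < n div 2" using less by simp
    then show "n div 2 \<ge> 1 \<and> b \<le> 2 ^ (n div 2 - 1)" using b by (simp add: power_increasing)
  qed
  have even_dF: "even n \<and> n \<ge> 4 \<and> dF \<longleftrightarrow> dF" using big by blast
  have two: "n \<ge> 2 \<and> \<not> dF \<and> c = 2 ^ (n - 2) \<longleftrightarrow> dT"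
    "n \<ge> 2 \<and> \<not> dF \<and> iso_L2pow (Con A j m) (n - 2) \<longleftrightarrow> dT"
    "n \<ge> 2 \<and> iso_L2pow (Con A j m) (n - 2) \<longleftrightarrow> dT \<or> dF"
    using c_cases(2) c_iso2 big excl(3) by auto
  show ?thesis
    unfolding c_def[symmetric] b_def[symmetric] chain_iff gT gF even_dF g b_iso b_eq c_iso1 c_cases(1)
      two b_less powi insert_iff empty_iff
    using b_le pk c3 c3' b_half excl boolean_BI_if_boolean_Con boolean_Con_if_modular
    by (intro conjI; blast)
qed

end
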